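(* Let $\Delta$ be a smooth fan in $N_{\mathbb R}$, $N\cong\mathbb Z^n$, with primitive edge vectors $v_1,\dots,v_d$, such that $X=X(\Delta)$ is connected, numbered so that $v_1,\dots,v_n$ form a basis of $N\otimes_{\mathbb Z}\mathbb Z_2$, with dual basis $u_1,\dots,u_n$ of $M\otimes_{\mathbb Z}\mathbb Z_2$. Put $a_{j,i}=\langle u_i,v_j\rangle\in\mathbb Z_2$ for $1\le j\le d$, $1\le i\le n$. For $\underline t=(t_1,\dots,t_n)\in\mathbb Z_2^n$ put $\underline b^j=(t_i+a_{j,i})_{i=1,\dots,n}$ and $\underline c^{p,q}=(t_i+a_{p,i}+a_{q,i})_{i=1,\dots,n}$ for $1\le j,p,q\le d$ (these depend on $\underline t$). Then $\pi_1(X)$ has a presentation with generators $$\{y_{j,\underline t}: 1\le j\le d,\ \underline t\in\mathbb Z_2^n\}$$ and relators $$\bigcup_{\underline t\in\mathbb Z_2^n}\{y_{1,(0,\dots,0)}^{t_1}\cdot y_{2,(t_1,0,\dots,0)}^{t_2}\cdots y_{n,(t_1,\dots,t_{n-1},0)}^{t_n}\},$$ $$\bigcup_{\underline t\in\mathbb Z_2^n}\{y_{j,\underline t}\cdot y_{j,\underline b^j}: 1\le j\le d\},$$ $$\bigcup_{\underline t\in\mathbb Z_2^n}\{y_{p,\underline t}\cdot y_{q,\underline b^p}\cdot y_{p,\underline c^{p,q}}\cdot y_{q,\underline b^q}: \langle v_p,v_q\rangle\in\Delta\},$$ where exponents $t_i\in\mathbb Z_2$ are read as integers $0$ or $1$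.
   Context: $N\cong\mathbb Z^n$, $M=\mathrm{Hom}(N,\mathbb Z)$, $N_{\mathbb R}=N\otimes\mathbb R$, $\mathbb Z_2=\mathbb Z/2$. A smooth fan is a finite fan of strongly convex rational polyhedral cones, each generated by part of a $\mathbb Z$-basis of $N$ (not necessarily complete); $v_1,\dots,v_d$ are the primitive lattice vectors along its one-dimensional cones. $\langle v_p,v_q\rangle$ denotes the cone generated by $v_p,v_q$ (whereas $\langle u_i,v_j\rangle$ is the dual pairing). The real toric variety $X(\Delta)$ is the set of real points of the complex toric variety of $\Delta$ with its classical topology: it is obtained by gluing $U_\sigma=\mathrm{Hom}_{sg}(\sigma^\vee\cap M,\mathbb R)$, $\sigma\in\Delta$ (homomorphisms from the additive semigroup to the multiplicative semigroup $\mathbb R$ sending $0$ to $1$). Connectedness of $X(\Delta)$ is equivalent to the $v_j$ spanning $N\otimes\mathbb Z_2$. *)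

theory Defs
  imports
    "HOL-Analysis.Analysis"
    "HOL-Algebra.Coset"
    "HOL-Algebra.Generated_Groups"
    "HOL-Library.Z2"
begin

section \<open>Lattices and smooth fans\<close>

text \<open>The ambient type \<open>'a\<close> plays the role of \<open>N\<^sub>\<real> = N \<otimes> \<real>\<close>, and the lattice \<open>N\<close> is a
  subset of it: the \<open>\<int>\<close>-span of an \<open>\<real>\<close>-basis. For a basis of such a lattice,
  \<open>\<int>\<close>-linear and \<open>\<real>\<close>-linear independence agree.\<close>

definition lattice_basis :: "'a::real_vector set \<Rightarrow> 'a set \<Rightarrow> bool" where
  "lattice_basis N B \<longleftrightarrow> finite B \<and> independent B \<and> span B = UNIV \<and>
     N = {\<Sum>b\<in>B. of_int (c b) *\<^sub>R b | c :: 'a \<Rightarrow> int. True}"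

definition lattice_of_rank :: "nat \<Rightarrow> 'a::real_vector set \<Rightarrow> bool" where
  "lattice_of_rank n N \<longleftrightarrow> (\<exists>B. lattice_basis N B \<and> card B = n)"

text \<open>\<open>M = Hom(N, \<int>)\<close>; a homomorphism \<open>N \<rightarrow> \<int>\<close> is identified with its unique
  \<open>\<real>\<close>-linear extension to \<open>N\<^sub>\<real>\<close>.\<close>

definition dual_lattice :: "'a::real_vector set \<Rightarrow> ('a \<Rightarrow> real) set" where
  "dual_lattice N = {u. linear u \<and> u ` N \<subseteq> \<int>}"

definition rational_polyhedral_cone :: "'a::real_vector set \<Rightarrow> 'a set \<Rightarrow> bool" where
  "rational_polyhedral_cone N \<sigma> \<longleftrightarrow> (\<exists>S. finite S \<and> S \<subseteq> N \<and> \<sigma> = convex_cone hull S)"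

definition strongly_convex_cone :: "'a::real_vector set \<Rightarrow> bool" where
  "strongly_convex_cone \<sigma> \<longleftrightarrow> convex_cone \<sigma> \<and> \<sigma> \<inter> uminus ` \<sigma> = {0}"

definition cone_face :: "'a::real_vector set \<Rightarrow> 'a set \<Rightarrow> bool" where
  "cone_face \<tau> \<sigma> \<longleftrightarrow>
     (\<exists>u :: 'a \<Rightarrow> real. linear u \<and> (\<forall>x\<in>\<sigma>. 0 \<le> u x) \<and> \<tau> = {x \<in> \<sigma>. u x = 0})"

definition fan :: "'a::real_vector set \<Rightarrow> 'a set set \<Rightarrow> bool" where
  "fan N \<Delta> \<longleftrightarrow> finite \<Delta> \<and>
     (\<forall>\<sigma>\<in>\<Delta>. rational_polyhedral_cone N \<sigma> \<and> strongly_convex_cone \<sigma>) \<and>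
     (\<forall>\<sigma>\<in>\<Delta>. \<forall>\<tau>. cone_face \<tau> \<sigma> \<longrightarrow> \<tau> \<in> \<Delta>) \<and>
     (\<forall>\<sigma>\<in>\<Delta>. \<forall>\<sigma>'\<in>\<Delta>. cone_face (\<sigma> \<inter> \<sigma>') \<sigma> \<and> cone_face (\<sigma> \<inter> \<sigma>') \<sigma>')"

definition smooth_fan :: "'a::real_vector set \<Rightarrow> 'a set set \<Rightarrow> bool" where
  "smooth_fan N \<Delta> \<longleftrightarrow> fan N \<Delta> \<and>
     (\<forall>\<sigma>\<in>\<Delta>. \<exists>B S. lattice_basis N B \<and> S \<subseteq> B \<and> \<sigma> = convex_cone hull S)"

definition primitive_vector :: "'a::real_vector set \<Rightarrow> 'a \<Rightarrow> bool" where
  "primitive_vector N v \<longleftrightarrow> v \<in> N \<and> v \<noteq> 0 \<and>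
     (\<forall>w\<in>N. \<forall>k :: int. v = of_int k *\<^sub>R w \<longrightarrow> \<bar>k\<bar> = 1)"

definition edge_vectors :: "'a::real_vector set \<Rightarrow> 'a set set \<Rightarrow> 'a set" where
  "edge_vectors N \<Delta> = {v. primitive_vector N v \<and> (\<exists>\<rho>\<in>\<Delta>. dim \<rho> = 1 \<and> v \<in> \<rho>)}"

section \<open>Reduction modulo 2\<close>

text \<open>\<open>N \<otimes> \<int>\<^sub>2 = N / 2N\<close>: the two conjuncts after membership say that the classes of
  \<open>v\<^sub>1, \<dots>, v\<^sub>n\<close> span \<open>N / 2N\<close> and are linearly independent there.\<close>

definition mod2_basis :: "'a::real_vector set \<Rightarrow> nat \<Rightarrow> (nat \<Rightarrow> 'a) \<Rightarrow> bool" where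
  "mod2_basis N n v \<longleftrightarrow> (\<forall>i\<in>{1..n}. v i \<in> N) \<and>
     (\<forall>w\<in>N. \<exists>c :: nat \<Rightarrow> int. w - (\<Sum>i=1..n. of_int (c i) *\<^sub>R v i) \<in> (\<lambda>w. 2 *\<^sub>R w) ` N) \<and>
     (\<forall>c :: nat \<Rightarrow> int. (\<Sum>i=1..n. of_int (c i) *\<^sub>R v i) \<in> (\<lambda>w. 2 *\<^sub>R w) ` N \<longrightarrow>
        (\<forall>i\<in>{1..n}. even (c i)))"

text \<open>The pairing \<open>M \<times> N \<rightarrow> \<int>\<close> followed by reduction modulo 2; the floor only converts
  an integer-valued real into an \<open>int\<close>.\<close>

definition pairing2 :: "('a \<Rightarrow> real) \<Rightarrow> 'a \<Rightarrow> bit" where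
  "pairing2 u v = of_int \<lfloor>u v\<rfloor>"

text \<open>The elements \<open>u\<^sub>i\<close> of \<open>M \<otimes> \<int>\<^sub>2 = M / 2M\<close> are given by arbitrary representatives
  in \<open>M\<close>; the pairing above depends only on their classes.\<close>

definition mod2_dual_basis ::
    "'a::real_vector set \<Rightarrow> nat \<Rightarrow> (nat \<Rightarrow> 'a) \<Rightarrow> (nat \<Rightarrow> 'a \<Rightarrow> real) \<Rightarrow> bool" where
  "mod2_dual_basis N n v u \<longleftrightarrow>
     (\<forall>i\<in>{1..n}. u i \<in> dual_lattice N) \<and>
     (\<forall>i\<in>{1..n}. \<forall>j\<in>{1..n}. pairing2 (u i) (v j) = (if i = j then 1 else 0))"

abbreviation Z2_vectors :: "nat \<Rightarrow> (nat \<Rightarrow> bit) set" where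
  "Z2_vectors n \<equiv> {1..n} \<rightarrow>\<^sub>E UNIV"

section \<open>The real toric variety\<close>

definition dual_semigroup :: "'a::real_vector set \<Rightarrow> 'a set \<Rightarrow> ('a \<Rightarrow> real) set" where
  "dual_semigroup N \<sigma> = {u \<in> dual_lattice N. \<forall>x\<in>\<sigma>. 0 \<le> u x}"

text \<open>\<open>U\<^sub>\<sigma> = Hom\<^sub>s\<^sub>g(\<sigma>\<^sup>\<or> \<inter> M, \<real>)\<close> with the topology of pointwise convergence. This is the
  classical topology: given generators \<open>u\<^sub>1, \<dots>, u\<^sub>k\<close> of \<open>\<sigma>\<^sup>\<or> \<inter> M\<close>, every coordinate is a
  monomial in those at \<open>u\<^sub>1, \<dots>, u\<^sub>k\<close>, so it is the topology induced from \<open>\<real>\<^sup>k\<close>.\<close>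

definition affine_chart :: "'a::real_vector set \<Rightarrow> 'a set \<Rightarrow> (('a \<Rightarrow> real) \<Rightarrow> real) topology" where
  "affine_chart N \<sigma> =
     subtopology (product_topology (\<lambda>_. euclideanreal) (dual_semigroup N \<sigma>))
       {x. x (\<lambda>_. 0) = 1 \<and>
           (\<forall>u\<in>dual_semigroup N \<sigma>. \<forall>w\<in>dual_semigroup N \<sigma>. x (\<lambda>z. u z + w z) = x u * x w)}"

text \<open>\<open>U\<^sub>\<sigma>\<close> and \<open>U\<^sub>\<sigma>\<^sub>'\<close> are glued along \<open>U\<^bsub>\<sigma> \<inter> \<sigma>'\<^esub>\<close>, which maps to both by restriction
  of homomorphisms.\<close>

definition chart_gluing ::
    "'a::real_vector set \<Rightarrow> 'a set set \<Rightarrow> (('a set \<times> (('a \<Rightarrow> real) \<Rightarrow> real)) \<times> ('a set \<times> (('a \<Rightarrow> real) \<Rightarrow> real))) set" where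
  "chart_gluing N \<Delta> =
     {((\<sigma>, restrict z (dual_semigroup N \<sigma>)), (\<sigma>', restrict z (dual_semigroup N \<sigma>'))) | \<sigma> \<sigma>' z.
        \<sigma> \<in> \<Delta> \<and> \<sigma>' \<in> \<Delta> \<and> z \<in> topspace (affine_chart N (\<sigma> \<inter> \<sigma>'))}"

definition quotient_topology :: "'b topology \<Rightarrow> ('b \<times> 'b) set \<Rightarrow> 'b set topology" where
  "quotient_topology T r = topology (\<lambda>W. W \<subseteq> topspace T // r \<and> openin T (\<Union>W))"

definition real_toric_variety ::
    "'a::real_vector set \<Rightarrow> 'a set set \<Rightarrow> ('a set \<times> (('a \<Rightarrow> real) \<Rightarrow> real)) set topology" where
  "real_toric_variety N \<Delta> =
     quotient_topology (sum_topology (affine_chart N) \<Delta>) (chart_gluing N \<Delta>)"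

lemma quotient_classes_disjoint:
  assumes "equiv A r" "W \<subseteq> A // r" "W' \<subseteq> A // r"
  shows "\<Union>(W \<inter> W') = \<Union>W \<inter> \<Union>W'"
proof
  show "\<Union>W \<inter> \<Union>W' \<subseteq> \<Union>(W \<inter> W')"
  proof
    fix x assume "x \<in> \<Union>W \<inter> \<Union>W'"
    then obtain C C' where C: "C \<in> W" "x \<in> C" "C' \<in> W'" "x \<in> C'" by auto
    then have "C = C'"
      using assms quotient_disj [OF assms(1), of C C'] by blast
    with C show "x \<in> \<Union>(W \<inter> W')" by blast
  qed
qed auto

lemma openin_quotient_topology:
  assumes "equiv (topspace T) r"
  shows "openin (quotient_topology T r) W \<longleftrightarrow> W \<subseteq> topspace T // r \<and> openin T (\<Union>W)"
proof -
  have "istopology (\<lambda>W. W \<subseteq> topspace T // r \<and> openin T (\<Union>W))"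
    unfolding istopology_def
  proof (intro conjI allI impI)
    fix W W'
    assume W: "W \<subseteq> topspace T // r \<and> openin T (\<Union>W)" "W' \<subseteq> topspace T // r \<and> openin T (\<Union>W')"
    then have "\<Union>(W \<inter> W') = \<Union>W \<inter> \<Union>W'"
      by (intro quotient_classes_disjoint [OF assms]) auto
    with W show "openin T (\<Union>(W \<inter> W'))" by (simp only: openin_Int)
  next
    fix K assume K: "\<forall>W\<in>K. W \<subseteq> topspace T // r \<and> openin T (\<Union>W)"
    have "\<Union>(\<Union>K) = \<Union>(Union ` K)" by auto
    then show "openin T (\<Union>(\<Union>K))" using K by (auto intro: openin_Union)
  qed auto
  then show ?thesis
    by (simp add: quotient_topology_def topology_inverse')
qed

lemma topspace_quotient_topology:
  assumes "equiv (topspace T) r"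
  shows "topspace (quotient_topology T r) = topspace T // r"
proof -
  have "openin (quotient_topology T r) (topspace T // r)"
    by (simp add: openin_quotient_topology [OF assms] Union_quotient [OF assms])
  then show ?thesis
    by (metis assms openin_quotient_topology openin_subset openin_topspace subset_antisym)
qed

section \<open>The fundamental group\<close>

definition loops_at :: "'b topology \<Rightarrow> 'b \<Rightarrow> (real \<Rightarrow> 'b) set" where
  "loops_at X x = {p. pathin X p \<and> p 0 = x \<and> p 1 = x}"

definition loop_homotopy :: "'b topology \<Rightarrow> 'b \<Rightarrow> ((real \<Rightarrow> 'b) \<times> (real \<Rightarrow> 'b)) set" where
  "loop_homotopy X x = {(p, q). p \<in> loops_at X x \<and> q \<in> loops_at X x \<and>
     homotopic_with (\<lambda>r. r 0 = x \<and> r 1 = x) (top_of_set {0..1}) X p q}"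

text \<open>The library's \<^const>\<open>joinpaths\<close> is confined to types of class
  \<^class>\<open>topological_space\<close>.\<close>

definition join_loops :: "(real \<Rightarrow> 'b) \<Rightarrow> (real \<Rightarrow> 'b) \<Rightarrow> real \<Rightarrow> 'b" where
  "join_loops p q = (\<lambda>s. if s \<le> 1/2 then p (2 * s) else q (2 * s - 1))"

definition fundamental_group :: "'b topology \<Rightarrow> 'b \<Rightarrow> (real \<Rightarrow> 'b) set monoid" where
  "fundamental_group X x =
     \<lparr>carrier = loops_at X x // loop_homotopy X x,
      mult = (\<lambda>A B. \<Union>p\<in>A. \<Union>q\<in>B. loop_homotopy X x `` {join_loops p q}),
      one = loop_homotopy X x `` {\<lambda>_. x}\<rparr>"

section \<open>Groups given by generators and relators\<close>

text \<open>The letter \<open>(g, True)\<close> stands for the generator \<open>g\<close> and \<open>(g, False)\<close> for its inverse.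
  Elements of the free group are the reduced words.\<close>

type_synonym 'g letter = "'g \<times> bool"

definition inv_letter :: "'g letter \<Rightarrow> 'g letter" where
  "inv_letter x = (fst x, \<not> snd x)"

fun push_letter :: "'g letter \<Rightarrow> 'g letter list \<Rightarrow> 'g letter list" where
  "push_letter x [] = [x]"
| "push_letter x (y # w) = (if y = inv_letter x then w else x # y # w)"

abbreviation reduced :: "'g letter list \<Rightarrow> bool" where
  "reduced \<equiv> successively (\<lambda>x y. y \<noteq> inv_letter x)"

definition free_group :: "'g set \<Rightarrow> 'g letter list monoid" where
  "free_group S =
     \<lparr>carrier = {w \<in> lists (S \<times> UNIV). reduced w}, mult = foldr push_letter, one = []\<rparr>"

definition normal_closure :: "('b, 'c) monoid_scheme \<Rightarrow> 'b set \<Rightarrow> 'b set" where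
  "normal_closure G R = generate G {g \<otimes>\<^bsub>G\<^esub> r \<otimes>\<^bsub>G\<^esub> inv\<^bsub>G\<^esub> g | g r. g \<in> carrier G \<and> r \<in> R}"

text \<open>Relators are arbitrary words; \<open>foldr push_letter w []\<close> is the reduced form of \<open>w\<close>.\<close>

definition presented_group :: "'g set \<Rightarrow> 'g letter list set \<Rightarrow> 'g letter list set monoid" where
  "presented_group S R =
     free_group S Mod normal_closure (free_group S) ((\<lambda>w. foldr push_letter w []) ` R)"

lemma inv_letter_invol [simp]: "inv_letter (inv_letter x) = x"
  by (simp add: inv_letter_def)

lemma inv_letter_neq [simp]: "inv_letter x \<noteq> x"
  by (metis inv_letter_def snd_conv)

lemma reduced_push [simp]: "reduced w \<Longrightarrow> reduced (push_letter x w)"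
  by (cases w) (auto simp: successively_Cons)

lemma reduced_foldr_push [simp]: "reduced w \<Longrightarrow> reduced (foldr push_letter u w)"
  by (induction u) auto

lemma push_inv_push:
  assumes "reduced w"
  shows "push_letter x (push_letter (inv_letter x) w) = w"
proof (cases w)
  case (Cons y w')
  then show ?thesis using assms by (cases w') auto
qed auto

lemma foldr_push_push:
  assumes "reduced w"
  shows "foldr push_letter (push_letter x u) w = push_letter x (foldr push_letter u w)"
  using assms by (cases u) (auto simp: push_inv_push)

lemma foldr_push_assoc:
  assumes "reduced w"
  shows "foldr push_letter (foldr push_letter u v) w = foldr push_letter u (foldr push_letter v w)"
  using assms by (induction u) (auto simp: foldr_push_push)

lemma foldr_push_Nil: "reduced w \<Longrightarrow> foldr push_letter w [] = w"
proof (induction w)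
  case (Cons x w)
  then show ?case by (cases w) auto
qed auto

lemma foldr_push_inverse:
  assumes "reduced w"
  shows "foldr push_letter (rev (map inv_letter u)) (foldr push_letter u w) = w"
proof (induction u)
  case (Cons x u)
  have "push_letter (inv_letter x) (push_letter x (foldr push_letter u w)) = foldr push_letter u w"
    using push_inv_push [of "foldr push_letter u w" "inv_letter x"] assms by simp
  with Cons show ?case by simp
qed auto

lemma push_in_lists: "x \<in> S \<times> UNIV \<Longrightarrow> w \<in> lists (S \<times> UNIV) \<Longrightarrow> push_letter x w \<in> lists (S \<times> UNIV)"
  by (cases w) auto

lemma foldr_push_in_lists:
  "u \<in> lists (S \<times> UNIV) \<Longrightarrow> w \<in> lists (S \<times> UNIV) \<Longrightarrow> foldr push_letter u w \<in> lists (S \<times> UNIV)"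
proof (induction u)
  case (Cons x u)
  then have "foldr push_letter u w \<in> lists (S \<times> UNIV)" "x \<in> S \<times> UNIV" by auto
  then show ?case using push_in_lists [of x S] by simp
qed auto

lemma reduced_inverse: "reduced u \<Longrightarrow> reduced (rev (map inv_letter u))"
  by (auto simp: successively_map elim!: successively_mono)

lemma group_free_group: "group (free_group S)"
proof (rule groupI)
  fix u assume u: "u \<in> carrier (free_group S)"
  show "\<exists>u'\<in>carrier (free_group S). u' \<otimes>\<^bsub>free_group S\<^esub> u = \<one>\<^bsub>free_group S\<^esub>"
  proof
    show "rev (map inv_letter u) \<in> carrier (free_group S)"
      using u reduced_inverse [of u] by (auto simp: free_group_def in_lists_conv_set inv_letter_def)
    show "rev (map inv_letter u) \<otimes>\<^bsub>free_group S\<^esub> u = \<one>\<^bsub>free_group S\<^esub>"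
      using u foldr_push_inverse [of "[]" u] foldr_push_Nil [of u] by (simp add: free_group_def)
  qed
next
  fix u w assume "u \<in> carrier (free_group S)" "w \<in> carrier (free_group S)"
  then show "u \<otimes>\<^bsub>free_group S\<^esub> w \<in> carrier (free_group S)"
    using foldr_push_in_lists [of u S w] by (simp add: free_group_def)
qed (auto simp: free_group_def foldr_push_assoc)

lemma normal_normal_closure:
  assumes "group G" "R \<subseteq> carrier G"
  shows "normal_closure G R \<lhd> G"
proof -
  interpret group G by fact
  show ?thesis
    unfolding normal_closure_def
  proof (rule normal_generateI)
    show "{g \<otimes>\<^bsub>G\<^esub> r \<otimes>\<^bsub>G\<^esub> inv\<^bsub>G\<^esub> g |g r. g \<in> carrier G \<and> r \<in> R} \<subseteq> carrier G"
      using assms(2) by auto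
  next
    fix h g
    assume "h \<in> {g \<otimes>\<^bsub>G\<^esub> r \<otimes>\<^bsub>G\<^esub> inv\<^bsub>G\<^esub> g |g r. g \<in> carrier G \<and> r \<in> R}" and g: "g \<in> carrier G"
    then obtain k r where k: "h = k \<otimes>\<^bsub>G\<^esub> r \<otimes>\<^bsub>G\<^esub> inv\<^bsub>G\<^esub> k" "k \<in> carrier G" "r \<in> R" "r \<in> carrier G"
      using assms(2) by auto
    then have "g \<otimes>\<^bsub>G\<^esub> h \<otimes>\<^bsub>G\<^esub> inv\<^bsub>G\<^esub> g = (g \<otimes>\<^bsub>G\<^esub> k) \<otimes>\<^bsub>G\<^esub> r \<otimes>\<^bsub>G\<^esub> inv\<^bsub>G\<^esub> (g \<otimes>\<^bsub>G\<^esub> k)"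
      using g by (simp add: m_assoc inv_mult_group)
    then show "g \<otimes>\<^bsub>G\<^esub> h \<otimes>\<^bsub>G\<^esub> inv\<^bsub>G\<^esub> g \<in> {g \<otimes>\<^bsub>G\<^esub> r \<otimes>\<^bsub>G\<^esub> inv\<^bsub>G\<^esub> g |g r. g \<in> carrier G \<and> r \<in> R}"
      using k g by blast
  qed
qed

lemma group_presented_group:
  assumes "R \<subseteq> lists (S \<times> UNIV)"
  shows "group (presented_group S R)"
proof -
  have "(\<lambda>w. foldr push_letter w []) ` R \<subseteq> carrier (free_group S)"
    using assms foldr_push_in_lists [of _ S "[]"] by (auto simp: free_group_def)
  then show ?thesis
    unfolding presented_group_def
    by (intro normal.factorgroup_is_group normal_normal_closure group_free_group)
qed

section \<open>The words occurring in the presentation\<close>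

definition y_letter :: "nat \<Rightarrow> (nat \<Rightarrow> bit) \<Rightarrow> (nat \<times> (nat \<Rightarrow> bit)) letter" where
  "y_letter j t = ((j, t), True)"

text \<open>\<open>(t\<^sub>1, \<dots>, t\<^bsub>k-1\<^esub>, 0, \<dots>, 0) \<in> \<int>\<^sub>2\<^sup>n\<close>\<close>

definition truncate_before :: "nat \<Rightarrow> nat \<Rightarrow> (nat \<Rightarrow> bit) \<Rightarrow> nat \<Rightarrow> bit" where
  "truncate_before n k t = (\<lambda>i\<in>{1..n}. if i < k then t i else 0)"

text \<open>The product of the powers \<open>y\<^sub>k ^ t\<^sub>k\<close> for \<open>k = 1, \<dots>, n\<close>, the \<open>k\<close>-th generator being indexed
  by the truncation above.\<close>

definition base_path_word :: "nat \<Rightarrow> (nat \<Rightarrow> bit) \<Rightarrow> (nat \<times> (nat \<Rightarrow> bit)) letter list" where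
  "base_path_word n t =
     concat (map (\<lambda>k. if t k = 1 then [y_letter k (truncate_before n k t)] else []) [1..<Suc n])"

end

theory Submission
  imports Defs
begin

text \<open>The affine charts \<open>U\<^sub>\<sigma>\<close> have simply connected components, and each of them contains base points
  of components of the torus. Going from the component \<open>t\<close> to the component \<open>t + v\<^sub>j\<close> across the divisor
  of \<open>v\<^sub>j\<close> gives the path \<open>y\<^bsub>j,t\<^esub>\<close>. Every loop is, by a Lebesgue number argument, a product of such
  paths closed up along the base paths; the relators along the base paths telescope, and each of the
  others is null-homotopic because it is a loop in one chart. So the presented group maps onto \<open>\<pi>\<^sub>1\<close>.
  Injectivity: let \<open>P\<close> be the presented
  group. The generators give a locally constant \<open>P\<close>-valued cocycle on the closed cover of \<open>X\<close> by the
  closures of the components of the torus (well defined since the edges of a smooth cone are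
  independent modulo \<open>2\<close>), and its monodromy is a homomorphism from \<open>\<pi>\<^sub>1\<close> to \<open>P\<close> that inverts the
  first map up to conjugation.\<close>

section \<open>Paths in abstract topological spaces\<close>

text \<open>The obstacle to injectivity is that a path may run inside the divisors and cross them in
  no orderly way, so no word can be read off it directly. A point of a divisor therefore carries
  several indices at once, one for each torus component with the point in its closure, and only the
  semicontinuity of this index set is used: nearby points have fewer indices. A lift of a path is a
  locally constant family of values in \<open>P\<close>, one for each index, related by the cocycle;
  this does the work of a covering space without constructing it. Smoothness enters through parity:
  the generators of a cone are part of a lattice basis, so a closed walk with labels from one cone
  uses every label an even number of times, and the two-letter and four-letter relators reduce its
  word to the identity. The value of a walk in one chart thus depends only on its ends. The base
  point of the fundamental group is arbitrary and may lie on a divisor; the monodromy then returns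
  all generators conjugated by one common element, and this does not change which words are
  trivial.\<close>

abbreviation unit_square :: "(real \<times> real) set" where
  "unit_square \<equiv> {0..1} \<times> {0..1}"

text \<open>The first coordinate of the square is the time of the homotopy, the second the parameter
  of the path. The square is spelled out because lifts over it will give the homotopy invariance of
  monodromy.\<close>

definition path_homotopic :: "'b topology \<Rightarrow> (real \<Rightarrow> 'b) \<Rightarrow> (real \<Rightarrow> 'b) \<Rightarrow> bool" where
  "path_homotopic X p q \<longleftrightarrow> (\<exists>h. continuous_map (top_of_set unit_square) X h \<and>
     (\<forall>s\<in>{0..1}. h (0, s) = p s \<and> h (1, s) = q s) \<and>
     (\<forall>r\<in>{0..1}. h (r, 0) = p 0 \<and> h (r, 1) = p 1))"

lemma path_homotopic_iff_homotopic_with: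
  "path_homotopic X p q \<longleftrightarrow>
     homotopic_with (\<lambda>r. r 0 = p 0 \<and> r 1 = p 1) (top_of_set {0..1}) X p q"
  by (subst homotopic_with) (auto simp: path_homotopic_def)

lemma path_homotopic_imp_pathin:
  assumes "path_homotopic X p q"
  shows "pathin X p" "pathin X q"
  using homotopic_with_imp_continuous_maps assms
  unfolding path_homotopic_iff_homotopic_with pathin_def by blast+

lemma path_homotopic_ends:
  assumes "path_homotopic X p q"
  shows "q 0 = p 0" "q 1 = p 1"
proof -
  obtain h :: "real \<times> real \<Rightarrow> 'a" where "\<forall>s\<in>{0..1}. h (0, s) = p s \<and> h (1, s) = q s"
     "\<forall>r\<in>{0..1}. h (r, 0) = p 0 \<and> h (r, 1) = p 1"
    using assms unfolding path_homotopic_def by blast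
  then show "q 0 = p 0" "q 1 = p 1" by (metis atLeastAtMost_iff order_refl zero_le_one)+
qed

lemma path_homotopic_eq:
  assumes "pathin X p" "\<And>s. 0 \<le> s \<Longrightarrow> s \<le> 1 \<Longrightarrow> q s = p s"
  shows "path_homotopic X p q"
  using assms unfolding path_homotopic_iff_homotopic_with pathin_def
  by (intro homotopic_with_equal) auto

lemma path_homotopic_refl: "pathin X p \<Longrightarrow> path_homotopic X p p"
  by (simp add: path_homotopic_eq)

lemma path_homotopic_sym:
  assumes "path_homotopic X p q" shows "path_homotopic X q p"
  using homotopic_with_symD [of _ _ _ p q] assms path_homotopic_ends [OF assms]
  unfolding path_homotopic_iff_homotopic_with by fastforce

lemma path_homotopic_trans [trans]:
  assumes "path_homotopic X p q" "path_homotopic X q r" shows "path_homotopic X p r"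
  using homotopic_with_trans [of _ _ _ p q r] assms path_homotopic_ends [OF assms(1)]
  unfolding path_homotopic_iff_homotopic_with by fastforce

section \<open>Reversal, subpaths and concatenation up to homotopy\<close>

definition reverse_path :: "(real \<Rightarrow> 'b) \<Rightarrow> real \<Rightarrow> 'b" where
  "reverse_path p = (\<lambda>s. p (1 - s))"

definition subpath_of :: "real \<Rightarrow> real \<Rightarrow> (real \<Rightarrow> 'b) \<Rightarrow> real \<Rightarrow> 'b" where
  "subpath_of a b p = (\<lambda>s. p (a + (b - a) * s))"

lemma join_loops_ends [simp]: "join_loops p q 0 = p 0" "join_loops p q 1 = q 1"
  by (simp_all add: join_loops_def)

lemma reverse_path_ends [simp]: "reverse_path p 0 = p 1" "reverse_path p 1 = p 0"
  by (simp_all add: reverse_path_def)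

lemma subpath_of_ends [simp]: "subpath_of a b p 0 = p a" "subpath_of a b p 1 = p b"
  by (simp_all add: subpath_of_def)

text \<open>The parameter set \<open>K\<close> lets one pasting serve twice: it concatenates
  homotopies, and applied to functions constant in the parameter it concatenates paths.\<close>

lemma continuous_map_join:
  assumes f: "continuous_map (top_of_set (K \<times> {0..1})) X f"
    and g: "continuous_map (top_of_set (K \<times> {0..1})) X g"
    and fg: "\<And>r. r \<in> K \<Longrightarrow> f (r, 1) = g (r, 0)"
  shows "continuous_map (top_of_set (K \<times> {0..1::real})) X
    (\<lambda>(r, s). if s \<le> 1/2 then f (r, 2 * s) else g (r, 2 * s - 1))"
proof -
  have "continuous_map (top_of_set (K \<times> {0..1})) X
    (\<lambda>x. if snd x \<le> 1/2 then (f \<circ> (\<lambda>x. (fst x, 2 * snd x))) x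
                      else (g \<circ> (\<lambda>x. (fst x, 2 * snd x - 1))) x)"
  proof (rule continuous_map_cases_le)
    show "continuous_map (subtopology (top_of_set (K \<times> {0..1}))
        {x \<in> topspace (top_of_set (K \<times> {0..1})). snd x \<le> 1/2}) X (f \<circ> (\<lambda>x. (fst x, 2 * snd x)))"
      by (rule continuous_map_compose [OF _ f])
        (auto simp: subtopology_subtopology intro!: continuous_intros)
    show "continuous_map (subtopology (top_of_set (K \<times> {0..1}))
        {x \<in> topspace (top_of_set (K \<times> {0..1})). 1/2 \<le> snd x}) X (g \<circ> (\<lambda>x. (fst x, 2 * snd x - 1)))"
      by (rule continuous_map_compose [OF _ g])
        (auto simp: subtopology_subtopology intro!: continuous_intros)
    fix x :: "'a \<times> real" assume "x \<in> topspace (top_of_set (K \<times> {0..1}))" "snd x = 1 / 2"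
    then have "fst x \<in> K" "2 * snd x = 1" by auto
    then show "(f \<circ> (\<lambda>x. (fst x, 2 * snd x))) x = (g \<circ> (\<lambda>x. (fst x, 2 * snd x - 1))) x"
      using fg [of "fst x"] by (cases x) auto
  qed (auto intro!: continuous_intros)
  then show ?thesis
    by (simp add: case_prod_unfold comp_def cong: if_cong)
qed

lemma pathin_reparam:
  assumes "pathin X p" "continuous_on {0..1} f" "f \<in> {0..1} \<rightarrow> {0..1}"
  shows "pathin X (p \<circ> f)"
  using assms unfolding pathin_def
  by (intro continuous_map_compose [of _ "top_of_set {0..1}"]) auto

text \<open>Convex combinations of two reparametrisations stay in the unit interval, so one can be
  deformed into the other before \<open>p\<close> is applied. The associativity, unit and inverse
  laws all come down to this.\<close>

lemma path_homotopic_reparam: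
  assumes p: "pathin X p" and f: "continuous_on {0..1} f" "f \<in> {0..1} \<rightarrow> {0..1}"
    and g: "continuous_on {0..1} g" "g \<in> {0..1} \<rightarrow> {0..1}"
    and ends: "f 0 = g 0" "f 1 = g 1"
  shows "path_homotopic X (p \<circ> f) (p \<circ> g)"
proof -
  let ?h = "\<lambda>x. (1 - fst x) * f (snd x) + fst x * g (snd x)"
  have "continuous_map (top_of_set unit_square) (top_of_set {0..1}) ?h"
  proof -
    have "continuous_on unit_square ?h"
      by (intro continuous_intros continuous_on_compose2 [OF f(1)] continuous_on_compose2 [OF g(1)]) auto
    moreover have "?h x \<in> {0..1}" if "x \<in> unit_square" for x
    proof -
      have "f (snd x) \<in> {0..1}" "g (snd x) \<in> {0..1}" "0 \<le> fst x" "fst x \<le> 1"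
        using that f(2) g(2) by auto
      then show ?thesis
        using convex_bound_le [of "f (snd x)" 1 "g (snd x)" "1 - fst x" "fst x"] by auto
    qed
    ultimately show ?thesis by auto
  qed
  then have "continuous_map (top_of_set unit_square) X (p \<circ> ?h)"
    using p continuous_map_compose unfolding pathin_def by blast
  moreover have "(1 - r) * f 1 + r * g 1 = f 1" "(1 - r) * f 0 + r * g 0 = f 0" for r
    by (simp_all add: ends algebra_simps)
  ultimately show ?thesis
    unfolding path_homotopic_def by (intro exI [of _ "p \<circ> ?h"]) auto
qed

text \<open>A path is a homotopy that is constant in time; what is shown for squares thereby applies
  to paths, including the existence of lifts.\<close>

lemma pathin_iff_cylinder:
  "pathin X p \<longleftrightarrow> continuous_map (top_of_set unit_square) X (p \<circ> snd)"
proof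
  assume "pathin X p"
  then show "continuous_map (top_of_set unit_square) X (p \<circ> snd)"
    unfolding pathin_def
    by (intro continuous_map_compose [of _ "top_of_set {0..1}"]) (auto intro!: continuous_intros)
next
  assume c: "continuous_map (top_of_set unit_square) X (p \<circ> snd)"
  have "continuous_map (top_of_set {0..1}) X ((p \<circ> snd) \<circ> (\<lambda>s. (0::real, s)))"
    by (rule continuous_map_compose [OF _ c]) (auto intro!: continuous_intros)
  then show "pathin X p"
    by (simp add: pathin_def o_def)
qed

lemma pathin_join:
  assumes "pathin X p" "pathin X q" "p 1 = q 0"
  shows "pathin X (join_loops p q)"
proof -
  have "continuous_map (top_of_set unit_square) X
     (\<lambda>(r, s). if s \<le> 1/2 then (p \<circ> snd) (r, 2 * s) else (q \<circ> snd) (r, 2 * s - 1))"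
    using assms by (intro continuous_map_join) (auto simp: pathin_iff_cylinder o_def)
  then show ?thesis
    by (simp add: pathin_iff_cylinder join_loops_def case_prod_unfold comp_def cong: if_cong)
qed

lemma path_homotopic_join:
  assumes p: "path_homotopic X p p'" and q: "path_homotopic X q q'" and "p 1 = q 0"
  shows "path_homotopic X (join_loops p q) (join_loops p' q')"
proof -
  obtain h where h: "continuous_map (top_of_set unit_square) X h"
    "\<forall>s\<in>{0..1}. h (0, s) = p s \<and> h (1, s) = p' s" "\<forall>r\<in>{0..1}. h (r, 0) = p 0 \<and> h (r, 1) = p 1"
    using p unfolding path_homotopic_def by blast
  obtain k where k: "continuous_map (top_of_set unit_square) X k"
    "\<forall>s\<in>{0..1}. k (0, s) = q s \<and> k (1, s) = q' s" "\<forall>r\<in>{0..1}. k (r, 0) = q 0 \<and> k (r, 1) = q 1"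
    using q unfolding path_homotopic_def by blast
  show ?thesis
    unfolding path_homotopic_def
    using h k assms(3)
    by (intro exI [of _ "\<lambda>(r, s). if s \<le> 1/2 then h (r, 2 * s) else k (r, 2 * s - 1)"] conjI
        continuous_map_join) (auto simp: join_loops_def)
qed

lemma pathin_reverse: "pathin X p \<Longrightarrow> pathin X (reverse_path p)"
  using pathin_reparam [of X p "\<lambda>s. 1 - s"]
  by (simp add: reverse_path_def o_def continuous_on_op_minus)

lemma pathin_subpath_of:
  assumes "pathin X p" "0 \<le> a" "a \<le> 1" "0 \<le> b" "b \<le> 1"
  shows "pathin X (subpath_of a b p)"
proof -
  have "a + (b - a) * s \<in> {0..1}" if "s \<in> {0..1}" for s
  proof -
    have "a + (b - a) * s = (1 - s) * a + s * b" by (simp add: algebra_simps)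
    then show ?thesis using that assms convex_bound_le [of a 1 b "1 - s" s] by auto
  qed
  then have "(\<lambda>s. a + (b - a) * s) \<in> {0..1} \<rightarrow> {0..1}" by blast
  moreover have "continuous_on {0..1} (\<lambda>s. a + (b - a) * s)" by (intro continuous_intros)
  ultimately show ?thesis
    using pathin_reparam [of X p "\<lambda>s. a + (b - a) * s"] assms(1)
    by (simp add: subpath_of_def o_def)
qed

lemma path_homotopic_reparam_eq:
  assumes p: "pathin X p" and f: "continuous_on {0..1} f" "f \<in> {0..1} \<rightarrow> {0..1}"
    and g: "continuous_on {0..1} g" "g \<in> {0..1} \<rightarrow> {0..1}"
    and ends: "f 0 = g 0" "f 1 = g 1"
    and q: "\<And>s. 0 \<le> s \<Longrightarrow> s \<le> 1 \<Longrightarrow> q s = p (f s)"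
    and r: "\<And>s. 0 \<le> s \<Longrightarrow> s \<le> 1 \<Longrightarrow> r s = p (g s)"
  shows "path_homotopic X q r"
proof -
  have "path_homotopic X (p \<circ> f) q" "path_homotopic X (p \<circ> g) r"
    using assms by (auto intro!: path_homotopic_eq pathin_reparam)
  then show ?thesis
    using path_homotopic_reparam [OF p f g ends] path_homotopic_sym path_homotopic_trans by meson
qed

lemma path_homotopic_assoc:
  assumes "pathin X p" "pathin X q" "pathin X r" "p 1 = q 0" "q 1 = r 0"
  shows "path_homotopic X (join_loops (join_loops p q) r) (join_loops p (join_loops q r))"
proof (rule path_homotopic_reparam_eq [of X "join_loops (join_loops p q) r" "\<lambda>s. s"
      "\<lambda>s. if s \<le> 1/2 then s / 2 else if s \<le> 3/4 then s - 1/4 else 2 * s - 1"])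
  show "pathin X (join_loops (join_loops p q) r)"
    using assms by (intro pathin_join) auto
  show "continuous_on {0..1} (\<lambda>s::real. if s \<le> 1/2 then s / 2 else if s \<le> 3/4 then s - 1/4 else 2 * s - 1)"
  proof -
    \<comment> \<open>The slopes 1/2, 1, 2 increase, so the piecewise affine function is the maximum
      of its three pieces and is visibly continuous.\<close>
    have "(\<lambda>s::real. if s \<le> 1/2 then s / 2 else if s \<le> 3/4 then s - 1/4 else 2 * s - 1) =
      (\<lambda>s. max (s / 2) (max (s - 1/4) (2 * s - 1)) )"
      by (auto simp: max_def)
    moreover have "continuous_on {0..1} (\<lambda>s::real. max (s / 2) (max (s - 1/4) (2 * s - 1)))"
      by (intro continuous_intros) auto
    ultimately show ?thesis by (simp only:)
  qed
  show "join_loops p (join_loops q r) s =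
     join_loops (join_loops p q) r (if s \<le> 1/2 then s / 2 else if s \<le> 3/4 then s - 1/4 else 2 * s - 1)"
    if "0 \<le> s" "s \<le> 1" for s
    using that by (auto simp: join_loops_def field_simps intro!: arg_cong [of _ _ q])
qed auto

text \<open>Going forth and back is \<open>p\<close> composed with a tent function, which deforms to
  the constant 0.\<close>

lemma path_homotopic_reverse_right:
  assumes "pathin X p"
  shows "path_homotopic X (join_loops p (reverse_path p)) (\<lambda>_. p 0)"
proof (rule path_homotopic_reparam_eq [of X p "\<lambda>s. min (2 * s) (2 - 2 * s)" "\<lambda>_. 0"])
  show "join_loops p (reverse_path p) s = p (min (2 * s) (2 - 2 * s))" if "0 \<le> s" "s \<le> 1" for s
    by (auto simp: join_loops_def reverse_path_def min_def intro!: arg_cong [of _ _ p])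
qed (use assms in \<open>auto intro!: continuous_intros\<close>)

lemma path_homotopic_reverse_left:
  assumes "pathin X p"
  shows "path_homotopic X (join_loops (reverse_path p) p) (\<lambda>_. p 1)"
  using path_homotopic_reverse_right [OF pathin_reverse [OF assms]]
  by (simp add: reverse_path_def)

lemma path_homotopic_const_left:
  assumes "pathin X p" "x = p 0"
  shows "path_homotopic X (join_loops (\<lambda>_. x) p) p"
proof (rule path_homotopic_reparam_eq [of X p "\<lambda>s. max 0 (2 * s - 1)" "\<lambda>s. s"])
  show "join_loops (\<lambda>_. x) p s = p (max 0 (2 * s - 1))" if "0 \<le> s" "s \<le> 1" for s
  proof (cases "s = 1/2")
    case True
    show ?thesis unfolding True using assms by (simp add: join_loops_def)
  qed (use assms that in \<open>auto simp: join_loops_def max_def\<close>)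
qed (use assms in \<open>auto intro!: continuous_intros\<close>)

lemma path_homotopic_const_right:
  assumes "pathin X p" "x = p 1"
  shows "path_homotopic X (join_loops p (\<lambda>_. x)) p"
proof (rule path_homotopic_reparam_eq [of X p "\<lambda>s. min 1 (2 * s)" "\<lambda>s. s"])
  show "join_loops p (\<lambda>_. x) s = p (min 1 (2 * s))" if "0 \<le> s" "s \<le> 1" for s
  proof (cases "s = 1/2")
    case True
    show ?thesis unfolding True using assms by (simp add: join_loops_def)
  qed (use assms that in \<open>auto simp: join_loops_def min_def\<close>)
qed (use assms in \<open>auto intro!: continuous_intros\<close>)

text \<open>The concatenation spends half of the time on each piece, the direct subpath moves at
  constant speed. The two clamped terms write the former as a single reparametrisation of
  \<open>p\<close>. This drives the subdivision of loops into paths lying in charts.\<close>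

lemma path_homotopic_join_subpath_of:
  assumes p: "pathin X p" and abc: "0 \<le> a" "a \<le> b" "b \<le> c" "c \<le> 1"
  shows "path_homotopic X (join_loops (subpath_of a b p) (subpath_of b c p)) (subpath_of a c p)"
proof (rule path_homotopic_reparam_eq
    [of X p "\<lambda>s. a + (b - a) * min 1 (2 * s) + (c - b) * max 0 (2 * s - 1)" "\<lambda>s. a + (c - a) * s"])
  have "a + (b - a) * u + (c - b) * w \<in> {0..1}" if "u \<in> {0..1}" "w \<in> {0..1}" for u w
  proof -
    have "(b - a) * u \<le> (b - a) * 1" "(c - b) * w \<le> (c - b) * 1" "0 \<le> (b - a) * u" "0 \<le> (c - b) * w"
      using that abc by (auto intro!: mult_left_mono mult_nonneg_nonneg simp del: mult_1_right)
    then show ?thesis using abc by simp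
  qed
  then show "(\<lambda>s. a + (b - a) * min 1 (2 * s) + (c - b) * max 0 (2 * s - 1)) \<in> {0..1} \<rightarrow> {0..1}"
    by (auto simp: Pi_iff)
  show "(\<lambda>s. a + (c - a) * s) \<in> {0..1} \<rightarrow> {0..1}"
  proof
    fix s :: real assume "s \<in> {0..1}"
    then have "(c - a) * s \<le> (c - a) * 1" "0 \<le> (c - a) * s"
      using abc by (auto intro!: mult_left_mono mult_nonneg_nonneg simp del: mult_1_right)
    then show "a + (c - a) * s \<in> {0..1}" using abc by simp
  qed
  show "join_loops (subpath_of a b p) (subpath_of b c p) s =
      p (a + (b - a) * min 1 (2 * s) + (c - b) * max 0 (2 * s - 1))" if "0 \<le> s" "s \<le> 1" for s
  proof (cases "s = 1/2")
    case True
    show ?thesis unfolding True by (simp add: join_loops_def subpath_of_def)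
  qed (use that in \<open>auto simp: join_loops_def subpath_of_def min_def max_def\<close>)
qed (use p in \<open>auto simp: subpath_of_def intro!: continuous_intros\<close>)

section \<open>The fundamental group\<close>

lemma loop_homotopy_iff:
  "(p, q) \<in> loop_homotopy X x \<longleftrightarrow> p \<in> loops_at X x \<and> q \<in> loops_at X x \<and> path_homotopic X p q"
  by (auto simp: loop_homotopy_def loops_at_def path_homotopic_iff_homotopic_with)

lemma equiv_loop_homotopy: "equiv (loops_at X x) (loop_homotopy X x)"
proof (rule equivI)
  show "refl_on (loops_at X x) (loop_homotopy X x)"
    by (rule refl_onI) (auto simp: loop_homotopy_iff loops_at_def intro: path_homotopic_refl)
  show "sym (loop_homotopy X x)"
    by (rule symI) (auto simp: loop_homotopy_iff intro: path_homotopic_sym)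
  show "trans (loop_homotopy X x)"
    by (rule transI) (auto simp: loop_homotopy_iff intro: path_homotopic_trans)
qed (auto simp: loop_homotopy_def)

definition loop_class :: "'b topology \<Rightarrow> 'b \<Rightarrow> (real \<Rightarrow> 'b) \<Rightarrow> (real \<Rightarrow> 'b) set" where
  "loop_class X x p = loop_homotopy X x `` {p}"

lemma loop_class_eq_iff:
  assumes "p \<in> loops_at X x" "q \<in> loops_at X x"
  shows "loop_class X x p = loop_class X x q \<longleftrightarrow> path_homotopic X p q"
  using eq_equiv_class_iff [OF equiv_loop_homotopy assms] assms
  by (simp add: loop_class_def loop_homotopy_iff)

lemma carrier_fundamental_group:
  "carrier (fundamental_group X x) = loop_class X x ` loops_at X x"
  by (auto simp: fundamental_group_def quotient_def loop_class_def)

lemma one_fundamental_group: "\<one>\<^bsub>fundamental_group X x\<^esub> = loop_class X x (\<lambda>_. x)"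
  by (simp add: fundamental_group_def loop_class_def)

lemma join_in_loops_at:
  "p \<in> loops_at X x \<Longrightarrow> q \<in> loops_at X x \<Longrightarrow> join_loops p q \<in> loops_at X x"
  by (auto simp: loops_at_def intro: pathin_join)

text \<open>The product in \<open>fundamental_group\<close> is a union over all pairs of
  representatives; it collapses because every pair contributes the same class.\<close>

lemma mult_fundamental_group:
  assumes "p \<in> loops_at X x" "q \<in> loops_at X x"
  shows "loop_class X x p \<otimes>\<^bsub>fundamental_group X x\<^esub> loop_class X x q = loop_class X x (join_loops p q)"
proof -
  have "loop_homotopy X x `` {join_loops p' q'} = loop_class X x (join_loops p q)"
    if "p' \<in> loop_class X x p" "q' \<in> loop_class X x q" for p' q'
  proof -
    have "p' \<in> loops_at X x" "path_homotopic X p p'" "q' \<in> loops_at X x" "path_homotopic X q q'"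
      using that by (auto simp: loop_class_def loop_homotopy_iff)
    then have "path_homotopic X (join_loops p q) (join_loops p' q')"
      using assms by (intro path_homotopic_join) (auto simp: loops_at_def)
    then show ?thesis
      using loop_class_eq_iff [of "join_loops p q" X x "join_loops p' q'"]
        \<open>p' \<in> loops_at X x\<close> \<open>q' \<in> loops_at X x\<close> assms by (simp add: join_in_loops_at loop_class_def)
  qed
  moreover have "p \<in> loop_class X x p" "q \<in> loop_class X x q"
    using assms equiv_class_self [OF equiv_loop_homotopy] by (auto simp: loop_class_def)
  ultimately have "(\<Union>p'\<in>loop_class X x p. \<Union>q'\<in>loop_class X x q. loop_homotopy X x `` {join_loops p' q'})
      = loop_class X x (join_loops p q)"
    by (intro UN_constant_eq ballI) blast+
  then show ?thesis
    by (simp add: fundamental_group_def)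
qed

lemma group_fundamental_group:
  assumes "x \<in> topspace X"
  shows "group (fundamental_group X x)"
proof (rule groupI)
  have const: "(\<lambda>_. x) \<in> loops_at X x"
    using assms by (simp add: loops_at_def)
  then show "\<one>\<^bsub>fundamental_group X x\<^esub> \<in> carrier (fundamental_group X x)"
    by (auto simp: one_fundamental_group carrier_fundamental_group)
  fix A assume "A \<in> carrier (fundamental_group X x)"
  then obtain p where p: "p \<in> loops_at X x" "A = loop_class X x p"
    by (auto simp: carrier_fundamental_group)
  have "path_homotopic X (join_loops (\<lambda>_. x) p) p"
    using p by (intro path_homotopic_const_left) (auto simp: loops_at_def)
  then show "\<one>\<^bsub>fundamental_group X x\<^esub> \<otimes>\<^bsub>fundamental_group X x\<^esub> A = A"
    using p const by (simp add: one_fundamental_group mult_fundamental_group loop_class_eq_iff join_in_loops_at)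
  have r: "reverse_path p \<in> loops_at X x" "path_homotopic X (join_loops (reverse_path p) p) (\<lambda>_. x)"
    using p path_homotopic_reverse_left [of X p] by (auto simp: loops_at_def intro: pathin_reverse)
  show "\<exists>B\<in>carrier (fundamental_group X x). B \<otimes>\<^bsub>fundamental_group X x\<^esub> A = \<one>\<^bsub>fundamental_group X x\<^esub>"
    using r p const
    by (intro bexI [of _ "loop_class X x (reverse_path p)"])
      (simp_all add: one_fundamental_group mult_fundamental_group loop_class_eq_iff join_in_loops_at
         carrier_fundamental_group)
  fix B assume "B \<in> carrier (fundamental_group X x)"
  then obtain q where q: "q \<in> loops_at X x" "B = loop_class X x q"
    by (auto simp: carrier_fundamental_group)
  then show "A \<otimes>\<^bsub>fundamental_group X x\<^esub> B \<in> carrier (fundamental_group X x)"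
    using p by (simp add: mult_fundamental_group carrier_fundamental_group join_in_loops_at)
  fix C assume "C \<in> carrier (fundamental_group X x)"
  then obtain r where r: "r \<in> loops_at X x" "C = loop_class X x r"
    by (auto simp: carrier_fundamental_group)
  have "path_homotopic X (join_loops (join_loops p q) r) (join_loops p (join_loops q r))"
    using p q r by (intro path_homotopic_assoc) (auto simp: loops_at_def)
  then show "A \<otimes>\<^bsub>fundamental_group X x\<^esub> B \<otimes>\<^bsub>fundamental_group X x\<^esub> C =
      A \<otimes>\<^bsub>fundamental_group X x\<^esub> (B \<otimes>\<^bsub>fundamental_group X x\<^esub> C)"
    using p q r by (simp add: mult_fundamental_group loop_class_eq_iff join_in_loops_at)
qed

text \<open>A path from \<open>x0\<close> to each point turns every path of \<open>X\<close> into a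
  loop at \<open>x0\<close>, so that \<open>cl\<close> is a functor from the fundamental groupoid to
  the fundamental group. With the constant path chosen at \<open>x0\<close>, \<open>cl\<close>
  agrees with the class map on loops.\<close>

locale based_paths =
  fixes X :: "'b topology" and x0 :: 'b and \<theta> :: "'b \<Rightarrow> real \<Rightarrow> 'b"
  assumes pathin_theta: "x \<in> topspace X \<Longrightarrow> pathin X (\<theta> x)"
    and theta_0: "x \<in> topspace X \<Longrightarrow> \<theta> x 0 = x0"
    and theta_1: "x \<in> topspace X \<Longrightarrow> \<theta> x 1 = x"
    and theta_base: "\<theta> x0 = (\<lambda>_. x0)"
    and base_in: "x0 \<in> topspace X"
begin

definition pi where "pi = fundamental_group X x0"

sublocale pi: group pi
  unfolding pi_def by (rule group_fundamental_group [OF base_in])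

definition lp :: "(real \<Rightarrow> 'b) \<Rightarrow> real \<Rightarrow> 'b" where
  "lp p = join_loops (join_loops (\<theta> (p 0)) p) (reverse_path (\<theta> (p 1)))"

definition cl :: "(real \<Rightarrow> 'b) \<Rightarrow> (real \<Rightarrow> 'b) set" where
  "cl p = loop_class X x0 (lp p)"

lemma pathin_ends: "pathin X p \<Longrightarrow> p 0 \<in> topspace X" "pathin X p \<Longrightarrow> p 1 \<in> topspace X"
  by (auto simp: pathin_def continuous_map_def)

lemma lp_in_loops: "pathin X p \<Longrightarrow> lp p \<in> loops_at X x0"
  by (auto simp: lp_def loops_at_def theta_0 theta_1 pathin_ends
      intro!: pathin_join pathin_reverse pathin_theta)

lemma cl_closed: "pathin X p \<Longrightarrow> cl p \<in> carrier pi"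
  by (auto simp: cl_def pi_def carrier_fundamental_group lp_in_loops)

lemma cl_homotopic:
  assumes "path_homotopic X p q"
  shows "cl p = cl q"
proof -
  have p: "pathin X p" "pathin X q" "q 0 = p 0" "q 1 = p 1"
    using path_homotopic_imp_pathin [OF assms] path_homotopic_ends [OF assms] by auto
  have "path_homotopic X (lp p) (lp q)"
    unfolding lp_def p using p assms
    by (intro path_homotopic_join path_homotopic_refl)
      (auto simp: theta_1 pathin_ends intro!: pathin_theta pathin_reverse)
  then show ?thesis
    by (simp add: cl_def loop_class_eq_iff lp_in_loops p)
qed

text \<open>The return along \<open>\<theta> (p 1)\<close> that ends the first loop cancels against
  the start of the second.\<close>

lemma cl_join:
  assumes p: "pathin X p" and q: "pathin X q" and pq: "p 1 = q 0"
  shows "cl (join_loops p q) = cl p \<otimes>\<^bsub>pi\<^esub> cl q"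
proof -
  let ?x = "\<theta> (p 0)" and ?y = "\<theta> (p 1)" and ?z = "\<theta> (q 1)"
  note [simp] = theta_0 theta_1 pathin_ends p q pq pathin_theta pathin_reverse pathin_join
  have [simp]: "p 0 \<in> topspace X" "q 0 \<in> topspace X" "q 1 \<in> topspace X"
    using pathin_ends p q by blast+
  have "path_homotopic X (join_loops (lp p) (lp q))
      (join_loops (join_loops (lp p) (join_loops ?y q)) (reverse_path ?z))"
    unfolding lp_def pq by (rule path_homotopic_sym, rule path_homotopic_assoc) auto
  also have "path_homotopic X \<dots>
      (join_loops (join_loops (join_loops ?x p) (join_loops (reverse_path ?y) (join_loops ?y q))) (reverse_path ?z))"
    unfolding lp_def pq
    by (intro path_homotopic_join path_homotopic_refl path_homotopic_assoc) auto
  also have "path_homotopic X \<dots>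
      (join_loops (join_loops (join_loops ?x p) (join_loops (join_loops (reverse_path ?y) ?y) q)) (reverse_path ?z))"
    unfolding pq
    by (intro path_homotopic_join path_homotopic_refl path_homotopic_sym [OF path_homotopic_assoc]) auto
  also have "path_homotopic X \<dots>
      (join_loops (join_loops (join_loops ?x p) (join_loops (\<lambda>_. q 0) q)) (reverse_path ?z))"
    using path_homotopic_reverse_left [of X ?y]
    unfolding pq by (intro path_homotopic_join path_homotopic_refl) auto
  also have "path_homotopic X \<dots> (join_loops (join_loops (join_loops ?x p) q) (reverse_path ?z))"
    by (intro path_homotopic_join path_homotopic_refl path_homotopic_const_left) auto
  also have "path_homotopic X \<dots> (lp (join_loops p q))"
    unfolding lp_def
    by (simp, intro path_homotopic_join path_homotopic_refl path_homotopic_assoc) auto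
  finally show ?thesis
    by (simp add: cl_def pi_def mult_fundamental_group lp_in_loops loop_class_eq_iff
        join_in_loops_at path_homotopic_sym)
qed

text \<open>The class is idempotent, and in a group only the identity is.\<close>

lemma cl_const:
  assumes "x \<in> topspace X"
  shows "cl (\<lambda>_. x) = \<one>\<^bsub>pi\<^esub>"
proof -
  have c: "pathin X (\<lambda>_. x)" using assms by simp
  have "cl (\<lambda>_. x) \<otimes>\<^bsub>pi\<^esub> cl (\<lambda>_. x) = cl (\<lambda>_. x)"
    using cl_join [OF c c] cl_homotopic [OF path_homotopic_const_left [OF c]] by simp
  then show ?thesis
    using cl_closed [OF c] by (metis pi.l_cancel_one)
qed

lemma cl_reverse:
  assumes p: "pathin X p"
  shows "cl (reverse_path p) = inv\<^bsub>pi\<^esub> cl p"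
proof -
  have "cl (reverse_path p) \<otimes>\<^bsub>pi\<^esub> cl p = \<one>\<^bsub>pi\<^esub>"
    using cl_join [OF pathin_reverse [OF p] p] cl_homotopic [OF path_homotopic_reverse_left [OF p]]
      cl_const [of "p 1"] pathin_ends [OF p] by simp
  then show ?thesis
    by (metis pi.inv_equality cl_closed p pathin_reverse)
qed

lemma cl_loop:
  assumes p: "p \<in> loops_at X x0"
  shows "cl p = loop_class X x0 p"
proof -
  have p': "pathin X p" "p 0 = x0" "p 1 = x0" using p by (auto simp: loops_at_def)
  have "reverse_path (\<lambda>_. x0) = (\<lambda>_. x0)" by (simp add: reverse_path_def)
  then have "path_homotopic X (lp p) (join_loops p (\<lambda>_. x0))"
    unfolding lp_def p' theta_base using p' base_in
    by (auto intro!: path_homotopic_join path_homotopic_refl path_homotopic_const_left)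
  also have "path_homotopic X \<dots> p"
    using p' by (intro path_homotopic_const_right) auto
  finally show ?thesis
    by (simp add: cl_def loop_class_eq_iff p lp_in_loops p')
qed

end

section \<open>Locally constant cocycles and their monodromy\<close>

text \<open>A 1-cocycle on a closed cover: \<open>A x\<close> lists the pieces containing
  \<open>x\<close>, and \<open>c x\<close> gives the transitions between them. Stability takes the
  place of open overlaps: near \<open>x\<close> only pieces through \<open>x\<close> occur, with the
  same transition values. Such data amount to a covering with left \<open>G\<close>-action, whose
  fibre over \<open>x\<close> consists of the functions \<open>f\<close> on \<open>A x\<close> with
  \<open>f t' = f t \<otimes> c x t t'\<close>.\<close>

locale stable_cocycle = group G for G (structure) +
  fixes X :: "'b topology" and A :: "'b \<Rightarrow> 't set" and c :: "'b \<Rightarrow> 't \<Rightarrow> 't \<Rightarrow> 'a"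
  assumes A_nonempty: "x \<in> topspace X \<Longrightarrow> A x \<noteq> {}"
    and c_closed: "\<lbrakk>x \<in> topspace X; t \<in> A x; t' \<in> A x\<rbrakk> \<Longrightarrow> c x t t' \<in> carrier G"
    and c_mult: "\<lbrakk>x \<in> topspace X; t \<in> A x; t' \<in> A x; t'' \<in> A x\<rbrakk> \<Longrightarrow> c x t t' \<otimes> c x t' t'' = c x t t''"
    and stable: "x \<in> topspace X \<Longrightarrow> \<exists>V. openin X V \<and> x \<in> V \<and>
       (\<forall>y\<in>V. A y \<subseteq> A x \<and> (\<forall>t\<in>A y. \<forall>t'\<in>A y. c y t t' = c x t t'))"
begin

lemma c_refl: "\<lbrakk>x \<in> topspace X; t \<in> A x\<rbrakk> \<Longrightarrow> c x t t = \<one>"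
  by (metis c_closed c_mult l_cancel_one)

text \<open>\<open>F k\<close> stands for a point of the fibre over \<open>h k\<close>; its values
  outside \<open>A (h k)\<close> are irrelevant. The last clause is continuity of the lift: near
  \<open>k\<close> the functions are restrictions of \<open>F k\<close>.\<close>

definition lift_along :: "'k::topological_space set \<Rightarrow> ('k \<Rightarrow> 'b) \<Rightarrow> ('k \<Rightarrow> 't \<Rightarrow> 'a) \<Rightarrow> bool" where
  "lift_along K h F \<longleftrightarrow>
     (\<forall>k\<in>K. h k \<in> topspace X) \<and>
     (\<forall>k\<in>K. \<forall>t\<in>A (h k). F k t \<in> carrier G) \<and>
     (\<forall>k\<in>K. \<forall>t\<in>A (h k). \<forall>t'\<in>A (h k). F k t' = F k t \<otimes> c (h k) t t') \<and>
     (\<forall>k\<in>K. \<exists>U. open U \<and> k \<in> U \<and> (\<forall>l. l \<in> K \<longrightarrow> l \<in> U \<longrightarrow> A (h l) \<subseteq> A (h k)) \<and>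
        (\<forall>l t. l \<in> K \<longrightarrow> l \<in> U \<longrightarrow> t \<in> A (h l) \<longrightarrow> F l t = F k t))"

lemma lift_alongD:
  assumes "lift_along K h F" "k \<in> K"
  shows "h k \<in> topspace X" "t \<in> A (h k) \<Longrightarrow> F k t \<in> carrier G"
    "t \<in> A (h k) \<Longrightarrow> t' \<in> A (h k) \<Longrightarrow> F k t' = F k t \<otimes> c (h k) t t'"
  using assms unfolding lift_along_def by blast+

lemma lift_along_near:
  assumes "lift_along K h F" "k \<in> K"
  obtains U where "open U" "k \<in> U" "\<And>l. l \<in> K \<Longrightarrow> l \<in> U \<Longrightarrow> A (h l) \<subseteq> A (h k)"
    "\<And>l t. l \<in> K \<Longrightarrow> l \<in> U \<Longrightarrow> t \<in> A (h l) \<Longrightarrow> F l t = F k t"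
proof -
  have "\<forall>k\<in>K. \<exists>U. open U \<and> k \<in> U \<and> (\<forall>l. l \<in> K \<longrightarrow> l \<in> U \<longrightarrow> A (h l) \<subseteq> A (h k)) \<and>
        (\<forall>l t. l \<in> K \<longrightarrow> l \<in> U \<longrightarrow> t \<in> A (h l) \<longrightarrow> F l t = F k t)"
    using assms(1) unfolding lift_along_def by (elim conjE)
  then obtain U where U: "open U" "k \<in> U" "\<forall>l. l \<in> K \<longrightarrow> l \<in> U \<longrightarrow> A (h l) \<subseteq> A (h k)"
     "\<forall>l t. l \<in> K \<longrightarrow> l \<in> U \<longrightarrow> t \<in> A (h l) \<longrightarrow> F l t = F k t"
    using assms(2) by meson
  show ?thesis
    by (rule that [OF U(1,2) U(3) [rule_format] U(4) [rule_format]])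
qed

lemma lift_alongI:
  assumes "\<And>k. k \<in> K \<Longrightarrow> h k \<in> topspace X"
    and "\<And>k t. k \<in> K \<Longrightarrow> t \<in> A (h k) \<Longrightarrow> F k t \<in> carrier G"
    and "\<And>k t t'. k \<in> K \<Longrightarrow> t \<in> A (h k) \<Longrightarrow> t' \<in> A (h k) \<Longrightarrow> F k t' = F k t \<otimes> c (h k) t t'"
    and near: "\<And>k. k \<in> K \<Longrightarrow> \<exists>U. open U \<and> k \<in> U \<and> (\<forall>l. l \<in> K \<longrightarrow> l \<in> U \<longrightarrow> A (h l) \<subseteq> A (h k)) \<and>
        (\<forall>l t. l \<in> K \<longrightarrow> l \<in> U \<longrightarrow> t \<in> A (h l) \<longrightarrow> F l t = F k t)"
  shows "lift_along K h F"
  unfolding lift_along_def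
  by (intro conjI ballI) (fact assms)+

lemma lift_along_subset:
  assumes "lift_along K h F" "L \<subseteq> K"
  shows "lift_along L h F"
proof (rule lift_alongI)
  fix k assume k: "k \<in> L"
  then have k': "k \<in> K" using assms(2) by blast
  show "h k \<in> topspace X" using lift_alongD(1) [OF assms(1) k'] .
  show "F k t \<in> carrier G" if "t \<in> A (h k)" for t using lift_alongD(2) [OF assms(1) k' that] .
  show "F k t' = F k t \<otimes> c (h k) t t'" if "t \<in> A (h k)" "t' \<in> A (h k)" for t t'
    using lift_alongD(3) [OF assms(1) k' that] .
  obtain U where "open U" "k \<in> U" "\<And>l. l \<in> K \<Longrightarrow> l \<in> U \<Longrightarrow> A (h l) \<subseteq> A (h k)"
    "\<And>l t. l \<in> K \<Longrightarrow> l \<in> U \<Longrightarrow> t \<in> A (h l) \<Longrightarrow> F l t = F k t"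
    by (rule lift_along_near [OF assms(1) k']) (rule that)
  then show "\<exists>U. open U \<and> k \<in> U \<and> (\<forall>l. l \<in> L \<longrightarrow> l \<in> U \<longrightarrow> A (h l) \<subseteq> A (h k)) \<and>
        (\<forall>l t. l \<in> L \<longrightarrow> l \<in> U \<longrightarrow> t \<in> A (h l) \<longrightarrow> F l t = F k t)"
    using subsetD [OF assms(2)] by (intro exI [of _ U]) simp
qed

text \<open>The cocycle acts on the right, so left translations commute with it; they are the deck
  transformations and serve to normalise initial values.\<close>

lemma lift_along_left_mult:
  assumes F: "lift_along K h F" and g: "g \<in> carrier G"
  shows "lift_along K h (\<lambda>k t. g \<otimes> F k t)"
proof (rule lift_alongI)
  fix k assume k: "k \<in> K"
  show "h k \<in> topspace X" using lift_alongD(1) [OF F k] .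
  show "g \<otimes> F k t \<in> carrier G" if "t \<in> A (h k)" for t
    using lift_alongD(2) [OF F k that] g by simp
  show "g \<otimes> F k t' = g \<otimes> F k t \<otimes> c (h k) t t'" if "t \<in> A (h k)" "t' \<in> A (h k)" for t t'
    using lift_alongD(3) [OF F k that] lift_alongD(1) [OF F k] lift_alongD(2) [OF F k that(1)] g that
    by (simp add: m_assoc c_closed)
  obtain U where "open U" "k \<in> U" "\<And>l. l \<in> K \<Longrightarrow> l \<in> U \<Longrightarrow> A (h l) \<subseteq> A (h k)"
    "\<And>l t. l \<in> K \<Longrightarrow> l \<in> U \<Longrightarrow> t \<in> A (h l) \<Longrightarrow> F l t = F k t"
    by (rule lift_along_near [OF F k]) (rule that)
  then show "\<exists>U. open U \<and> k \<in> U \<and> (\<forall>l. l \<in> K \<longrightarrow> l \<in> U \<longrightarrow> A (h l) \<subseteq> A (h k)) \<and>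
        (\<forall>l t. l \<in> K \<longrightarrow> l \<in> U \<longrightarrow> t \<in> A (h l) \<longrightarrow> g \<otimes> F l t = g \<otimes> F k t)"
    by (intro exI [of _ U]) simp
qed

lemma lift_along_eq_if_one_eq:
  assumes F: "lift_along K h F" and F': "lift_along K h F'" and k: "k \<in> K"
    and t: "t \<in> A (h k)" "F k t = F' k t" and t': "t' \<in> A (h k)"
  shows "F k t' = F' k t'"
  using lift_alongD(3) [OF F k t(1) t'] lift_alongD(3) [OF F' k t(1) t'] t by simp

text \<open>Agreement is locally constant. If the lifts agree at a point \<open>x\<close> near
  \<open>a\<close>, any index of \<open>x\<close> is also an index of \<open>a\<close> and shows
  agreement there; agreement at one index spreads to all indices of \<open>a\<close> by the cocycle,
  and from \<open>a\<close> back to every nearby point.\<close>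

lemma lift_along_unique:
  assumes K: "connected K" and F: "lift_along K h F" and F': "lift_along K h F'"
    and k: "k \<in> K" "t \<in> A (h k)" "F k t = F' k t" and l: "l \<in> K" "s \<in> A (h l)"
  shows "F l s = F' l s"
proof -
  let ?P = "\<lambda>k. \<forall>t\<in>A (h k). F k t = F' k t"
  have "?P l"
  proof (rule connected_induction_simple [OF K k(1) l(1), where P = ?P])
    show "\<forall>t\<in>A (h k). F k t = F' k t"
      using lift_along_eq_if_one_eq [OF F F' k] by blast
    fix a assume a: "a \<in> K"
    obtain U where U: "open U" "a \<in> U" "\<And>l. l \<in> K \<Longrightarrow> l \<in> U \<Longrightarrow> A (h l) \<subseteq> A (h a)"
      "\<And>l t. l \<in> K \<Longrightarrow> l \<in> U \<Longrightarrow> t \<in> A (h l) \<Longrightarrow> F l t = F a t"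
      by (rule lift_along_near [OF F a]) (rule that)
    obtain U' where U': "open U'" "a \<in> U'"
      "\<And>l t. l \<in> K \<Longrightarrow> l \<in> U' \<Longrightarrow> t \<in> A (h l) \<Longrightarrow> F' l t = F' a t"
      using lift_along_near [OF F' a] by metis
    have "?P y" if x: "x \<in> K \<inter> (U \<inter> U')" "?P x" and y: "y \<in> K \<inter> (U \<inter> U')" for x y
    proof -
      obtain t where t: "t \<in> A (h x)"
        using x lift_alongD(1) [OF F] A_nonempty by fastforce
      have ta: "t \<in> A (h a)" "F a t = F' a t"
        using x U(3) [of x] U(4) [of x t] U'(3) [of x t] t by auto
      then have "F a s = F' a s" if "s \<in> A (h a)" for s
        using lift_along_eq_if_one_eq [OF F F' a ta that] by simp
      then show ?thesis
        using y U(3) [of y] U(4) [of y] U'(3) [of y] by (metis IntE subsetD)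
    qed
    moreover have "openin (top_of_set K) (K \<inter> (U \<inter> U'))" "a \<in> K \<inter> (U \<inter> U')"
      using U U' a by (auto intro: openin_open_Int)
    ultimately show "\<exists>T. openin (top_of_set K) T \<and> a \<in> T \<and> (\<forall>x\<in>T. \<forall>y\<in>T. ?P x \<longrightarrow> ?P y)"
      by blast
  qed
  then show ?thesis using l by blast
qed

text \<open>The value may be prescribed at any point of \<open>K\<close>, not only at a
  distinguished one, so that a lift can be continued across a common boundary in either
  direction.\<close>

definition liftable :: "'k::topological_space set \<Rightarrow> ('k \<Rightarrow> 'b) \<Rightarrow> bool" where
  "liftable K h \<longleftrightarrow> (\<forall>k\<in>K. \<forall>t\<in>A (h k). \<forall>g\<in>carrier G. \<exists>F. lift_along K h F \<and> F k t = g)"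

text \<open>At a point outside one of the closed pieces, the complement of that piece is a
  neighbourhood on which it imposes nothing.\<close>

lemma lift_along_Un:
  assumes F: "lift_along K h F" and F': "lift_along L h F'" and cl: "closed K" "closed L"
    and eq: "\<And>k t. k \<in> K \<Longrightarrow> k \<in> L \<Longrightarrow> t \<in> A (h k) \<Longrightarrow> F k t = F' k t"
  shows "lift_along (K \<union> L) h (\<lambda>k. if k \<in> K then F k else F' k)" (is "lift_along _ _ ?F")
proof (rule lift_alongI)
  fix k assume k: "k \<in> K \<union> L"
  show "h k \<in> topspace X"
    using k lift_alongD(1) [OF F, of k] lift_alongD(1) [OF F', of k] by blast
  show "?F k t \<in> carrier G" if "t \<in> A (h k)" for t
    using k lift_alongD(2) [OF F _ that] lift_alongD(2) [OF F' _ that] by auto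
  show "?F k t' = ?F k t \<otimes> c (h k) t t'" if "t \<in> A (h k)" "t' \<in> A (h k)" for t t'
    using k lift_alongD(3) [OF F _ that] lift_alongD(3) [OF F' _ that] by auto
  obtain U where U: "open U" "k \<in> U" "\<And>l. l \<in> K \<Longrightarrow> l \<in> U \<Longrightarrow> A (h l) \<subseteq> A (h k)"
    "\<And>l t. l \<in> K \<Longrightarrow> l \<in> U \<Longrightarrow> t \<in> A (h l) \<Longrightarrow> F l t = ?F k t"
  proof (cases "k \<in> K")
    case True
    show ?thesis by (rule lift_along_near [OF F True]) (rule that, auto simp: True)
  next
    case False
    then show ?thesis by (intro that [of "- K"]) (use cl in auto)
  qed
  obtain U' where U': "open U'" "k \<in> U'" "\<And>l. l \<in> L \<Longrightarrow> l \<in> U' \<Longrightarrow> A (h l) \<subseteq> A (h k)"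
    "\<And>l t. l \<in> L \<Longrightarrow> l \<in> U' \<Longrightarrow> t \<in> A (h l) \<Longrightarrow> F' l t = ?F k t"
  proof (cases "k \<in> L")
    case True
    obtain U where U: "open U" "k \<in> U" "\<And>l. l \<in> L \<Longrightarrow> l \<in> U \<Longrightarrow> A (h l) \<subseteq> A (h k)"
      "\<And>l t. l \<in> L \<Longrightarrow> l \<in> U \<Longrightarrow> t \<in> A (h l) \<Longrightarrow> F' l t = F' k t"
      by (rule lift_along_near [OF F' True]) (rule that)
    have "F' l t = ?F k t" if "l \<in> L" "l \<in> U" "t \<in> A (h l)" for l t
      using U(3) [OF that(1,2)] U(4) [OF that] that(3) eq [of k t] True by auto
    then show ?thesis using U(1-3) by (intro that [of U])
  next
    case False
    then show ?thesis by (intro that [of "- L"]) (use cl in auto)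
  qed
  show "\<exists>U. open U \<and> k \<in> U \<and> (\<forall>l. l \<in> K \<union> L \<longrightarrow> l \<in> U \<longrightarrow> A (h l) \<subseteq> A (h k)) \<and>
        (\<forall>l t. l \<in> K \<union> L \<longrightarrow> l \<in> U \<longrightarrow> t \<in> A (h l) \<longrightarrow> ?F l t = ?F k t)"
  proof (intro exI [of _ "U \<inter> U'"] conjI allI impI)
    fix l t assume l: "l \<in> K \<union> L" "l \<in> U \<inter> U'"
    then show "A (h l) \<subseteq> A (h k)" using U(3) [of l] U'(3) [of l] by blast
    assume "t \<in> A (h l)"
    then show "?F l t = ?F k t"
      using l U(4) [of l t] U'(4) [of l t] by (cases "l \<in> K") auto
  qed (use U U' in auto)
qed

text \<open>The second lift is started with the value of the first at one common point; since the
  intersection is connected, uniqueness makes them agree on all of it.\<close>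

lemma liftable_Un:
  assumes K: "liftable K h" and L: "liftable L h" and cl: "closed K" "closed L"
    and con: "connected (K \<inter> L)" "K \<inter> L \<noteq> {}" and h: "h ` (K \<inter> L) \<subseteq> topspace X"
  shows "liftable (K \<union> L) h"
proof -
  have *: "\<exists>F. lift_along (K \<union> L) h F \<and> F k t = g"
    if K: "liftable K h" and L: "liftable L h" and cl: "closed K" "closed L"
      and con: "connected (K \<inter> L)" and l: "l \<in> K \<inter> L" and s: "s \<in> A (h l)"
      and k: "k \<in> K" "t \<in> A (h k)" "g \<in> carrier G" for K L k t g l s
  proof -
    obtain F where F: "lift_along K h F" "F k t = g"
      using K k unfolding liftable_def by blast
    have "F l s \<in> carrier G" using lift_alongD(2) [OF F(1)] l s by blast
    then obtain F' where F': "lift_along L h F'" "F' l s = F l s"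
      using L l s unfolding liftable_def by blast
    have "F x r = F' x r" if "x \<in> K" "x \<in> L" "r \<in> A (h x)" for x r
      by (rule lift_along_unique [OF con lift_along_subset [OF F(1)] lift_along_subset [OF F'(1)]
            l s F'(2) [symmetric] IntI [OF that(1,2)] that(3)]) (rule Int_lower1 Int_lower2)+
    from lift_along_Un [OF F(1) F'(1) cl this] F(2) k(1) show ?thesis
      by (intro exI [of _ "\<lambda>k. if k \<in> K then F k else F' k"]) simp
  qed
  obtain l where l: "l \<in> K \<inter> L" using con by blast
  obtain s where s: "s \<in> A (h l)" using A_nonempty h l by blast
  show ?thesis
    unfolding liftable_def
  proof (intro ballI)
    fix k t g assume k: "k \<in> K \<union> L" and t: "t \<in> A (h k)" "g \<in> carrier G"
    show "\<exists>F. lift_along (K \<union> L) h F \<and> F k t = g"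
    proof (cases "k \<in> K")
      case True
      show ?thesis by (rule *[OF K L cl con(1) l s True t])
    next
      case False
      then have "k \<in> L" using k by blast
      from *[OF L K cl(2,1) _ _ s this t] con(1) l show ?thesis
        by (simp add: Int_commute Un_commute)
    qed
  qed
qed

text \<open>If one function satisfies the cocycle relation at all points of the image, it is a lift
  without depending on the parameter. Continuity of \<open>h\<close> is needed only for the
  shrinking of the index sets.\<close>

lemma lift_along_constI:
  assumes h: "continuous_map (top_of_set K) X h"
    and f: "\<And>k t. k \<in> K \<Longrightarrow> t \<in> A (h k) \<Longrightarrow> f t \<in> carrier G"
    and fc: "\<And>k t t'. k \<in> K \<Longrightarrow> t \<in> A (h k) \<Longrightarrow> t' \<in> A (h k) \<Longrightarrow> f t' = f t \<otimes> c (h k) t t'"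
  shows "lift_along K h (\<lambda>_. f)"
proof (rule lift_alongI)
  fix l assume l: "l \<in> K"
  then show hl: "h l \<in> topspace X" using h by (auto simp: continuous_map_def)
  obtain W where W: "openin X W" "h l \<in> W" "\<forall>y\<in>W. A y \<subseteq> A (h l)"
    using stable [OF hl] by blast
  then have "openin (top_of_set K) {k \<in> K. h k \<in> W}"
    using h openin_continuous_map_preimage by fastforce
  then obtain U where "open U" "{k \<in> K. h k \<in> W} = K \<inter> U"
    by (auto simp: openin_open)
  then show "\<exists>U. open U \<and> l \<in> U \<and> (\<forall>m. m \<in> K \<longrightarrow> m \<in> U \<longrightarrow> A (h m) \<subseteq> A (h l)) \<and>
      (\<forall>m s. m \<in> K \<longrightarrow> m \<in> U \<longrightarrow> s \<in> A (h m) \<longrightarrow> f s = f s)"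
    using W l by (intro exI [of _ U]) blast
qed (use f fc in blast)+

text \<open>Over a neighbourhood with the stability property the cocycle is trivialised by an index
  \<open>t\<close> of the centre: \<open>g \<otimes> c x t s\<close> is a lift with value
  \<open>g\<close> at \<open>t\<close>.\<close>

lemma liftable_small:
  assumes x: "x \<in> topspace X" and V: "\<And>y. y \<in> V \<Longrightarrow> A y \<subseteq> A x \<and> (\<forall>t\<in>A y. \<forall>t'\<in>A y. c y t t' = c x t t')"
    and h: "continuous_map (top_of_set K) X h" and hV: "h ` K \<subseteq> V"
  shows "liftable K h"
  unfolding liftable_def
proof (intro ballI)
  fix k t g assume k: "k \<in> K" "t \<in> A (h k)" "g \<in> carrier G"
  have A: "A (h l) \<subseteq> A x" if "l \<in> K" for l using hV V that by blast
  have t: "t \<in> A x" using k A by blast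
  have "lift_along K h (\<lambda>_ s. g \<otimes> c x t s)"
  proof (rule lift_along_constI [OF h])
    fix l s s' assume l: "l \<in> K" "s \<in> A (h l)"
    then have s: "s \<in> A x" using A by blast
    then show "g \<otimes> c x t s \<in> carrier G" using k(3) t x by (simp add: c_closed)
    assume s': "s' \<in> A (h l)"
    have "c (h l) s s' = c x s s'" using V hV l s' by (meson image_subset_iff)
    moreover have "s' \<in> A x" using l s' A by blast
    ultimately show "g \<otimes> c x t s' = g \<otimes> c x t s \<otimes> c (h l) s s'"
      using k t x s by (simp add: m_assoc c_closed c_mult)
  qed
  moreover have "g \<otimes> c x t t = g"
    using t x k by (simp add: c_refl)
  ultimately show "\<exists>F. lift_along K h F \<and> F k t = g" by blast
qed

text \<open>The square is covered by open sets on which \<open>liftable_small\<close> applies, and a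
  Lebesgue number reduces the claim to gluing small rectangles along connected edges.\<close>

lemma liftable_square:
  assumes h: "continuous_map (top_of_set unit_square) X h"
  shows "liftable unit_square h"
proof -
  let ?ok = "\<lambda>U. \<forall>K. K \<subseteq> unit_square \<inter> U \<longrightarrow> liftable K h"
  let ?C = "{U. open U \<and> ?ok U}"
  have "unit_square \<subseteq> \<Union>?C"
  proof
    fix k assume k: "k \<in> unit_square"
    then have hk: "h k \<in> topspace X" using h by (auto simp: continuous_map_def)
    obtain V where V: "openin X V" "h k \<in> V"
      "\<forall>y\<in>V. A y \<subseteq> A (h k) \<and> (\<forall>t\<in>A y. \<forall>t'\<in>A y. c y t t' = c (h k) t t')"
      using stable [OF hk] by blast
    have "openin (top_of_set unit_square) {k \<in> unit_square. h k \<in> V}"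
      using openin_continuous_map_preimage [OF h V(1)] by simp
    then obtain U where U: "open U" "{k \<in> unit_square. h k \<in> V} = unit_square \<inter> U"
      by (auto simp: openin_open)
    have "liftable K h" if "K \<subseteq> unit_square \<inter> U" for K
    proof (rule liftable_small [OF hk])
      show "continuous_map (top_of_set K) X h"
        using continuous_map_from_subtopology_mono [OF h, of K] that by auto
      show "h ` K \<subseteq> V" using that U by blast
    qed (use V in blast)
    then have "?ok U" by blast
    moreover have "k \<in> U" using k U V by blast
    ultimately show "k \<in> \<Union>?C" using U by blast
  qed
  moreover have "compact unit_square" by (intro compact_Times compact_Icc)
  moreover have "?C \<noteq> {}"
    using calculation by force
  moreover have "\<And>B. B \<in> ?C \<Longrightarrow> open B" by blast
  ultimately obtain \<delta> where \<delta>: "0 < \<delta>"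
    "\<And>T. \<lbrakk>T \<subseteq> unit_square; diameter T < \<delta>\<rbrakk> \<Longrightarrow> \<exists>B\<in>?C. T \<subseteq> B"
    using Lebesgue_number_lemma [of unit_square ?C thesis] by blast
  \<comment> \<open>Sides shorter than \<open>\<delta> / 3\<close> keep the diameter at most
    \<open>2 * \<delta> / 3\<close>, strictly below the Lebesgue number.\<close>
  have small: "liftable ({a..b} \<times> {a'..b'}) h"
    if "0 \<le> a" "b \<le> 1" "0 \<le> a'" "b' \<le> 1" "b - a < \<delta> / 3" "b' - a' < \<delta> / 3" for a b a' b'
  proof -
    have "diameter ({a..b} \<times> {a'..b'}) \<le> 2 * \<delta> / 3"
    proof (rule diameter_le)
      fix x y assume xy: "x \<in> {a..b} \<times> {a'..b'}" "y \<in> {a..b} \<times> {a'..b'}"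
      have "norm (x - y) \<le> norm (fst (x - y)) + norm (snd (x - y))"
        by (metis norm_Pair_le prod.collapse)
      also have "\<dots> \<le> \<delta> / 3 + \<delta> / 3"
        using xy that(5,6) by (intro add_mono) (auto simp: abs_if split: if_splits)
      finally show "norm (x - y) \<le> 2 * \<delta> / 3" by simp
    qed (use \<delta> in auto)
    moreover have sub: "{a..b} \<times> {a'..b'} \<subseteq> unit_square" using that by auto
    ultimately obtain B where "B \<in> ?C" "{a..b} \<times> {a'..b'} \<subseteq> B"
      using \<delta>(1) \<delta>(2) [OF sub] by auto
    then show ?thesis using sub by blast
  qed
  have hX: "h k \<in> topspace X" if "k \<in> unit_square" for k
    using h that by (auto simp: continuous_map_def)
  \<comment> \<open>Bisection in the first coordinate: rectangles of small height are glued along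
    the segment over the common end \<open>v\<close>, which is connected and nonempty.\<close>
  have strip: "liftable ({a..b} \<times> {a'..b'}) h"
    if ab: "0 \<le> a" "a \<le> b" "b \<le> 1" and ab': "0 \<le> a'" "a' \<le> b'" "b' \<le> 1" "b' - a' < \<delta> / 3"
    for a b a' b'
  proof -
    have "0 \<le> a \<longrightarrow> b \<le> 1 \<longrightarrow> liftable ({a..b} \<times> {a'..b'}) h"
    proof (rule Bolzano [of a b "\<lambda>a b. 0 \<le> a \<longrightarrow> b \<le> 1 \<longrightarrow> liftable ({a..b} \<times> {a'..b'}) h"])
      fix u v w :: real
      assume lift: "0 \<le> u \<longrightarrow> v \<le> 1 \<longrightarrow> liftable ({u..v} \<times> {a'..b'}) h"
        "0 \<le> v \<longrightarrow> w \<le> 1 \<longrightarrow> liftable ({v..w} \<times> {a'..b'}) h" and uvw: "u \<le> v" "v \<le> w"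
      show "0 \<le> u \<longrightarrow> w \<le> 1 \<longrightarrow> liftable ({u..w} \<times> {a'..b'}) h"
      proof (intro impI)
        assume uw: "0 \<le> u" "w \<le> 1"
        have int: "{u..v} \<times> {a'..b'} \<inter> {v..w} \<times> {a'..b'} = {v} \<times> {a'..b'}"
          and un: "{u..v} \<times> {a'..b'} \<union> {v..w} \<times> {a'..b'} = {u..w} \<times> {a'..b'}"
          using uvw by auto
        have "liftable ({u..v} \<times> {a'..b'} \<union> {v..w} \<times> {a'..b'}) h"
          by (rule liftable_Un; (unfold int)?) (use lift uvw uw ab' hX in \<open>auto intro!: connected_Times closed_Times\<close>)
        then show "liftable ({u..w} \<times> {a'..b'}) h" unfolding un .
      qed
    next
      fix x assume "a \<le> x" "x \<le> b"
      show "\<exists>d>0. \<forall>a b. a \<le> x \<and> x \<le> b \<and> b - a < d \<longrightarrow> 0 \<le> a \<longrightarrow> b \<le> 1 \<longrightarrow> liftable ({a..b} \<times> {a'..b'}) h"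
        using small ab' \<delta>(1) by (intro exI [of _ "\<delta> / 3"]) simp
    qed (use ab in simp)
    then show ?thesis using ab by simp
  qed
  \<comment> \<open>The same bisection in the second coordinate, now gluing full strips along
    horizontal segments.\<close>
  have "0 \<le> (0::real) \<longrightarrow> 1 \<le> (1::real) \<longrightarrow> liftable ({0..1} \<times> {0..1}) h"
  proof (rule Bolzano [of 0 1 "\<lambda>a b. 0 \<le> a \<longrightarrow> b \<le> 1 \<longrightarrow> liftable ({0..1} \<times> {a..b}) h"])
    fix u v w :: real
    assume lift: "0 \<le> u \<longrightarrow> v \<le> 1 \<longrightarrow> liftable ({0..1} \<times> {u..v}) h"
      "0 \<le> v \<longrightarrow> w \<le> 1 \<longrightarrow> liftable ({0..1} \<times> {v..w}) h" and uvw: "u \<le> v" "v \<le> w"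
    show "0 \<le> u \<longrightarrow> w \<le> 1 \<longrightarrow> liftable ({0..1} \<times> {u..w}) h"
    proof (intro impI)
      assume uw: "0 \<le> u" "w \<le> 1"
      have int: "{0..1} \<times> {u..v} \<inter> {0..1} \<times> {v..w} = {0..1::real} \<times> {v}"
        and un: "{0..1} \<times> {u..v} \<union> {0..1} \<times> {v..w} = {0..1::real} \<times> {u..w}"
        using uvw by auto
      have "liftable ({0..1} \<times> {u..v} \<union> {0..1} \<times> {v..w}) h"
        by (rule liftable_Un; (unfold int)?) (use lift uvw uw hX in \<open>auto intro!: connected_Times closed_Times\<close>)
      then show "liftable ({0..1} \<times> {u..w}) h" unfolding un .
    qed
  next
    fix y :: real assume "0 \<le> y" "y \<le> 1"
    show "\<exists>d>0. \<forall>u v. u \<le> y \<and> y \<le> v \<and> v - u < d \<longrightarrow> 0 \<le> u \<longrightarrow> v \<le> 1 \<longrightarrow> liftable ({0..1} \<times> {u..v}) h"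
      using strip [of 0 1] \<delta>(1) by (intro exI [of _ "\<delta> / 3"]) simp
  qed simp
  then show ?thesis by simp
qed

section \<open>Transport along paths, its homotopy invariance and multiplicativity\<close>

lemma lift_along_compose:
  assumes F: "lift_along K h F" and f: "continuous_on UNIV f" "f ` L \<subseteq> K"
    and h': "\<And>l. l \<in> L \<Longrightarrow> h' l = h (f l)"
  shows "lift_along L h' (F \<circ> f)"
proof (rule lift_alongI)
  fix s assume s: "s \<in> L"
  then have s': "f s \<in> K" using f by blast
  show "h' s \<in> topspace X" using lift_alongD(1) [OF F s'] h' [OF s] by simp
  show "(F \<circ> f) s r \<in> carrier G" if "r \<in> A (h' s)" for r
    using lift_alongD(2) [OF F s'] h' [OF s] that by simp
  show "(F \<circ> f) s r' = (F \<circ> f) s r \<otimes> c (h' s) r r'" if "r \<in> A (h' s)" "r' \<in> A (h' s)" for r r'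
    using lift_alongD(3) [OF F s', of r r'] h' [OF s] that by simp
  obtain U where U: "open U" "f s \<in> U" "\<And>l. l \<in> K \<Longrightarrow> l \<in> U \<Longrightarrow> A (h l) \<subseteq> A (h (f s))"
    "\<And>l t. l \<in> K \<Longrightarrow> l \<in> U \<Longrightarrow> t \<in> A (h l) \<Longrightarrow> F l t = F (f s) t"
    by (rule lift_along_near [OF F s']) (rule that)
  have "open (f -` U)" using U(1) f(1) by (rule open_vimage)
  then show "\<exists>U. open U \<and> s \<in> U \<and> (\<forall>l. l \<in> L \<longrightarrow> l \<in> U \<longrightarrow> A (h' l) \<subseteq> A (h' s)) \<and>
        (\<forall>l t. l \<in> L \<longrightarrow> l \<in> U \<longrightarrow> t \<in> A (h' l) \<longrightarrow> (F \<circ> f) l t = (F \<circ> f) s t)"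
    using U(2) U(3,4) f(2) h' s by (intro exI [of _ "f -` U"]) (simp add: image_subset_iff)
qed

text \<open>Meant for the two sides of a homotopy square on which the endpoints of the paths stay
  fixed.\<close>

lemma lift_along_const:
  assumes K: "connected K" and F: "lift_along K h F" and h: "\<And>k. k \<in> K \<Longrightarrow> h k = x"
    and t: "t \<in> A x" and kl: "k \<in> K" "l \<in> K"
  shows "F k t = F l t"
proof (rule connected_local_const [OF K kl])
  show "\<forall>a\<in>K. \<forall>\<^sub>F b in at a within K. F a t = F b t"
  proof
    fix a assume a: "a \<in> K"
    obtain U where U: "open U" "a \<in> U"
      "\<And>l t. l \<in> K \<Longrightarrow> l \<in> U \<Longrightarrow> t \<in> A (h l) \<Longrightarrow> F l t = F a t"
      using lift_along_near [OF F a] by metis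
    then have "F a t = F b t" if "b \<in> K" "b \<in> U" for b
      using h t that by metis
    then show "\<forall>\<^sub>F b in at a within K. F a t = F b t"
      using U(1,2) unfolding eventually_at_topological by blast
  qed
qed

text \<open>The monodromy of the cocycle along \<open>p\<close>. An endpoint may carry several
  indices, so one has to be specified at each end. \<open>THE\<close> is justified by uniqueness of
  lifts.\<close>

definition transport :: "(real \<Rightarrow> 'b) \<Rightarrow> 't \<Rightarrow> 't \<Rightarrow> 'a" where
  "transport p t t' = (THE g. \<exists>F. lift_along {0..1} p F \<and> F 0 t = \<one> \<and> F 1 t' = g)"

text \<open>The square lifting is applied to the homotopy that rests at \<open>p\<close>, and the
  lift is restricted to one side.\<close>

lemma lift_along_path_exists:
  assumes p: "pathin X p" and t: "t \<in> A (p 0)"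
  obtains F where "lift_along {0..1} p F" "F 0 t = \<one>"
proof -
  have "liftable unit_square (p \<circ> snd)"
    using p by (intro liftable_square) (simp add: pathin_iff_cylinder)
  moreover have "(0, 0) \<in> unit_square" "t \<in> A ((p \<circ> snd) (0, 0))" using t by simp_all
  ultimately obtain F where F: "lift_along unit_square (p \<circ> snd) F" "F (0, 0) t = \<one>"
    unfolding liftable_def by blast
  have "lift_along {0..1} p (F \<circ> (\<lambda>s. (0, s)))"
    by (rule lift_along_compose [OF F(1)]) (auto intro!: continuous_intros)
  then show ?thesis using F(2) that by fastforce
qed

text \<open>Any lift computes the monodromy, normalised or not, since a left translation corrects
  its initial value.\<close>

lemma transport_unfold:
  assumes F: "lift_along {0..1} p F" and t: "t \<in> A (p 0)" and t': "t' \<in> A (p 1)"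
  shows "transport p t t' = inv (F 0 t) \<otimes> F 1 t'"
  unfolding transport_def
proof (rule the_equality)
  have F0: "F 0 t \<in> carrier G" and F1: "F 1 t' \<in> carrier G"
    using lift_alongD(2) [OF F] t t' by auto
  show "\<exists>F'. lift_along {0..1} p F' \<and> F' 0 t = \<one> \<and> F' 1 t' = inv F 0 t \<otimes> F 1 t'"
    using lift_along_left_mult [OF F inv_closed [OF F0]] F0
    by (intro exI [of _ "\<lambda>k t'. inv (F 0 t) \<otimes> F k t'"]) simp
  fix g assume "\<exists>F'. lift_along {0..1} p F' \<and> F' 0 t = \<one> \<and> F' 1 t' = g"
  then obtain F' where F': "lift_along {0..1} p F'" "F' 0 t = \<one>" "F' 1 t' = g" by blast
  have "F 1 t' = F 0 t \<otimes> F' 1 t'"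
    by (rule lift_along_unique [OF connected_Icc F lift_along_left_mult [OF F'(1) F0] _ t _ _ t'])
      (use F' F0 in simp_all)
  moreover have "g \<in> carrier G" using lift_alongD(2) [OF F'(1)] F'(3) t' by auto
  ultimately show "g = inv (F 0 t) \<otimes> F 1 t'"
    using F' F0 by (simp add: m_assoc [symmetric])
qed

lemma lift_along_transport:
  assumes F: "lift_along {0..1} p F" and t: "t \<in> A (p 0)" and t': "t' \<in> A (p 1)"
  shows "F 1 t' = F 0 t \<otimes> transport p t t'"
proof -
  have "F 0 t \<in> carrier G" "F 1 t' \<in> carrier G"
    using lift_alongD(2) [OF F] t t' by auto
  then show ?thesis
    by (simp add: transport_unfold [OF assms] m_assoc [symmetric])
qed

lemma transport_closed:
  assumes "pathin X p" "t \<in> A (p 0)" "t' \<in> A (p 1)"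
  shows "transport p t t' \<in> carrier G"
proof -
  obtain F where F: "lift_along {0..1} p F" "F 0 t = \<one>"
    using lift_along_path_exists [OF assms(1,2)] .
  then show ?thesis
    using lift_alongD(2) [OF F(1)] assms by (simp add: transport_unfold [OF F(1)])
qed

text \<open>One lift over the whole homotopy is restricted to the four sides: two of them are lifts
  of \<open>p\<close> and \<open>q\<close>, and along the other two it does not change.\<close>

lemma transport_homotopic:
  assumes pq: "path_homotopic X p q" and t: "t \<in> A (p 0)" and t': "t' \<in> A (p 1)"
  shows "transport p t t' = transport q t t'"
proof -
  obtain h where h: "continuous_map (top_of_set unit_square) X h"
    "\<And>s. s \<in> {0..1} \<Longrightarrow> h (0, s) = p s \<and> h (1, s) = q s"
    "\<And>r. r \<in> {0..1} \<Longrightarrow> h (r, 0) = p 0 \<and> h (r, 1) = p 1"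
    using pq unfolding path_homotopic_def by blast
  have ends: "q 0 = p 0" "q 1 = p 1" using path_homotopic_ends [OF pq] by auto
  have "(0, 0) \<in> unit_square" "t \<in> A (h (0, 0))" using t h(3) [of 0] by simp_all
  then obtain F where F: "lift_along unit_square h F" "F (0, 0) t = \<one>"
    using liftable_square [OF h(1)] unfolding liftable_def by blast
  have p: "lift_along {0..1} p (F \<circ> (\<lambda>s. (0, s)))" and q: "lift_along {0..1} q (F \<circ> (\<lambda>s. (1, s)))"
    by (rule lift_along_compose [OF F(1)]; use h(2) in \<open>force intro!: continuous_intros\<close>)+
  have "lift_along {0..1} (\<lambda>r. h (r, 0)) (F \<circ> (\<lambda>r. (r, 0)))"
       "lift_along {0..1} (\<lambda>r. h (r, 1)) (F \<circ> (\<lambda>r. (r, 1)))"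
    by (rule lift_along_compose [OF F(1)]; force intro!: continuous_intros)+
  from lift_along_const [OF _ this(1), of "p 0" t 0 1] lift_along_const [OF _ this(2), of "p 1" t' 0 1]
  have "F (0, 0) t = F (1, 0) t" "F (0, 1) t' = F (1, 1) t'"
    using h(3) t t' by simp_all
  then show ?thesis
    using transport_unfold [OF p t t'] transport_unfold [OF q] t t' ends by simp
qed

text \<open>Both factors are read off a single lift of the concatenation, cut at an index
  \<open>t'\<close> of the midpoint.\<close>

lemma transport_join:
  assumes p: "pathin X p" and q: "pathin X q" and pq: "p 1 = q 0"
    and t: "t \<in> A (p 0)" "t' \<in> A (p 1)" "t'' \<in> A (q 1)"
  shows "transport (join_loops p q) t t'' = transport p t t' \<otimes> transport q t' t''"
proof -
  have t0: "t \<in> A (join_loops p q 0)" "t'' \<in> A (join_loops p q 1)" using t by simp_all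
  obtain F where F: "lift_along {0..1} (join_loops p q) F" "F 0 t = \<one>"
    using lift_along_path_exists [OF pathin_join [OF p q pq]] t0 by blast
  have Fp: "lift_along {0..1} p (F \<circ> (\<lambda>s. s / 2))"
    by (rule lift_along_compose [OF F(1)]) (auto simp: join_loops_def intro!: continuous_intros)
  have Fq: "lift_along {0..1} q (F \<circ> (\<lambda>s. (s + 1) / 2))"
  proof (rule lift_along_compose [OF F(1)])
    fix s :: real assume s: "s \<in> {0..1}"
    show "q s = join_loops p q ((s + 1) / 2)"
      \<comment> \<open>At \<open>s = 0\<close> the concatenation is evaluated at 1/2, where its
        first branch applies; \<open>p 1 = q 0\<close> is needed exactly there.\<close>
      using pq s by (cases "s = 0") (auto simp: join_loops_def field_simps)
  qed (auto intro!: continuous_intros)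
  have "F 1 t'' = F (1/2) t' \<otimes> transport q t' t''"
    using lift_along_transport [OF Fq, of t' t''] t pq by simp
  moreover have "F (1/2) t' = transport p t t'"
    using lift_along_transport [OF Fp, of t t'] t F(2) transport_closed [OF p t(1,2)] by simp
  moreover have "F 1 t'' \<in> carrier G" using lift_alongD(2) [OF F(1)] t0 by auto
  ultimately show ?thesis
    using transport_unfold [OF F(1) t0] F(2) by simp
qed

lemma transport_reverse:
  assumes p: "pathin X p" and t: "t \<in> A (p 0)" "t' \<in> A (p 1)"
  shows "transport (reverse_path p) t' t = inv (transport p t t')"
proof -
  obtain F where F: "lift_along {0..1} p F" "F 0 t = \<one>"
    using lift_along_path_exists [OF p t(1)] .
  have "lift_along {0..1} (reverse_path p) (F \<circ> (\<lambda>s. 1 - s))"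
    by (rule lift_along_compose [OF F(1)]) (auto simp: reverse_path_def intro!: continuous_intros)
  from transport_unfold [OF this, of t' t] show ?thesis
    using t F(2) transport_unfold [OF F(1) t] lift_alongD(2) [OF F(1)] by simp
qed

end

section \<open>Homomorphisms out of a presented group\<close>

definition letter_value :: "('h, 'i) monoid_scheme \<Rightarrow> ('g \<Rightarrow> 'h) \<Rightarrow> 'g letter \<Rightarrow> 'h" where
  "letter_value H f x = (if snd x then f (fst x) else inv\<^bsub>H\<^esub> f (fst x))"

text \<open>Evaluation is defined on all words, reduced or not, because relators and the words of
  walks need not be reduced.\<close>

definition word_value :: "('h, 'i) monoid_scheme \<Rightarrow> ('g \<Rightarrow> 'h) \<Rightarrow> 'g letter list \<Rightarrow> 'h" where
  "word_value H f w = foldr (\<lambda>x h. letter_value H f x \<otimes>\<^bsub>H\<^esub> h) w \<one>\<^bsub>H\<^esub>"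

lemma word_value_Nil [simp]: "word_value H f [] = \<one>\<^bsub>H\<^esub>"
  and word_value_Cons [simp]: "word_value H f (x # w) = letter_value H f x \<otimes>\<^bsub>H\<^esub> word_value H f w"
  by (simp_all add: word_value_def)

definition reduced_form :: "'g letter list \<Rightarrow> 'g letter list" where
  "reduced_form w = foldr push_letter w []"

context group
begin

lemma letter_value_closed:
  "f \<in> S \<rightarrow> carrier G \<Longrightarrow> x \<in> S \<times> UNIV \<Longrightarrow> letter_value G f x \<in> carrier G"
  by (auto simp: letter_value_def)

lemma word_value_closed:
  assumes "f \<in> S \<rightarrow> carrier G"
  shows "w \<in> lists (S \<times> UNIV) \<Longrightarrow> word_value G f w \<in> carrier G"
  using letter_value_closed [OF assms] by (induction w) auto

lemma word_value_append:
  assumes f: "f \<in> S \<rightarrow> carrier G" and w: "w \<in> lists (S \<times> UNIV)"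
  shows "u \<in> lists (S \<times> UNIV) \<Longrightarrow> word_value G f (u @ w) = word_value G f u \<otimes> word_value G f w"
  using letter_value_closed [OF f] word_value_closed [OF f] w
  by (induction u) (auto simp: m_assoc)

lemma letter_value_inv_letter:
  "f \<in> S \<rightarrow> carrier G \<Longrightarrow> x \<in> S \<times> UNIV \<Longrightarrow> letter_value G f (inv_letter x) = inv (letter_value G f x)"
  using letter_value_closed [of f S x]
  by (auto simp: letter_value_def inv_letter_def Pi_iff)

lemma word_value_push:
  assumes f: "f \<in> S \<rightarrow> carrier G" and x: "x \<in> S \<times> UNIV" and w: "w \<in> lists (S \<times> UNIV)"
  shows "word_value G f (push_letter x w) = letter_value G f x \<otimes> word_value G f w"
  using letter_value_closed [OF f x] letter_value_inv_letter [OF f x] word_value_closed [OF f] w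
  by (cases w) (auto simp: m_assoc [symmetric])

lemma word_value_foldr_push:
  assumes f: "f \<in> S \<rightarrow> carrier G" and w: "w \<in> lists (S \<times> UNIV)"
  shows "u \<in> lists (S \<times> UNIV) \<Longrightarrow>
    word_value G f (foldr push_letter u w) = word_value G f u \<otimes> word_value G f w"
proof (induction u)
  case Nil
  then show ?case using word_value_closed [OF f w] by simp
next
  case (Cons x u)
  then have x: "x \<in> S \<times> UNIV" and u: "u \<in> lists (S \<times> UNIV)" by auto
  have "word_value G f (foldr push_letter (x # u) w) =
      letter_value G f x \<otimes> word_value G f (foldr push_letter u w)"
    using word_value_push [OF f x foldr_push_in_lists [OF u w]] by simp
  also have "\<dots> = word_value G f (x # u) \<otimes> word_value G f w"
    using Cons.IH [OF u] letter_value_closed [OF f x] word_value_closed [OF f] u w by (simp add: m_assoc)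
  finally show ?case .
qed

lemma word_value_reduced_form:
  assumes f: "f \<in> S \<rightarrow> carrier G" and w: "w \<in> lists (S \<times> UNIV)"
  shows "word_value G f (reduced_form w) = word_value G f w"
  using word_value_foldr_push [OF f _ w, of "[]"] word_value_closed [OF f w] by (simp add: reduced_form_def)

lemma word_value_hom:
  assumes f: "f \<in> S \<rightarrow> carrier G"
  shows "word_value G f \<in> hom (free_group S) G"
  using word_value_closed [OF f] word_value_foldr_push [OF f]
  by (auto simp: hom_def free_group_def)

text \<open>One common conjugation of the generators passes through products and inverses. This is
  what allows the monodromy to be an inverse only up to conjugation.\<close>

lemma word_value_conj:
  assumes f: "f \<in> S \<rightarrow> carrier G" and n: "n \<in> carrier G"
    and f': "\<And>s. s \<in> S \<Longrightarrow> f' s = n \<otimes> f s \<otimes> inv n"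
  shows "w \<in> lists (S \<times> UNIV) \<Longrightarrow> word_value G f' w = n \<otimes> word_value G f w \<otimes> inv n"
proof (induction w)
  case (Cons x w)
  then have x: "x \<in> S \<times> UNIV" and w: "w \<in> lists (S \<times> UNIV)" by auto
  have fx: "f (fst x) \<in> carrier G" using x f by auto
  have x': "letter_value G f' x = n \<otimes> letter_value G f x \<otimes> inv n"
    using x f' [of "fst x"] fx n by (auto simp: letter_value_def inv_mult_group m_assoc)
  have l: "letter_value G f x \<in> carrier G" "word_value G f w \<in> carrier G"
    using letter_value_closed [OF f x] word_value_closed [OF f w] by auto
  have "inv n \<otimes> (n \<otimes> (word_value G f w \<otimes> inv n)) = word_value G f w \<otimes> inv n"
    using n l by (simp add: m_assoc [symmetric])
  then show ?case
    using Cons.IH [OF w] x' l n by (simp add: m_assoc)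
qed (use n in auto)

end

lemma hom_word_value:
  assumes G: "group G" and H: "group H" and \<Phi>: "\<Phi> \<in> hom G H" and f: "f \<in> S \<rightarrow> carrier G"
  shows "w \<in> lists (S \<times> UNIV) \<Longrightarrow> \<Phi> (word_value G f w) = word_value H (\<lambda>s. \<Phi> (f s)) w"
proof (induction w)
  interpret \<Phi>: group_hom G H \<Phi> using assms by (simp add: group_hom_def group_hom_axioms_def)
  {
    case Nil
    then show ?case by simp
  next
    case (Cons x w)
    then have x: "x \<in> S \<times> UNIV" and w: "w \<in> lists (S \<times> UNIV)" by auto
    have "\<Phi> (letter_value G f x) = letter_value H (\<lambda>s. \<Phi> (f s)) x"
    proof -
      have "f (fst x) \<in> carrier G" using x f by auto
      then show ?thesis by (simp add: letter_value_def)
    qed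
    then show ?case
      using Cons.IH [OF w] group.letter_value_closed [OF G f x] group.word_value_closed [OF G f w] by simp
  }
qed

lemma reduced_form_carrier:
  "w \<in> lists (S \<times> UNIV) \<Longrightarrow> reduced_form w \<in> carrier (free_group S)"
  using foldr_push_in_lists [of w S "[]"] by (simp add: free_group_def reduced_form_def)

definition presented_gen :: "'g set \<Rightarrow> 'g letter list set \<Rightarrow> 'g \<Rightarrow> 'g letter list set" where
  "presented_gen S R s =
     normal_closure (free_group S) (reduced_form ` R) #>\<^bsub>free_group S\<^esub> [(s, True)]"

locale presentation =
  fixes S :: "'g set" and R :: "'g letter list set"
  assumes relators: "R \<subseteq> lists (S \<times> UNIV)"
begin

abbreviation "F \<equiv> free_group S"
abbreviation "K \<equiv> normal_closure F (reduced_form ` R)"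
abbreviation "P \<equiv> presented_group S R"

lemma P_eq: "P = F Mod K"
  by (simp add: presented_group_def reduced_form_def [abs_def])

sublocale F: group F by (rule group_free_group)

lemma normal_K: "K \<lhd> F"
  using relators by (intro normal_normal_closure group_free_group) (auto intro: reduced_form_carrier)

sublocale P: group P
  by (rule group_presented_group [OF relators])

lemma gen_in_F: "s \<in> S \<Longrightarrow> [(s, e)] \<in> carrier F"
  by (simp add: free_group_def)

lemma coset_hom: "(\<lambda>w. K #>\<^bsub>F\<^esub> w) \<in> hom F P"
  unfolding P_eq by (rule normal.r_coset_hom_Mod [OF normal_K])

lemma presented_gen_closed: "presented_gen S R \<in> S \<rightarrow> carrier P"
  using coset_hom gen_in_F unfolding presented_gen_def hom_def by blast

text \<open>The bridge between words and cosets: a word evaluates to the identity of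
  \<open>P\<close> exactly when its reduced form lies in the normal closure.\<close>

lemma word_value_presented_gen:
  "w \<in> lists (S \<times> UNIV) \<Longrightarrow> word_value P (presented_gen S R) w = K #>\<^bsub>F\<^esub> reduced_form w"
proof (induction w)
  interpret q: group_hom F P "\<lambda>w. K #>\<^bsub>F\<^esub> w"
    using coset_hom by unfold_locales
  {
    case Nil
    show ?case using q.hom_one by (simp add: reduced_form_def free_group_def)
  next
    case (Cons x w)
    then have x: "fst x \<in> S" and w: "w \<in> lists (S \<times> UNIV)" by auto
    have inv: "[(fst x, False)] = inv\<^bsub>F\<^esub> [(fst x, True)]"
      using gen_in_F [OF x]
      by (intro F.inv_equality [symmetric]) (auto simp: free_group_def inv_letter_def)
    have l: "letter_value P (presented_gen S R) x = K #>\<^bsub>F\<^esub> [x]"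
    proof (cases "snd x")
      case True
      then have "[x] = [(fst x, True)]" by (metis prod.collapse)
      then show ?thesis using True by (simp add: letter_value_def presented_gen_def)
    next
      case False
      then have "[x] = inv\<^bsub>F\<^esub> [(fst x, True)]" using inv by (metis prod.collapse)
      then show ?thesis
        using False gen_in_F [OF x] by (simp add: letter_value_def presented_gen_def)
    qed
    have "[x] \<otimes>\<^bsub>F\<^esub> reduced_form w = reduced_form (x # w)"
      by (simp add: free_group_def reduced_form_def)
    moreover have "[x] \<in> carrier F" using gen_in_F [OF x, of "snd x"] by simp
    ultimately show ?case
      using Cons.IH [OF w] l q.hom_mult [of "[x]" "reduced_form w"] reduced_form_carrier [OF w] by simp
  }
qed

lemma word_value_relator: 
  assumes "r \<in> R"
  shows "word_value P (presented_gen S R) r = \<one>\<^bsub>P\<^esub>"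
proof -
  have r: "r \<in> lists (S \<times> UNIV)" using relators assms by blast
  have "reduced_form r \<in> K"
  proof -
    have "\<one>\<^bsub>F\<^esub> \<otimes>\<^bsub>F\<^esub> reduced_form r \<otimes>\<^bsub>F\<^esub> inv\<^bsub>F\<^esub> \<one>\<^bsub>F\<^esub> = reduced_form r"
      using reduced_form_carrier [OF r] by simp
    then have "reduced_form r \<in> {g \<otimes>\<^bsub>F\<^esub> r \<otimes>\<^bsub>F\<^esub> inv\<^bsub>F\<^esub> g |g r. g \<in> carrier F \<and> r \<in> reduced_form ` R}"
      using assms F.one_closed by (metis (mono_tags, lifting) imageI mem_Collect_eq)
    then show ?thesis unfolding normal_closure_def by (rule generate.incl)
  qed
  then show ?thesis
    using normal_K reduced_form_carrier [OF r] unfolding word_value_presented_gen [OF r]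
    by (simp add: P_eq F.coset_join2 normal_imp_subgroup)
qed

text \<open>The map from the free group onto \<open>H\<close> kills the relators. A word that it
  kills is sent by \<open>\<Phi>\<close> to a conjugate of its own class in \<open>P\<close>, so
  that class is trivial and the kernel is no larger than \<open>K\<close>. Hence
  \<open>\<Phi>\<close> need not be a strict inverse.\<close>

lemma iso_presented_group:
  assumes H: "group H" and f: "f \<in> S \<rightarrow> carrier H"
    and rel: "\<And>r. r \<in> R \<Longrightarrow> word_value H f r = \<one>\<^bsub>H\<^esub>"
    and gen: "carrier H \<subseteq> word_value H f ` lists (S \<times> UNIV)"
    and \<Phi>: "\<Phi> \<in> hom H P" and n: "n \<in> carrier P"
    and \<Phi>f: "\<And>s. s \<in> S \<Longrightarrow> \<Phi> (f s) = n \<otimes>\<^bsub>P\<^esub> presented_gen S R s \<otimes>\<^bsub>P\<^esub> inv\<^bsub>P\<^esub> n"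
  shows "H \<cong> P"
proof -
  interpret H: group H by fact
  interpret \<Psi>: group_hom F H "word_value H f"
    using H.word_value_hom [OF f] by unfold_locales
  interpret \<Phi>: group_hom H P \<Phi> using \<Phi> by unfold_locales
  have onto: "word_value H f ` carrier F = carrier H"
  proof
    show "carrier H \<subseteq> word_value H f ` carrier F"
    proof
      fix h assume "h \<in> carrier H"
      then obtain w where w: "w \<in> lists (S \<times> UNIV)" "h = word_value H f w" using gen by blast
      then show "h \<in> word_value H f ` carrier F"
        using H.word_value_reduced_form [OF f w(1)] reduced_form_carrier [OF w(1)] by (metis imageI)
    qed
  qed auto
  have "kernel F H (word_value H f) = K"
  proof
    show "K \<subseteq> kernel F H (word_value H f)"
      unfolding normal_closure_def
    proof (rule F.generate_subgroup_incl [OF _ \<Psi>.subgroup_kernel], safe)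
      fix g r assume g: "g \<in> carrier F" and r: "r \<in> R"
      then have r': "r \<in> lists (S \<times> UNIV)" using relators by blast
      have "word_value H f (reduced_form r) = \<one>\<^bsub>H\<^esub>"
        using rel [OF r] H.word_value_reduced_form [OF f r'] by simp
      then show "g \<otimes>\<^bsub>F\<^esub> reduced_form r \<otimes>\<^bsub>F\<^esub> inv\<^bsub>F\<^esub> g \<in> kernel F H (word_value H f)"
        using g reduced_form_carrier [OF r'] by (simp add: kernel_def)
    qed
    show "kernel F H (word_value H f) \<subseteq> K"
    proof
      fix w assume "w \<in> kernel F H (word_value H f)"
      then have w: "w \<in> carrier F" "word_value H f w = \<one>\<^bsub>H\<^esub>" by (auto simp: kernel_def)
      then have w': "w \<in> lists (S \<times> UNIV)" "reduced_form w = w"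
        by (auto simp: free_group_def reduced_form_def foldr_push_Nil)
      let ?v = "word_value P (presented_gen S R) w"
      have v: "?v \<in> carrier P" by (rule P.word_value_closed [OF presented_gen_closed w'(1)])
      have "\<one>\<^bsub>P\<^esub> = word_value P (\<lambda>s. \<Phi> (f s)) w"
        using hom_word_value [OF H P.group_axioms \<Phi> f w'(1)] w by simp
      also have "\<dots> = n \<otimes>\<^bsub>P\<^esub> ?v \<otimes>\<^bsub>P\<^esub> inv\<^bsub>P\<^esub> n"
        using \<Phi>f by (intro P.word_value_conj [OF presented_gen_closed n _ w'(1)]) simp
      finally have "n \<otimes>\<^bsub>P\<^esub> ?v = n"
        using n v P.inv_solve_right [of "\<one>\<^bsub>P\<^esub>" "n \<otimes>\<^bsub>P\<^esub> ?v" n] by simp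
      then have "?v = \<one>\<^bsub>P\<^esub>" using n v P.l_cancel_one [of n ?v] by simp
      then have "K #>\<^bsub>F\<^esub> w = K"
        using word_value_presented_gen [OF w'(1)] w'(2) by (simp add: P_eq)
      then show "w \<in> K"
        by (rule F.coset_join1 [OF _ w(1) normal_imp_subgroup [OF normal_K]])
    qed
  qed
  then have "P \<cong> H"
    using \<Psi>.FactGroup_iso [OF onto] by (simp add: P_eq)
  then show ?thesis
    using P.iso_sym by blast
qed

end

section \<open>Walks in a labelled graph\<close>

text \<open>The edge labelled \<open>j\<close> leaves the vertex \<open>t\<close> towards \<open>b j t\<close> and carries the generator \<open>(j, t)\<close>.\<close>

fun walk_edges :: "('j \<Rightarrow> 't \<Rightarrow> 't) \<Rightarrow> 't \<Rightarrow> 'j list \<Rightarrow> ('j \<times> 't) list" where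
  "walk_edges b t [] = []"
| "walk_edges b t (j # js) = (j, t) # walk_edges b (b j t) js"

abbreviation walk_word :: "('j \<Rightarrow> 't \<Rightarrow> 't) \<Rightarrow> 't \<Rightarrow> 'j list \<Rightarrow> ('j \<times> 't) letter list" where
  "walk_word b t js \<equiv> map (\<lambda>s. (s, True)) (walk_edges b t js)"

text \<open>The labels act on the vertices as commuting involutions. In the application the vertices
  are the vectors of \<open>Z2_vectors n\<close> and a label acts by translation with the class of
  an edge vector.\<close>

locale edge_involutions =
  fixes D :: "'j set" and T :: "'t set" and b :: "'j \<Rightarrow> 't \<Rightarrow> 't"
  assumes b_closed: "j \<in> D \<Longrightarrow> t \<in> T \<Longrightarrow> b j t \<in> T"
    and b_invol: "j \<in> D \<Longrightarrow> t \<in> T \<Longrightarrow> b j (b j t) = t"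
    and b_comm: "i \<in> D \<Longrightarrow> j \<in> D \<Longrightarrow> t \<in> T \<Longrightarrow> b i (b j t) = b j (b i t)"
begin

lemma fold_b_closed: "set js \<subseteq> D \<Longrightarrow> t \<in> T \<Longrightarrow> fold b js t \<in> T"
  by (induction js arbitrary: t) (auto simp: b_closed)

lemma fold_b_rev: "set js \<subseteq> D \<Longrightarrow> t \<in> T \<Longrightarrow> fold b (rev js) (fold b js t) = t"
  by (induction js arbitrary: t) (auto simp: b_closed b_invol)

lemma fold_b_move: "set js \<subseteq> D \<Longrightarrow> j \<in> D \<Longrightarrow> t \<in> T \<Longrightarrow> fold b js (b j t) = b j (fold b js t)"
proof (induction js arbitrary: t)
  case (Cons k js)
  then show ?case using b_comm [of k j t] by (simp add: b_closed)
qed simp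

lemma walk_word_in_lists:
  "set js \<subseteq> D \<Longrightarrow> t \<in> T \<Longrightarrow> walk_word b t js \<in> lists ((D \<times> T) \<times> UNIV)"
  by (induction js arbitrary: t) (auto simp: b_closed)

text \<open>A change of the edge values by a function on the vertices telescopes along a walk and
  leaves only the two ends. It is used in the fundamental group with \<open>B\<close> and in
  \<open>P\<close> with \<open>n\<close>.\<close>

lemma word_value_walk_conj:
  assumes G: "group G" and f: "f \<in> D \<times> T \<rightarrow> carrier G" and n: "n \<in> T \<rightarrow> carrier G"
    and f': "\<And>j t. j \<in> D \<Longrightarrow> t \<in> T \<Longrightarrow> f' (j, t) = n t \<otimes>\<^bsub>G\<^esub> f (j, t) \<otimes>\<^bsub>G\<^esub> inv\<^bsub>G\<^esub> n (b j t)"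
  shows "set js \<subseteq> D \<Longrightarrow> t \<in> T \<Longrightarrow> word_value G f' (walk_word b t js) =
    n t \<otimes>\<^bsub>G\<^esub> word_value G f (walk_word b t js) \<otimes>\<^bsub>G\<^esub> inv\<^bsub>G\<^esub> n (fold b js t)"
proof (induction js arbitrary: t)
  interpret G: group G by fact
  {
    case Nil
    then have "n t \<in> carrier G" using n by auto
    then show ?case by simp
  next
    case (Cons j js)
    then have j: "j \<in> D" "set js \<subseteq> D" "b j t \<in> T" by (auto simp: b_closed)
    have nt: "n t \<in> carrier G" "n (b j t) \<in> carrier G" "n (fold b js (b j t)) \<in> carrier G"
      using n j Cons.prems fold_b_closed [OF j(2,3)] by auto
    have ft: "f (j, t) \<in> carrier G" using f j Cons.prems by auto
    have w: "word_value G f (walk_word b (b j t) js) \<in> carrier G"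
      by (rule G.word_value_closed [OF f walk_word_in_lists [OF j(2,3)]])
    have "inv\<^bsub>G\<^esub> n (b j t) \<otimes>\<^bsub>G\<^esub> (n (b j t) \<otimes>\<^bsub>G\<^esub> x) = x" if "x \<in> carrier G" for x
      using nt that by (simp add: G.m_assoc [symmetric])
    then show ?case
      using Cons.IH [OF j(2,3)] f' [of j t] Cons.prems j nt ft w
      by (simp add: letter_value_def G.m_assoc)
  }
qed

end

section \<open>The fundamental group of a union of simply connected charts\<close>

text \<open>The model is a real toric variety: \<open>U i\<close> is the affine chart of a cone, \<open>J i\<close> the set of its
  edges, \<open>e t\<close> a base point in the component \<open>t\<close> of the torus, and \<open>b j t\<close> the component reached from \<open>t\<close>
  by crossing the divisor of the edge \<open>j\<close>. The component \<open>t\<close> is reached from \<open>t0\<close> along \<open>w t\<close>.\<close>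

locale chart_atlas = edge_involutions D T b
  for D :: "'j set" and T :: "'t set" and b :: "'j \<Rightarrow> 't \<Rightarrow> 't" +
  fixes X :: "'b topology" and I :: "'c set" and U :: "'c \<Rightarrow> 'b set" and J :: "'c \<Rightarrow> 'j set"
    and e :: "'t \<Rightarrow> 'b" and t0 :: 't and w :: "'t \<Rightarrow> 'j list"
  assumes U_open: "i \<in> I \<Longrightarrow> openin X (U i)"
    and minimal_chart: "x \<in> topspace X \<Longrightarrow> \<exists>i\<in>I. x \<in> U i \<and> (\<forall>k\<in>I. x \<in> U k \<longrightarrow> U i \<subseteq> U k \<and> J i \<subseteq> J k)"
    and locally_connected: "i \<in> I \<Longrightarrow> x \<in> U i \<Longrightarrow>
      \<exists>V. openin X V \<and> x \<in> V \<and> (\<forall>y\<in>V. path_component_of (subtopology X (U i)) x y)"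
    and loops_contract: "i \<in> I \<Longrightarrow> pathin (subtopology X (U i)) p \<Longrightarrow> p 1 = p 0 \<Longrightarrow>
      path_homotopic X p (\<lambda>_. p 0)"
    and reach: "i \<in> I \<Longrightarrow> x \<in> U i \<Longrightarrow> \<exists>t\<in>T. path_component_of (subtopology X (U i)) x (e t)"
    and edge_path: "j \<in> D \<Longrightarrow> t \<in> T \<Longrightarrow> \<exists>\<gamma>. pathin X \<gamma> \<and> \<gamma> 0 = e t \<and> \<gamma> 1 = e (b j t) \<and>
      (\<forall>i\<in>I. j \<in> J i \<longrightarrow> pathin (subtopology X (U i)) \<gamma>)"
    and D_eq: "D = \<Union>(J ` I)"
    and base_in: "i \<in> I \<Longrightarrow> t \<in> T \<Longrightarrow> e t \<in> U i"
    and same_component: "\<lbrakk>i \<in> I; t \<in> T; t' \<in> T; path_component_of (subtopology X (U i)) (e t) (e t')\<rbrakk> \<Longrightarrow>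
      \<exists>js. set js \<subseteq> J i \<and> fold b js t = t'"
    and independent_edges: "\<lbrakk>i \<in> I; distinct js; set js \<subseteq> J i; t \<in> T; fold b js t = t\<rbrakk> \<Longrightarrow> js = []"
    and t0_in: "t0 \<in> T"
    and base_walk: "t \<in> T \<Longrightarrow> set (w t) \<subseteq> D \<and> fold b (w t) t0 = t"
    and base_walk_t0: "w t0 = []"
begin

text \<open>All relators are words of walks: from the base vertex to a vertex along its chosen walk,
  across an edge and back, and around the square of two labels of one chart. The last walk closes
  because crossings commute and are involutions.\<close>

definition relators :: "('j \<times> 't) letter list set" where
  "relators = {walk_word b t0 (w t) | t. t \<in> T} \<union>
     {walk_word b t [j, j] | j t. j \<in> D \<and> t \<in> T} \<union>
     {walk_word b t [p, q, p, q] | p q t. t \<in> T \<and> (\<exists>i\<in>I. p \<in> J i \<and> q \<in> J i)}"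

lemma J_subset: "i \<in> I \<Longrightarrow> J i \<subseteq> D"
  using D_eq by blast

sublocale presentation "D \<times> T" relators
proof
  show "relators \<subseteq> lists ((D \<times> T) \<times> UNIV)"
  proof
    fix r assume "r \<in> relators"
    then obtain js t where "r = walk_word b t js" "set js \<subseteq> D" "t \<in> T"
      unfolding relators_def using base_walk t0_in J_subset by fastforce
    then show "r \<in> lists ((D \<times> T) \<times> UNIV)" using walk_word_in_lists by blast
  qed
qed

abbreviation Y :: "'j \<times> 't \<Rightarrow> ('j \<times> 't) letter list set" where
  "Y \<equiv> presented_gen (D \<times> T) relators"

section \<open>Values of walks in the presented group\<close>

definition walk_value :: "'t \<Rightarrow> 'j list \<Rightarrow> ('j \<times> 't) letter list set" where
  "walk_value t js = word_value P Y (walk_word b t js)"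

lemma Y_closed: "j \<in> D \<Longrightarrow> t \<in> T \<Longrightarrow> Y (j, t) \<in> carrier P"
  using presented_gen_closed by auto

lemma walk_value_closed: "set js \<subseteq> D \<Longrightarrow> t \<in> T \<Longrightarrow> walk_value t js \<in> carrier P"
  unfolding walk_value_def by (rule P.word_value_closed [OF presented_gen_closed walk_word_in_lists])

lemma walk_value_Nil [simp]: "walk_value t [] = \<one>\<^bsub>P\<^esub>"
  and walk_value_Cons [simp]: "walk_value t (j # js) = Y (j, t) \<otimes>\<^bsub>P\<^esub> walk_value (b j t) js"
  by (simp_all add: walk_value_def letter_value_def)

lemma walk_value_append:
  assumes "set ks \<subseteq> D"
  shows "set js \<subseteq> D \<Longrightarrow> t \<in> T \<Longrightarrow>
    walk_value t (js @ ks) = walk_value t js \<otimes>\<^bsub>P\<^esub> walk_value (fold b js t) ks"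
proof (induction js arbitrary: t)
  case Nil
  then show ?case using walk_value_closed assms by simp
next
  case (Cons j js)
  then have "b j t \<in> T" "set js \<subseteq> D" "j \<in> D" by (auto simp: b_closed)
  then show ?case
    using Cons.IH Cons.prems walk_value_closed [OF assms fold_b_closed] walk_value_closed Y_closed
    by (simp add: P.m_assoc)
qed

lemma Y_involution:
  assumes "j \<in> D" "t \<in> T"
  shows "Y (j, t) \<otimes>\<^bsub>P\<^esub> Y (j, b j t) = \<one>\<^bsub>P\<^esub>"
proof -
  have "walk_word b t [j, j] \<in> relators" using assms unfolding relators_def by blast
  from word_value_relator [OF this] show ?thesis
    using assms by (simp add: letter_value_def Y_closed b_closed)
qed

text \<open>The four-letter relator makes the first two sides inverse to the last two, and
  \<open>Y_involution\<close> turns the inverse of those into the other way around the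
  square.\<close>

lemma Y_square:
  assumes i: "i \<in> I" and pq: "p \<in> J i" "q \<in> J i" and t: "t \<in> T"
  shows "Y (p, t) \<otimes>\<^bsub>P\<^esub> Y (q, b p t) = Y (q, t) \<otimes>\<^bsub>P\<^esub> Y (p, b q t)"
proof -
  have D: "p \<in> D" "q \<in> D" using i pq J_subset by auto
  have "walk_word b t [p, q, p, q] \<in> relators" using assms unfolding relators_def by blast
  from word_value_relator [OF this]
  have *: "Y (p, t) \<otimes>\<^bsub>P\<^esub> (Y (q, b p t) \<otimes>\<^bsub>P\<^esub> (Y (p, b q (b p t)) \<otimes>\<^bsub>P\<^esub> Y (q, b p (b q (b p t))))) = \<one>\<^bsub>P\<^esub>"
    using D t by (simp add: letter_value_def Y_closed b_closed)
  have 1: "b p (b q (b p t)) = b q t" "b q (b p t) = b p (b q t)"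
    using D t by (simp_all add: b_comm b_closed b_invol)
  have inv: "inv\<^bsub>P\<^esub> Y (q, b q t) = Y (q, t)" "inv\<^bsub>P\<^esub> Y (p, b p (b q t)) = Y (p, b q t)"
    using P.inv_equality [OF Y_involution [OF D(2) t]]
      P.inv_equality [OF Y_involution [OF D(1) b_closed [OF D(2) t]]] D t
    by (simp_all add: Y_closed b_closed)
  let ?x = "Y (p, t) \<otimes>\<^bsub>P\<^esub> Y (q, b p t)" and ?y = "Y (p, b p (b q t)) \<otimes>\<^bsub>P\<^esub> Y (q, b q t)"
  have c: "?x \<in> carrier P" "?y \<in> carrier P" using D t by (simp_all add: Y_closed b_closed)
  have "?x \<otimes>\<^bsub>P\<^esub> ?y = \<one>\<^bsub>P\<^esub>"
    using * 1 D t by (simp add: P.m_assoc Y_closed b_closed)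
  then have "?x = inv\<^bsub>P\<^esub> ?y" using c by (metis P.inv_equality)
  also have "\<dots> = Y (q, t) \<otimes>\<^bsub>P\<^esub> Y (p, b q t)"
    using D t inv by (simp add: P.inv_mult_group Y_closed b_closed)
  finally show ?thesis .
qed

text \<open>The label \<open>j\<close> is pushed through the others one square at a time. The
  purpose is to bring two occurrences of the same label next to each other.\<close>

lemma walk_value_rotate:
  assumes i: "i \<in> I" and j: "j \<in> J i"
  shows "set js \<subseteq> J i \<Longrightarrow> t \<in> T \<Longrightarrow> walk_value t (j # js) = walk_value t (js @ [j])"
proof (induction js arbitrary: t)
  case Nil
  then show ?case by simp
next
  case (Cons k js)
  have D: "j \<in> D" "k \<in> D" "set js \<subseteq> D" using i j Cons.prems J_subset by auto
  have t: "b j t \<in> T" "b k t \<in> T" "b j (b k t) \<in> T" using D Cons.prems b_closed by auto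
  have "walk_value t (j # k # js) = (Y (j, t) \<otimes>\<^bsub>P\<^esub> Y (k, b j t)) \<otimes>\<^bsub>P\<^esub> walk_value (b j (b k t)) js"
    using D t Cons.prems b_comm [of k j t]
    by (simp add: P.m_assoc Y_closed walk_value_closed)
  also have "\<dots> = Y (k, t) \<otimes>\<^bsub>P\<^esub> walk_value (b k t) (j # js)"
    using D t Cons.prems Y_square [OF i j, of k t]
    by (simp add: P.m_assoc Y_closed walk_value_closed)
  also have "\<dots> = walk_value t ((k # js) @ [j])"
    using Cons.IH [of "b k t"] Cons.prems t by simp
  finally show ?case .
qed

text \<open>By independence of the labels of a chart, a nonempty closed walk repeats a label. Moving
  one occurrence next to the other cancels both without moving the end of the walk, and the
  induction on length applies.\<close>

lemma walk_value_closed_walk: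
  assumes i: "i \<in> I"
  shows "set js \<subseteq> J i \<Longrightarrow> t \<in> T \<Longrightarrow> fold b js t = t \<Longrightarrow> walk_value t js = \<one>\<^bsub>P\<^esub>"
proof (induction js rule: length_induct)
  case (1 js)
  show ?case
  proof (cases "distinct js")
    case True
    then have "js = []" using independent_edges i 1 by blast
    then show ?thesis by simp
  next
    case False
    then obtain xs ys zs j where js: "js = xs @ [j] @ ys @ [j] @ zs"
      using not_distinct_decomp by blast
    have J: "set xs \<subseteq> J i" "set ys \<subseteq> J i" "set zs \<subseteq> J i" "j \<in> J i" using 1 js by auto
    have D: "set xs \<subseteq> D" "set ys \<subseteq> D" "set zs \<subseteq> D" "j \<in> D" using J J_subset [OF i] by auto
    define s where "s = fold b xs t"
    define r where "r = fold b ys s"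
    have s: "s \<in> T" "b j s \<in> T" unfolding s_def using 1 D b_closed fold_b_closed by auto
    have r: "r \<in> T" "fold b ys (b j s) = b j r"
      unfolding r_def using s D by (auto simp: fold_b_closed fold_b_move)
    have "walk_value s ([j] @ ys @ [j] @ zs) = walk_value s (j # ys) \<otimes>\<^bsub>P\<^esub> walk_value (b j r) (j # zs)"
      using walk_value_append [of "j # zs" "j # ys" s] s r D by simp
    also have "\<dots> = walk_value s ys \<otimes>\<^bsub>P\<^esub> (Y (j, r) \<otimes>\<^bsub>P\<^esub> (Y (j, b j r) \<otimes>\<^bsub>P\<^esub> walk_value r zs))"
    proof -
      \<comment> \<open>The first \<open>j\<close> is carried past \<open>ys\<close>; it then starts
        at \<open>r\<close> instead of \<open>s\<close> and meets the second
        \<open>j\<close>.\<close>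
      have "walk_value s (j # ys) = walk_value s ys \<otimes>\<^bsub>P\<^esub> Y (j, r)"
        using walk_value_rotate [OF i J(4,2) s(1)] walk_value_append [of "[j]" ys s] D s r
        by (simp add: r_def Y_closed)
      then show ?thesis
        using D s r by (simp add: P.m_assoc Y_closed walk_value_closed b_closed b_invol)
    qed
    also have "\<dots> = walk_value s ys \<otimes>\<^bsub>P\<^esub> walk_value r zs"
      using Y_involution [OF D(4) r(1)] D r s
      by (simp add: P.m_assoc [symmetric] Y_closed walk_value_closed b_closed)
    also have "\<dots> = walk_value s (ys @ zs)"
      using walk_value_append [of zs ys s] D s by (simp add: r_def)
    finally have "walk_value t js = walk_value t (xs @ ys @ zs)"
      using walk_value_append [of "ys @ zs" xs t] walk_value_append [of "[j] @ ys @ [j] @ zs" xs t] 1 D js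
      by (simp add: s_def)
    moreover have "fold b (xs @ ys @ zs) t = t"
    proof -
      have "fold b js t = fold b zs (b j (fold b ys (b j s)))" by (simp add: js s_def)
      also have "\<dots> = fold b zs r" using r D b_invol by simp
      finally show ?thesis using 1 by (simp add: r_def s_def)
    qed
    moreover have "length (xs @ ys @ zs) < length js" "set (xs @ ys @ zs) \<subseteq> J i"
      using js J by auto
    ultimately show ?thesis using 1 by metis
  qed
qed

lemma walk_value_rev:
  "set js \<subseteq> D \<Longrightarrow> t \<in> T \<Longrightarrow> walk_value (fold b js t) (rev js) = inv\<^bsub>P\<^esub> walk_value t js"
proof (induction js arbitrary: t)
  case (Cons j js)
  then have D: "j \<in> D" "set js \<subseteq> D" "b j t \<in> T" by (auto simp: b_closed)
  have "Y (j, b j t) = inv\<^bsub>P\<^esub> Y (j, t)"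
    using Y_involution [of j "b j t"] D Cons.prems
    by (intro P.inv_equality [symmetric]) (auto simp: Y_closed b_invol)
  then show ?case
    using Cons.IH [OF D(2,3)] D Cons.prems walk_value_append [of "[j]" "rev js" "fold b js (b j t)"]
    by (simp add: fold_b_closed fold_b_rev Y_closed P.inv_mult_group walk_value_closed b_closed)
qed simp

text \<open>One walk followed by the reverse of the other is closed. This independence of the walk
  makes the cocycle of a chart well defined.\<close>

lemma walk_value_unique:
  assumes i: "i \<in> I" and js: "set js \<subseteq> J i" "set ks \<subseteq> J i" and t: "t \<in> T"
    and eq: "fold b js t = fold b ks t"
  shows "walk_value t js = walk_value t ks"
proof -
  have D: "set js \<subseteq> D" "set ks \<subseteq> D" using js J_subset [OF i] by auto
  have "walk_value t (js @ rev ks) = \<one>\<^bsub>P\<^esub>"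
    using i js t eq D by (intro walk_value_closed_walk) (auto simp: fold_b_rev)
  moreover have "walk_value t (js @ rev ks) = walk_value t js \<otimes>\<^bsub>P\<^esub> inv\<^bsub>P\<^esub> walk_value t ks"
    using D t eq walk_value_rev [of ks t] walk_value_append [of "rev ks" js t] by simp
  ultimately show ?thesis
    using D t walk_value_closed P.inv_solve_right [of "\<one>\<^bsub>P\<^esub>" "walk_value t js" "walk_value t ks"]
    by simp
qed

section \<open>The cocycle of the atlas\<close>

definition joined :: "'c \<Rightarrow> 't \<Rightarrow> 't \<Rightarrow> bool" where
  "joined i t t' \<longleftrightarrow> (\<exists>js. set js \<subseteq> J i \<and> fold b js t = t')"

text \<open>The choice of the walk does not matter by \<open>walk_value_unique\<close>; on vertices
  that are not \<open>joined\<close> the value is meaningless.\<close>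

definition coc :: "'c \<Rightarrow> 't \<Rightarrow> 't \<Rightarrow> ('j \<times> 't) letter list set" where
  "coc i t t' = walk_value t (SOME js. set js \<subseteq> J i \<and> fold b js t = t')"

lemma coc_fold:
  assumes "i \<in> I" "set js \<subseteq> J i" "t \<in> T"
  shows "coc i t (fold b js t) = walk_value t js"
proof -
  let ?P = "\<lambda>ks. set ks \<subseteq> J i \<and> fold b ks t = fold b js t"
  have "?P (SOME ks. ?P ks)" by (rule someI [of ?P js]) (use assms in auto)
  then show ?thesis
    unfolding coc_def using assms by (intro walk_value_unique) auto
qed

lemma coc_closed:
  assumes "i \<in> I" "t \<in> T" "joined i t t'"
  shows "coc i t t' \<in> carrier P"
proof -
  obtain js where "set js \<subseteq> J i" "t' = fold b js t" using assms by (auto simp: joined_def)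
  then show ?thesis
    using coc_fold assms walk_value_closed J_subset by fastforce
qed

lemma coc_mult:
  assumes i: "i \<in> I" "t \<in> T" and "joined i t t'" "joined i t' t''"
  shows "coc i t t' \<otimes>\<^bsub>P\<^esub> coc i t' t'' = coc i t t''"
proof -
  obtain js ks where js: "set js \<subseteq> J i" "t' = fold b js t" and ks: "set ks \<subseteq> J i" "t'' = fold b ks t'"
    using assms by (auto simp: joined_def)
  have D: "set js \<subseteq> D" "set ks \<subseteq> D" using js ks J_subset i by auto
  have "coc i t t'' = walk_value t (js @ ks)"
    using coc_fold [of i "js @ ks" t] js ks i by simp
  moreover have "coc i t t' = walk_value t js" using coc_fold js i by simp
  moreover have "coc i t' t'' = walk_value t' ks"
    using coc_fold ks i js fold_b_closed D by simp
  ultimately show ?thesis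
    using walk_value_append [OF D(2,1) i(2)] js by simp
qed

text \<open>A walk in the smaller chart is also a walk in the larger one, so the cocycles of nested
  charts agree where both make sense.\<close>

lemma coc_mono:
  assumes "i \<in> I" "k \<in> I" "J i \<subseteq> J k" "t \<in> T" "joined i t t'"
  shows "coc i t t' = coc k t t'"
proof -
  obtain js where "set js \<subseteq> J i" "t' = fold b js t" using assms by (auto simp: joined_def)
  then show ?thesis using coc_fold assms by (metis subset_trans)
qed

abbreviation linked :: "'c \<Rightarrow> 'b \<Rightarrow> 'b \<Rightarrow> bool" where
  "linked i \<equiv> path_component_of (subtopology X (U i))"

lemma linked_mono: "U i \<subseteq> U k \<Longrightarrow> linked i x y \<Longrightarrow> linked k x y"
  unfolding path_component_of_def pathin_subtopology by blast

lemma linked_sym: "linked i x y \<Longrightarrow> linked i y x"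
  by (simp add: path_component_of_sym)

lemma linked_joined: "\<lbrakk>i \<in> I; t \<in> T; t' \<in> T; linked i x (e t); linked i x (e t')\<rbrakk> \<Longrightarrow> joined i t t'"
  using same_component [of i t t'] path_component_of_trans [OF linked_sym]
  unfolding joined_def by metis

text \<open>The least chart around \<open>x\<close>; for a toric variety it belongs to the cone
  whose torus orbit contains \<open>x\<close>.\<close>

definition \<tau> :: "'b \<Rightarrow> 'c" where
  "\<tau> x = (SOME i. i \<in> I \<and> x \<in> U i \<and> (\<forall>k\<in>I. x \<in> U k \<longrightarrow> U i \<subseteq> U k \<and> J i \<subseteq> J k))"

lemma \<tau>_minimal:
  assumes "x \<in> topspace X"
  shows "\<tau> x \<in> I" "x \<in> U (\<tau> x)"
    "\<And>k. k \<in> I \<Longrightarrow> x \<in> U k \<Longrightarrow> U (\<tau> x) \<subseteq> U k" "\<And>k. k \<in> I \<Longrightarrow> x \<in> U k \<Longrightarrow> J (\<tau> x) \<subseteq> J k"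
proof -
  have "\<tau> x \<in> I \<and> x \<in> U (\<tau> x) \<and> (\<forall>k\<in>I. x \<in> U k \<longrightarrow> U (\<tau> x) \<subseteq> U k \<and> J (\<tau> x) \<subseteq> J k)"
    unfolding \<tau>_def by (rule someI_ex) (use minimal_chart [OF assms] in \<open>simp only: Bex_def\<close>)
  then show "\<tau> x \<in> I" "x \<in> U (\<tau> x)"
    "\<And>k. k \<in> I \<Longrightarrow> x \<in> U k \<Longrightarrow> U (\<tau> x) \<subseteq> U k" "\<And>k. k \<in> I \<Longrightarrow> x \<in> U k \<Longrightarrow> J (\<tau> x) \<subseteq> J k"
    by simp_all
qed

text \<open>\<open>A x\<close> consists of the components of the torus that have \<open>x\<close> in their closure.\<close>

definition A :: "'b \<Rightarrow> 't set" where
  "A x = {t \<in> T. linked (\<tau> x) x (e t)}"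

lemma A_linked:
  assumes "x \<in> topspace X" "t \<in> A x" "i \<in> I" "x \<in> U i"
  shows "linked i x (e t)"
  by (rule linked_mono [OF \<tau>_minimal(3) [OF assms(1,3,4)]]) (use assms(2) in \<open>simp add: A_def\<close>)

lemma A_in_T: "t \<in> A x \<Longrightarrow> t \<in> T"
  by (simp add: A_def)

lemma A_joined:
  assumes "x \<in> topspace X" "t \<in> A x" "t' \<in> A x"
  shows "joined (\<tau> x) t t'"
  by (rule linked_joined [of _ _ _ x]) (use assms \<tau>_minimal(1) in \<open>simp_all add: A_def\<close>)

text \<open>Stability comes from a neighbourhood of \<open>x\<close> joined to \<open>x\<close>
  inside its least chart. For \<open>y\<close> in it, the least chart of \<open>y\<close> is
  contained in that of \<open>x\<close>, so indices of \<open>y\<close> are indices of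
  \<open>x\<close> and \<open>coc_mono\<close> identifies the values.\<close>

sublocale cocycle: stable_cocycle P X A "\<lambda>x. coc (\<tau> x)"
proof unfold_locales
  fix x assume x: "x \<in> topspace X"
  show "A x \<noteq> {}"
    using reach [OF \<tau>_minimal(1,2) [OF x]] unfolding A_def by blast
  note j = A_joined [OF x]
  show "coc (\<tau> x) t t' \<in> carrier P" if "t \<in> A x" "t' \<in> A x" for t t'
    using coc_closed [OF \<tau>_minimal(1) [OF x] _ j] that by (auto simp: A_def)
  show "coc (\<tau> x) t t' \<otimes>\<^bsub>P\<^esub> coc (\<tau> x) t' t'' = coc (\<tau> x) t t''"
    if "t \<in> A x" "t' \<in> A x" "t'' \<in> A x" for t t' t''
    using coc_mult [OF \<tau>_minimal(1) [OF x] _ j j] that by (auto simp: A_def)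
  obtain V where V: "openin X V" "x \<in> V" "\<forall>y\<in>V. linked (\<tau> x) x y"
    using locally_connected [OF \<tau>_minimal(1,2) [OF x]] by blast
  have "A y \<subseteq> A x \<and> (\<forall>t\<in>A y. \<forall>t'\<in>A y. coc (\<tau> y) t t' = coc (\<tau> x) t t')" if "y \<in> V" for y
  proof (intro conjI ballI)
    have y: "y \<in> topspace X" "y \<in> U (\<tau> x)" "linked (\<tau> x) x y"
      using path_component_in_topspace [of "subtopology X (U (\<tau> x))" x y] V(3) that by auto
    show "A y \<subseteq> A x"
    proof
      fix t assume t: "t \<in> A y"
      show "t \<in> A x"
        using A_in_T [OF t] path_component_of_trans [OF y(3) A_linked [OF y(1) t \<tau>_minimal(1) [OF x] y(2)]]
        by (simp add: A_def)
    qed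
    fix t t' assume t: "t \<in> A y" "t' \<in> A y"
    show "coc (\<tau> y) t t' = coc (\<tau> x) t t'"
    proof (rule coc_mono [OF \<tau>_minimal(1) [OF y(1)] \<tau>_minimal(1) [OF x] \<tau>_minimal(4) [OF y(1) \<tau>_minimal(1) [OF x] y(2)]])
      show "joined (\<tau> y) t t'" by (rule A_joined [OF y(1) t])
    qed (rule A_in_T [OF t(1)])
  qed
  with V(1,2) show "\<exists>V. openin X V \<and> x \<in> V \<and> (\<forall>y\<in>V. A y \<subseteq> A x \<and> (\<forall>t\<in>A y. \<forall>t'\<in>A y. coc (\<tau> y) t t' = coc (\<tau> x) t t'))"
    by (intro exI [of _ V]) simp
qed

lemma linked_path_points:
  assumes p: "pathin (subtopology X (U i)) p" and s: "s \<in> {0..1}"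
  shows "linked i (p 0) (p s)"
  unfolding path_component_of_def
  using pathin_subpath_of [OF p, of 0 s] s by (intro exI [of _ "subpath_of 0 s p"]) auto

lemma pathin_chart:
  assumes "i \<in> I" "pathin (subtopology X (U i)) p"
  shows "pathin X p" "s \<in> {0..1} \<Longrightarrow> p s \<in> topspace X" "s \<in> {0..1} \<Longrightarrow> p s \<in> U i"
  using assms by (auto simp: pathin_subtopology) (auto simp: pathin_def continuous_map_def)

text \<open>Along a path that stays in one chart, \<open>coc i t\<close> is a lift independent of
  the parameter, so the monodromy is simply the cocycle of the chart between the two end
  indices.\<close>

lemma transport_in_chart:
  assumes i: "i \<in> I" and p: "pathin (subtopology X (U i)) p" and t: "t \<in> A (p 0)" "t' \<in> A (p 1)"
  shows "cocycle.transport p t t' = coc i t t'"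
proof -
  note pX = pathin_chart [OF i p]
  have l: "linked i (p 0) (e s)" if "k \<in> {0..1}" "s \<in> A (p k)" for k s
    using path_component_of_trans [OF linked_path_points [OF p that(1)]
        A_linked [OF pX(2) [OF that(1)] that(2) i pX(3) [OF that(1)]]]
    by simp
  have j: "joined i s s'" if "k \<in> {0..1}" "s \<in> A (p k)" "l \<in> {0..1}" "s' \<in> A (p l)" for k s l s'
    by (rule linked_joined [OF i A_in_T [OF that(2)] A_in_T [OF that(4)] l [OF that(1,2)] l [OF that(3,4)]])
  have "cocycle.lift_along {0..1} p (\<lambda>_. coc i t)"
  proof (rule cocycle.lift_along_constI)
    show "continuous_map (top_of_set {0..1}) X p" using pX(1) by (simp add: pathin_def)
    fix k s assume k: "k \<in> {0..1}" "s \<in> A (p k)"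
    show "coc i t s \<in> carrier P"
      using coc_closed [OF i _ j [of 0]] t k A_in_T by simp
    fix s' assume s': "s' \<in> A (p k)"
    have "coc (\<tau> (p k)) s s' = coc i s s'"
    proof (rule coc_mono [OF \<tau>_minimal(1) [OF pX(2) [OF k(1)]] i \<tau>_minimal(4) [OF pX(2) [OF k(1)] i pX(3) [OF k(1)]]])
      show "joined (\<tau> (p k)) s s'" by (rule A_joined [OF pX(2) [OF k(1)] k(2) s'])
    qed (rule A_in_T [OF k(2)])
    then show "coc i t s' = coc i t s \<otimes>\<^bsub>P\<^esub> coc (\<tau> (p k)) s s'"
      using coc_mult [OF i A_in_T [OF t(1)] j [of 0 t k s] j [OF k k(1) s']] t k by simp
  qed
  from cocycle.transport_unfold [OF this t] show ?thesis
    using coc_fold [OF i, of "[]" t] A_in_T [OF t(1)] coc_closed [OF i A_in_T [OF t(1)] j [of 0 t 1 t']] t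
    by simp
qed

lemma topspace_chart: "i \<in> I \<Longrightarrow> U i \<subseteq> topspace X"
  by (rule openin_subset [OF U_open])

section \<open>Edge paths and the fundamental group of the atlas\<close>

definition edge :: "'j \<Rightarrow> 't \<Rightarrow> real \<Rightarrow> 'b" where
  "edge j t = (SOME \<gamma>. pathin X \<gamma> \<and> \<gamma> 0 = e t \<and> \<gamma> 1 = e (b j t) \<and>
     (\<forall>i\<in>I. j \<in> J i \<longrightarrow> pathin (subtopology X (U i)) \<gamma>))"

lemma edge_props:
  assumes "j \<in> D" "t \<in> T"
  shows "pathin X (edge j t)" "edge j t 0 = e t" "edge j t 1 = e (b j t)"
    "\<And>i. i \<in> I \<Longrightarrow> j \<in> J i \<Longrightarrow> pathin (subtopology X (U i)) (edge j t)"
proof -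
  have "pathin X (edge j t) \<and> edge j t 0 = e t \<and> edge j t 1 = e (b j t) \<and>
     (\<forall>i\<in>I. j \<in> J i \<longrightarrow> pathin (subtopology X (U i)) (edge j t))"
    unfolding edge_def by (rule someI_ex [OF edge_path [OF assms]])
  then show "pathin X (edge j t)" "edge j t 0 = e t" "edge j t 1 = e (b j t)"
    "\<And>i. i \<in> I \<Longrightarrow> j \<in> J i \<Longrightarrow> pathin (subtopology X (U i)) (edge j t)"
    by simp_all
qed

lemma e_in_A:
  assumes i: "i \<in> I" and t: "t \<in> T"
  shows "e t \<in> topspace X" "t \<in> A (e t)"
proof -
  show x: "e t \<in> topspace X" using topspace_chart [OF i] base_in [OF i t] by blast
  have "linked (\<tau> (e t)) (e t) (e t)"
    using \<tau>_minimal(1,2) [OF x] x by (simp add: path_component_of_refl)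
  then show "t \<in> A (e t)" using t by (simp add: A_def)
qed

lemma linked_imp_path_component: "linked i x y \<Longrightarrow> path_component_of X x y"
  unfolding path_component_of_def pathin_subtopology by blast

lemma path_component_walk:
  assumes "e t \<in> topspace X"
  shows "set js \<subseteq> D \<Longrightarrow> t \<in> T \<Longrightarrow> path_component_of X (e t) (e (fold b js t))"
  using assms
proof (induction js arbitrary: t)
  case Nil
  then show ?case by (simp add: path_component_of_refl)
next
  case (Cons j js)
  then have j: "j \<in> D" "t \<in> T" "set js \<subseteq> D" "b j t \<in> T" by (auto simp: b_closed)
  then have 1: "path_component_of X (e t) (e (b j t))"
    unfolding path_component_of_def using edge_props(1-3) [OF j(1,2)] by blast
  then have "e (b j t) \<in> topspace X" using path_component_in_topspace by fastforce
  with Cons.IH [OF j(3,4)] 1 show ?case by (simp add: path_component_of_trans)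
qed

text \<open>Every point reaches some base point within its least chart, and every base point is
  reached from \<open>e t0\<close> along the edges of its base walk.\<close>

lemma path_connected:
  assumes x: "x \<in> topspace X" and y: "y \<in> topspace X"
  shows "path_component_of X x y"
proof -
  have 1: "path_component_of X (e t0) x" if x: "x \<in> topspace X" for x
  proof -
    obtain t where t: "t \<in> T" "linked (\<tau> x) x (e t)"
      using reach [OF \<tau>_minimal(1,2) [OF x]] by blast
    have "path_component_of X (e t0) (e (fold b (w t) t0))"
      using base_walk [OF t(1)] t0_in e_in_A(1) [OF \<tau>_minimal(1) [OF x] t0_in]
      by (intro path_component_walk) auto
    also have "fold b (w t) t0 = t" using base_walk [OF t(1)] by simp
    finally show ?thesis
      using path_component_of_trans path_component_of_sym linked_imp_path_component [OF t(2)] by metis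
  qed
  show ?thesis using path_component_of_trans [of X x "e t0" y] 1 [OF x] 1 [OF y] path_component_of_sym by metis
qed

theorem fundamental_group_iso:
  assumes x0: "x0 \<in> topspace X"
  shows "fundamental_group X x0 \<cong> presented_group (D \<times> T) relators"
proof -
  define \<theta> where "\<theta> y = (if y = x0 then (\<lambda>_. x0) else (SOME p. pathin X p \<and> p 0 = x0 \<and> p 1 = y))" for y
  have \<theta>: "pathin X (\<theta> y) \<and> \<theta> y 0 = x0 \<and> \<theta> y 1 = y" if y: "y \<in> topspace X" for y
  proof (cases "y = x0")
    case True
    then show ?thesis using x0 by (simp add: \<theta>_def)
  next
    case False
    have "\<exists>p. pathin X p \<and> p 0 = x0 \<and> p 1 = y"
      using path_connected [OF x0 y] by (simp add: path_component_of_def)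
    from someI_ex [OF this] show ?thesis using False by (simp add: \<theta>_def)
  qed
  interpret \<theta>: based_paths X x0 \<theta>
    by unfold_locales (use \<theta> x0 in \<open>simp_all add: \<theta>_def\<close>)
  let ?\<pi> = "\<theta>.pi" and ?S = "D \<times> T"
  note eT = e_in_A [OF \<tau>_minimal(1) [OF x0]]
  define g where "g = (\<lambda>(j, t). \<theta>.cl (edge j t))"
  have g: "g \<in> ?S \<rightarrow> carrier ?\<pi>"
    by (auto simp: g_def intro!: \<theta>.cl_closed edge_props)
  define B where "B t = word_value ?\<pi> g (walk_word b t0 (w t))" for t
  have B: "B t \<in> carrier ?\<pi>" if "t \<in> T" for t
    unfolding B_def using base_walk [OF that] t0_in
    by (intro \<theta>.pi.word_value_closed [OF g walk_word_in_lists]) auto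
  \<comment> \<open>\<open>g\<close> closes an edge with the arbitrary paths
    \<open>\<theta>\<close>. Closing it with the base walks instead makes the value of each base
    walk telescope to \<open>B t\<close> times its inverse, so the first family of relators becomes
    trivial.\<close>
  define f where "f = (\<lambda>(j, t). B t \<otimes>\<^bsub>?\<pi>\<^esub> g (j, t) \<otimes>\<^bsub>?\<pi>\<^esub> inv\<^bsub>?\<pi>\<^esub> B (b j t))"
  have f: "f \<in> ?S \<rightarrow> carrier ?\<pi>"
    using g B b_closed by (auto simp: f_def Pi_iff)
  have f_walk: "word_value ?\<pi> f (walk_word b t js) =
      B t \<otimes>\<^bsub>?\<pi>\<^esub> word_value ?\<pi> g (walk_word b t js) \<otimes>\<^bsub>?\<pi>\<^esub> inv\<^bsub>?\<pi>\<^esub> B (fold b js t)"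
    if "set js \<subseteq> D" "t \<in> T" for js t
    by (rule word_value_walk_conj [OF \<theta>.pi.group_axioms g _ _ that]) (use B in \<open>auto simp: f_def\<close>)
  have B_t0: "B t0 = \<one>\<^bsub>?\<pi>\<^esub>" by (simp add: B_def base_walk_t0)
  \<comment> \<open>A walk with labels of one chart is realised by a path inside this chart, because
    each of its edges lies there.\<close>
  have walk_path: "\<exists>q. pathin (subtopology X (U i)) q \<and> q 0 = e t \<and> q 1 = e (fold b js t) \<and>
      \<theta>.cl q = word_value ?\<pi> g (walk_word b t js)"
    if i: "i \<in> I" and js: "set js \<subseteq> J i" "t \<in> T" for i js t
    using js
  proof (induction js arbitrary: t)
    case Nil
    then have "e t \<in> topspace X" "e t \<in> U i" using eT(1) base_in [OF i] by auto
    then show ?case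
      by (intro exI [of _ "\<lambda>_. e t"]) (simp add: \<theta>.cl_const)
  next
    case (Cons j js)
    then have j: "j \<in> J i" "j \<in> D" "t \<in> T" "set js \<subseteq> J i" "b j t \<in> T" 
      using J_subset [OF i] b_closed by auto
    obtain q where q: "pathin (subtopology X (U i)) q" "q 0 = e (b j t)" "q 1 = e (fold b js (b j t))"
      "\<theta>.cl q = word_value ?\<pi> g (walk_word b (b j t) js)"
      using Cons.IH [OF j(4,5)] by blast
    note ed = edge_props [OF j(2,3)]
    have "pathin (subtopology X (U i)) (join_loops (edge j t) q)"
      by (rule pathin_join [OF ed(4) [OF i j(1)] q(1)]) (simp add: ed q)
    moreover have "\<theta>.cl (join_loops (edge j t) q) = g (j, t) \<otimes>\<^bsub>?\<pi>\<^esub> \<theta>.cl q"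
      using \<theta>.cl_join [OF ed(1) pathin_chart(1) [OF i q(1)]] ed q by (simp add: g_def)
    ultimately show ?case
      using q ed by (intro exI [of _ "join_loops (edge j t) q"]) (simp add: letter_value_def)
  qed
  have cl_loop_chart: "\<theta>.cl q = \<one>\<^bsub>?\<pi>\<^esub>" if i: "i \<in> I" and q: "pathin (subtopology X (U i)) q" "q 1 = q 0" for i q
    using \<theta>.cl_homotopic [OF loops_contract [OF i q]] \<theta>.cl_const pathin_chart(2) [OF i q(1), of 0] by simp
  \<comment> \<open>Loops in a chart contract in \<open>X\<close>, so the class of a path in a chart
    depends only on its ends. This makes a path comparable with a walk.\<close>
  have cl_same_ends: "\<theta>.cl q = \<theta>.cl r"
    if i: "i \<in> I" and q: "pathin (subtopology X (U i)) q" "pathin (subtopology X (U i)) r"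
      and ends: "q 0 = r 0" "q 1 = r 1" for i q r
  proof -
    note X = pathin_chart(1) [OF i q(1)] pathin_chart(1) [OF i q(2)]
    have "\<theta>.cl (join_loops q (reverse_path r)) = \<one>\<^bsub>?\<pi>\<^esub>"
      using ends by (intro cl_loop_chart [OF i] pathin_join [OF q(1) pathin_reverse [OF q(2)]]) auto
    then have "\<theta>.cl q \<otimes>\<^bsub>?\<pi>\<^esub> inv\<^bsub>?\<pi>\<^esub> \<theta>.cl r = \<one>\<^bsub>?\<pi>\<^esub>"
      using \<theta>.cl_join [OF X(1) pathin_reverse [OF X(2)]] \<theta>.cl_reverse [OF X(2)] ends by simp
    then show ?thesis
      using \<theta>.cl_closed [OF X(1)] \<theta>.cl_closed [OF X(2)]
        \<theta>.pi.inv_solve_right [of "\<one>\<^bsub>?\<pi>\<^esub>" "\<theta>.cl q" "\<theta>.cl r"] by simp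
  qed
  have relator: "word_value ?\<pi> f r = \<one>\<^bsub>?\<pi>\<^esub>" if "r \<in> relators" for r
  proof -
    have closed: "word_value ?\<pi> f (walk_word b t js) = \<one>\<^bsub>?\<pi>\<^esub>"
      if i: "i \<in> I" "set js \<subseteq> J i" "t \<in> T" "fold b js t = t" for i js t
    proof -
      have "word_value ?\<pi> g (walk_word b t js) = \<one>\<^bsub>?\<pi>\<^esub>"
        using walk_path [OF i(1-3)] cl_loop_chart [OF i(1)] i(4) by metis
      moreover have "set js \<subseteq> D" using i J_subset by blast
      ultimately show ?thesis using f_walk [of js t] i B by simp
    qed
    from that consider (base) t where "t \<in> T" "r = walk_word b t0 (w t)"
      | (inv) j t where "j \<in> D" "t \<in> T" "r = walk_word b t [j, j]"
      | (square) i p q t where "t \<in> T" "i \<in> I" "p \<in> J i" "q \<in> J i" "r = walk_word b t [p, q, p, q]"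
      unfolding relators_def by blast
    then show ?thesis
    proof cases
      case base
      then show ?thesis
        using f_walk [of "w t" t0] base_walk [of t] t0_in B [of t] by (simp add: B_t0 flip: B_def)
    next
      case inv
      then obtain i where "i \<in> I" "j \<in> J i" using D_eq by blast
      then show ?thesis using closed [of i "[j, j]" t] inv b_invol by simp
    next
      case square
      then have D: "p \<in> D" "q \<in> D" using J_subset by auto
      then have "b q (b p (b q (b p t))) = b q (b p (b p (b q t)))"
        using square b_comm [of q p t] by simp
      then have "b q (b p (b q (b p t))) = t"
        using square D b_closed b_invol by simp
      then show ?thesis using closed [of i "[p, q, p, q]" t] square by simp
    qed
  qed
  let ?H = "word_value ?\<pi> f ` lists (?S \<times> UNIV)"
  have H_mult: "h \<otimes>\<^bsub>?\<pi>\<^esub> h' \<in> ?H" if "h \<in> ?H" "h' \<in> ?H" for h h'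
  proof -
    from that obtain u v where "u \<in> lists (?S \<times> UNIV)" "v \<in> lists (?S \<times> UNIV)"
      "h = word_value ?\<pi> f u" "h' = word_value ?\<pi> f v" by blast
    then show ?thesis
      using \<theta>.pi.word_value_append [OF f, of v u] by (intro image_eqI [of _ _ "u @ v"]) auto
  qed
  have "\<exists>t \<kappa>. t \<in> A y \<and> pathin (subtopology X (U (\<tau> y))) \<kappa> \<and> \<kappa> 0 = y \<and> \<kappa> 1 = e t"
    if y: "y \<in> topspace X" for y
    using cocycle.A_nonempty [OF y] unfolding A_def path_component_of_def by blast
  then obtain ty \<kappa> where ty: "\<And>y. y \<in> topspace X \<Longrightarrow> ty y \<in> A y"
    and \<kappa>: "\<And>y. y \<in> topspace X \<Longrightarrow> pathin (subtopology X (U (\<tau> y))) (\<kappa> y)"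
    "\<And>y. y \<in> topspace X \<Longrightarrow> \<kappa> y 0 = y" "\<And>y. y \<in> topspace X \<Longrightarrow> \<kappa> y 1 = e (ty y)"
    by metis
  have \<kappa>U: "pathin (subtopology X (U i)) (\<kappa> y)" if "i \<in> I" "y \<in> U i" for i y
  proof -
    have y: "y \<in> topspace X" using topspace_chart that by blast
    show ?thesis using \<kappa>(1) [OF y] \<tau>_minimal(3) [OF y that] by (auto simp: pathin_subtopology)
  qed
  \<comment> \<open>A correction at each point \<open>y\<close>, given by the base walk to a nearby
    base point and then back to \<open>y\<close> along \<open>\<kappa> y\<close>. It makes words
    appear for paths whose ends are not base points, and it telescopes under subdivision.\<close>
  define m where "m y = B (ty y) \<otimes>\<^bsub>?\<pi>\<^esub> inv\<^bsub>?\<pi>\<^esub> \<theta>.cl (\<kappa> y)" for y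
  have \<kappa>c: "\<theta>.cl (\<kappa> y) \<in> carrier ?\<pi>" if "y \<in> topspace X" for y
    using \<kappa>(1) [OF that] by (intro \<theta>.cl_closed) (simp add: pathin_subtopology)
  have m: "m y \<in> carrier ?\<pi>" if "y \<in> topspace X" for y
    using B [OF A_in_T [OF ty [OF that]]] \<kappa>c [OF that] by (simp add: m_def)
  \<comment> \<open>Extended at both ends by the paths \<open>\<kappa>\<close>, \<open>p\<close>
    joins two base points within the chart. By \<open>same_component\<close> these are also joined
    by a walk in the chart, and \<open>cl_same_ends\<close> equates the two classes.\<close>
  have chart: "m (p 0) \<otimes>\<^bsub>?\<pi>\<^esub> \<theta>.cl p \<otimes>\<^bsub>?\<pi>\<^esub> inv\<^bsub>?\<pi>\<^esub> m (p 1) \<in> ?H"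
    if i: "i \<in> I" and p: "pathin (subtopology X (U i)) p" for i p
  proof -
    have X: "p 0 \<in> topspace X" "p 1 \<in> topspace X" and U: "p 0 \<in> U i" "p 1 \<in> U i"
      using pathin_chart [OF i p] by auto
    let ?x = "\<kappa> (p 0)" and ?y = "\<kappa> (p 1)" and ?t = "ty (p 0)" and ?t' = "ty (p 1)"
    have T: "?t \<in> T" "?t' \<in> T" using ty X A_in_T by blast+
    note xy = \<kappa>U [OF i U(1)] \<kappa>U [OF i U(2)]
    note xyX = pathin_chart(1) [OF i xy(1)] pathin_chart(1) [OF i xy(2)] pathin_chart(1) [OF i p]
    define q where "q = join_loops (join_loops (reverse_path ?x) p) ?y"
    have q: "pathin (subtopology X (U i)) q" "q 0 = e ?t" "q 1 = e ?t'"
      unfolding q_def using xy p \<kappa> X by (auto intro!: pathin_join pathin_reverse)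
    then have "linked i (e ?t) (e ?t')" unfolding path_component_of_def by blast
    then obtain js where js: "set js \<subseteq> J i" "fold b js ?t = ?t'"
      using same_component [OF i T] by blast
    have jsD: "set js \<subseteq> D" using js J_subset [OF i] by blast
    obtain r where r: "pathin (subtopology X (U i)) r" "r 0 = e ?t" "r 1 = e ?t'"
      "\<theta>.cl r = word_value ?\<pi> g (walk_word b ?t js)"
      using walk_path [OF i js(1) T(1)] js(2) by auto
    have "\<theta>.cl q = inv\<^bsub>?\<pi>\<^esub> \<theta>.cl ?x \<otimes>\<^bsub>?\<pi>\<^esub> \<theta>.cl p \<otimes>\<^bsub>?\<pi>\<^esub> \<theta>.cl ?y"
      unfolding q_def using xyX \<kappa> X
      by (simp add: \<theta>.cl_join \<theta>.cl_reverse pathin_join pathin_reverse)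
    then have eq: "inv\<^bsub>?\<pi>\<^esub> \<theta>.cl ?x \<otimes>\<^bsub>?\<pi>\<^esub> \<theta>.cl p \<otimes>\<^bsub>?\<pi>\<^esub> \<theta>.cl ?y = word_value ?\<pi> g (walk_word b ?t js)"
      using cl_same_ends [OF i q(1) r(1)] q r by simp
    have "m (p 0) \<otimes>\<^bsub>?\<pi>\<^esub> \<theta>.cl p \<otimes>\<^bsub>?\<pi>\<^esub> inv\<^bsub>?\<pi>\<^esub> m (p 1) =
        B ?t \<otimes>\<^bsub>?\<pi>\<^esub> (inv\<^bsub>?\<pi>\<^esub> \<theta>.cl ?x \<otimes>\<^bsub>?\<pi>\<^esub> \<theta>.cl p \<otimes>\<^bsub>?\<pi>\<^esub> \<theta>.cl ?y) \<otimes>\<^bsub>?\<pi>\<^esub> inv\<^bsub>?\<pi>\<^esub> B ?t'"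
      using B [OF T(1)] B [OF T(2)] \<kappa>c [OF X(1)] \<kappa>c [OF X(2)] \<theta>.cl_closed [OF xyX(3)]
      by (simp add: m_def \<theta>.pi.m_assoc \<theta>.pi.inv_mult_group)
    also have "\<dots> = word_value ?\<pi> f (walk_word b ?t js)"
      using eq f_walk [OF jsD T(1)] js(2) by simp
    finally show ?thesis using walk_word_in_lists [OF jsD T(1)] by blast
  qed
  have loop: "m x0 \<otimes>\<^bsub>?\<pi>\<^esub> \<theta>.cl p \<otimes>\<^bsub>?\<pi>\<^esub> inv\<^bsub>?\<pi>\<^esub> m x0 \<in> ?H" if p: "p \<in> loops_at X x0" for p
  proof -
    have pX: "pathin X p" "p 0 = x0" "p 1 = x0" using p by (auto simp: loops_at_def)
    \<comment> \<open>Subdivision by bisection: the corrected class of a subpath lies in the set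
      \<open>?H\<close> of word values, which is closed under products, and the corrections at an
      intermediate point cancel.\<close>
    let ?Q = "\<lambda>a c. 0 \<le> a \<longrightarrow> a \<le> c \<longrightarrow> c \<le> 1 \<longrightarrow>
      m (p a) \<otimes>\<^bsub>?\<pi>\<^esub> \<theta>.cl (subpath_of a c p) \<otimes>\<^bsub>?\<pi>\<^esub> inv\<^bsub>?\<pi>\<^esub> m (p c) \<in> ?H"
    have ptop: "p s \<in> topspace X" if "s \<in> {0..1}" for s
      using pX(1) that by (auto simp: pathin_def continuous_map_def)
    have "?Q 0 1"
    proof (rule Bolzano [of 0 1 ?Q])
      fix a c d :: real assume Q: "?Q a c" "?Q c d" and le: "a \<le> c" "c \<le> d"
      show "?Q a d"
      proof (intro impI)
        assume ad: "0 \<le> a" "d \<le> 1"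
        have sp: "pathin X (subpath_of a c p)" "pathin X (subpath_of c d p)"
          using pathin_subpath_of [OF pX(1)] le ad by auto
        have "\<theta>.cl (subpath_of a d p) = \<theta>.cl (subpath_of a c p) \<otimes>\<^bsub>?\<pi>\<^esub> \<theta>.cl (subpath_of c d p)"
          using \<theta>.cl_join [OF sp] \<theta>.cl_homotopic [OF path_homotopic_join_subpath_of [OF pX(1) ad(1) le ad(2)]]
          by simp
        moreover have "m (p s) \<in> carrier ?\<pi>" if "s \<in> {a, c, d}" for s
          using that ad le by (intro m ptop) auto
        moreover have "inv\<^bsub>?\<pi>\<^esub> m (p c) \<otimes>\<^bsub>?\<pi>\<^esub> (m (p c) \<otimes>\<^bsub>?\<pi>\<^esub> z) = z" if "z \<in> carrier ?\<pi>" for z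
          using that calculation(2) [of c] by (simp add: \<theta>.pi.m_assoc [symmetric])
        ultimately have "m (p a) \<otimes>\<^bsub>?\<pi>\<^esub> \<theta>.cl (subpath_of a d p) \<otimes>\<^bsub>?\<pi>\<^esub> inv\<^bsub>?\<pi>\<^esub> m (p d) =
           (m (p a) \<otimes>\<^bsub>?\<pi>\<^esub> \<theta>.cl (subpath_of a c p) \<otimes>\<^bsub>?\<pi>\<^esub> inv\<^bsub>?\<pi>\<^esub> m (p c)) \<otimes>\<^bsub>?\<pi>\<^esub>
           (m (p c) \<otimes>\<^bsub>?\<pi>\<^esub> \<theta>.cl (subpath_of c d p) \<otimes>\<^bsub>?\<pi>\<^esub> inv\<^bsub>?\<pi>\<^esub> m (p d))"
          using \<theta>.cl_closed [OF sp(1)] \<theta>.cl_closed [OF sp(2)] by (simp add: \<theta>.pi.m_assoc)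
        then show "m (p a) \<otimes>\<^bsub>?\<pi>\<^esub> \<theta>.cl (subpath_of a d p) \<otimes>\<^bsub>?\<pi>\<^esub> inv\<^bsub>?\<pi>\<^esub> m (p d) \<in> ?H"
          using Q le ad H_mult by simp
      qed
    next
      fix s :: real assume s: "0 \<le> s" "s \<le> 1"
      have ps: "p s \<in> topspace X" using ptop s by simp
      note i = \<tau>_minimal(1,2) [OF ps]
      let ?W = "{r \<in> {0..1}. p r \<in> U (\<tau> (p s))}"
      have W: "openin (top_of_set {0..1}) ?W"
        using openin_continuous_map_preimage [of "top_of_set {0..1}" X p] pX(1) U_open [OF i(1)]
        by (simp add: pathin_def)
      have "s \<in> ?W" using s i(2) by simp
      with W have "\<exists>\<delta>>0. \<forall>r\<in>{0..1}. dist r s < \<delta> \<longrightarrow> r \<in> ?W"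
        unfolding openin_euclidean_subtopology_iff by (elim conjE bspec)
      then obtain \<delta> where \<delta>: "\<delta> > 0" "\<And>r. r \<in> {0..1} \<Longrightarrow> dist r s < \<delta> \<Longrightarrow> p r \<in> U (\<tau> (p s))"
        by auto
      have "?Q a c" if ac: "a \<le> s" "s \<le> c" "c - a < \<delta>" for a c
      proof (intro impI)
        assume a: "0 \<le> a" "c \<le> 1"
        have "pathin X (subpath_of a c p)" using a ac by (intro pathin_subpath_of pX) auto
        moreover have "subpath_of a c p r \<in> U (\<tau> (p s))" if r: "r \<in> {0..1}" for r
        proof -
          have "(c - a) * r \<le> (c - a) * 1" "0 \<le> (c - a) * r"
            using r ac by (auto intro!: mult_left_mono mult_nonneg_nonneg simp del: mult_1_right)
          then show ?thesis
            unfolding subpath_of_def using a ac by (intro \<delta>(2)) (auto simp: dist_real_def abs_if)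
        qed
        ultimately have "pathin (subtopology X (U (\<tau> (p s)))) (subpath_of a c p)"
          by (simp add: pathin_subtopology)
        from chart [OF i(1) this]
        show "m (p a) \<otimes>\<^bsub>?\<pi>\<^esub> \<theta>.cl (subpath_of a c p) \<otimes>\<^bsub>?\<pi>\<^esub> inv\<^bsub>?\<pi>\<^esub> m (p c) \<in> ?H" by simp
      qed
      then show "\<exists>\<delta>>0. \<forall>a c. a \<le> s \<and> s \<le> c \<and> c - a < \<delta> \<longrightarrow> ?Q a c" using \<delta>(1) by blast
    qed simp
    moreover have "subpath_of 0 1 p = p" by (simp add: subpath_of_def)
    ultimately show ?thesis using pX by simp
  qed
  \<comment> \<open>\<open>loop\<close> yields words only for conjugates by \<open>m x0\<close>; it
    is therefore applied to the inverse conjugate of \<open>h\<close>, which gives back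
    \<open>h\<close> itself.\<close>
  have gen: "carrier ?\<pi> \<subseteq> ?H"
  proof
    fix h assume h: "h \<in> carrier ?\<pi>"
    note mx = m [OF x0]
    have "inv\<^bsub>?\<pi>\<^esub> m x0 \<otimes>\<^bsub>?\<pi>\<^esub> h \<otimes>\<^bsub>?\<pi>\<^esub> m x0 \<in> carrier ?\<pi>" using h mx by simp
    then obtain p where p: "p \<in> loops_at X x0" "inv\<^bsub>?\<pi>\<^esub> m x0 \<otimes>\<^bsub>?\<pi>\<^esub> h \<otimes>\<^bsub>?\<pi>\<^esub> m x0 = \<theta>.cl p"
      using \<theta>.cl_loop unfolding \<theta>.pi_def carrier_fundamental_group by auto
    have "m x0 \<otimes>\<^bsub>?\<pi>\<^esub> (inv\<^bsub>?\<pi>\<^esub> m x0 \<otimes>\<^bsub>?\<pi>\<^esub> h \<otimes>\<^bsub>?\<pi>\<^esub> m x0) \<otimes>\<^bsub>?\<pi>\<^esub> inv\<^bsub>?\<pi>\<^esub> m x0 = h"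
      using h mx by (simp add: \<theta>.pi.m_assoc) (simp add: \<theta>.pi.m_assoc [symmetric])
    then show "h \<in> ?H" using loop [OF p(1)] p(2) by simp
  qed
  obtain s0 where s0: "s0 \<in> A x0" using cocycle.A_nonempty [OF x0] by blast
  \<comment> \<open>One index \<open>s0\<close> of the base point serves as both ends of every loop,
    which makes the monodromy multiplicative. The representative of the class is arbitrary, by
    \<open>transport_homotopic\<close>.\<close>
  define \<Phi> where "\<Phi> C = cocycle.transport (SOME p. p \<in> C) s0 s0" for C :: "(real \<Rightarrow> 'b) set"
  have \<Phi>_class: "\<Phi> (loop_class X x0 p) = cocycle.transport p s0 s0" if p: "p \<in> loops_at X x0" for p
  proof -
    have "p \<in> loop_class X x0 p"
      using equiv_class_self [OF equiv_loop_homotopy p] by (simp add: loop_class_def)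
    moreover define q where "q = (SOME q. q \<in> loop_class X x0 p)"
    ultimately have "q \<in> loop_class X x0 p"
      using someI [of "\<lambda>q. q \<in> loop_class X x0 p" p] by simp
    then have "path_homotopic X p q"
      by (simp add: loop_class_def loop_homotopy_iff)
    from cocycle.transport_homotopic [OF this] show ?thesis
      using s0 p by (simp add: \<Phi>_def loops_at_def flip: q_def)
  qed
  have \<Phi>: "\<Phi> \<in> hom ?\<pi> P"
  proof (rule homI)
    fix C assume "C \<in> carrier ?\<pi>"
    then obtain p where p: "p \<in> loops_at X x0" "C = loop_class X x0 p"
      by (auto simp: \<theta>.pi_def carrier_fundamental_group)
    then show "\<Phi> C \<in> carrier P"
      using s0 by (simp add: \<Phi>_class loops_at_def cocycle.transport_closed)
    fix C' assume "C' \<in> carrier ?\<pi>"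
    then obtain q where q: "q \<in> loops_at X x0" "C' = loop_class X x0 q"
      by (auto simp: \<theta>.pi_def carrier_fundamental_group)
    have "\<Phi> (C \<otimes>\<^bsub>?\<pi>\<^esub> C') = cocycle.transport (join_loops p q) s0 s0"
      using p q by (simp add: \<theta>.pi_def mult_fundamental_group \<Phi>_class join_in_loops_at)
    also have "\<dots> = cocycle.transport p s0 s0 \<otimes>\<^bsub>P\<^esub> cocycle.transport q s0 s0"
      using p q s0 by (intro cocycle.transport_join) (auto simp: loops_at_def)
    finally show "\<Phi> (C \<otimes>\<^bsub>?\<pi>\<^esub> C') = \<Phi> C \<otimes>\<^bsub>P\<^esub> \<Phi> C'"
      using p q by (simp add: \<Phi>_class)
  qed
  interpret \<Phi>: group_hom ?\<pi> P \<Phi> using \<Phi> by unfold_locales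
  \<comment> \<open>The monodromy of the unknown connecting paths. It enters as a function on
    vertices only, so it will telescope away.\<close>
  define n where "n t = cocycle.transport (\<theta> (e t)) s0 t" for t
  have n: "n t \<in> carrier P" if "t \<in> T" for t
    unfolding n_def using \<theta> [OF eT(1) [OF that]] eT(2) [OF that] s0
    by (intro cocycle.transport_closed) auto
  have \<Phi>g: "\<Phi> (g (j, t)) = n t \<otimes>\<^bsub>P\<^esub> Y (j, t) \<otimes>\<^bsub>P\<^esub> inv\<^bsub>P\<^esub> n (b j t)" if j: "j \<in> D" and t: "t \<in> T" for j t
  proof -
    have bt: "b j t \<in> T" using b_closed j t .
    obtain i where i: "i \<in> I" "j \<in> J i" using D_eq j by blast
    note ed = edge_props [OF j t]
    note th = \<theta> [OF eT(1) [OF t]] \<theta> [OF eT(1) [OF bt]]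
    note At = eT(2) [OF t] eT(2) [OF bt]
    \<comment> \<open>The edge lies in one chart, and there its monodromy is the value of the walk
      with the single label \<open>j\<close>.\<close>
    have Y: "cocycle.transport (edge j t) t (b j t) = Y (j, t)"
    proof -
      have "cocycle.transport (edge j t) t (b j t) = coc i t (b j t)"
        using ed At by (intro transport_in_chart [OF i(1) ed(4) [OF i]]) auto
      also have "\<dots> = Y (j, t)"
        using coc_fold [OF i(1), of "[j]" t] i j t by (simp add: Y_closed)
      finally show ?thesis .
    qed
    have 1: "pathin X (join_loops (\<theta> (e t)) (edge j t))"
      using th ed by (intro pathin_join) auto
    have "\<Phi> (g (j, t)) = cocycle.transport (\<theta>.lp (edge j t)) s0 s0"
      using \<theta>.lp_in_loops [OF ed(1)] by (simp add: g_def \<theta>.cl_def \<Phi>_class)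
    also have "\<dots> = cocycle.transport (join_loops (\<theta> (e t)) (edge j t)) s0 (b j t)
        \<otimes>\<^bsub>P\<^esub> cocycle.transport (reverse_path (\<theta> (e (b j t)))) (b j t) s0"
      unfolding \<theta>.lp_def ed(2,3)
      using 1 th ed At s0 by (intro cocycle.transport_join pathin_reverse) auto
    also have "cocycle.transport (join_loops (\<theta> (e t)) (edge j t)) s0 (b j t) = n t \<otimes>\<^bsub>P\<^esub> Y (j, t)"
      unfolding n_def Y [symmetric]
      using th ed At s0 by (intro cocycle.transport_join) auto
    also have "cocycle.transport (reverse_path (\<theta> (e (b j t)))) (b j t) s0 = inv\<^bsub>P\<^esub> n (b j t)"
      unfolding n_def using th At s0 by (intro cocycle.transport_reverse) auto
    finally show ?thesis .
  qed
  \<comment> \<open>The base walk itself is a relator and has value one in \<open>P\<close>; only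
    the contributions of its two ends survive.\<close>
  have \<Phi>B: "\<Phi> (B t) = n t0 \<otimes>\<^bsub>P\<^esub> inv\<^bsub>P\<^esub> n t" if t: "t \<in> T" for t
  proof -
    note bw = base_walk [OF t]
    have "\<Phi> (B t) = word_value P (\<lambda>s. \<Phi> (g s)) (walk_word b t0 (w t))"
      unfolding B_def using bw t0_in
      by (intro hom_word_value [OF \<theta>.pi.group_axioms P.group_axioms \<Phi> g] walk_word_in_lists) auto
    also have "\<dots> = n t0 \<otimes>\<^bsub>P\<^esub> walk_value t0 (w t) \<otimes>\<^bsub>P\<^esub> inv\<^bsub>P\<^esub> n (fold b (w t) t0)"
      unfolding walk_value_def
      by (rule word_value_walk_conj [OF P.group_axioms presented_gen_closed]) (use bw t0_in n \<Phi>g in auto)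
    also have "walk_value t0 (w t) = \<one>\<^bsub>P\<^esub>"
      unfolding walk_value_def by (rule word_value_relator) (use t in \<open>auto simp: relators_def\<close>)
    finally show ?thesis using bw n t t0_in by simp
  qed
  \<comment> \<open>The factors \<open>n t\<close> and \<open>n (b j t)\<close> from
    \<open>\<Phi>B\<close> and \<open>\<Phi>g\<close> cancel, leaving the same conjugator
    \<open>n t0\<close> for all generators, as \<open>iso_presented_group\<close> demands.\<close>
  have \<Phi>f: "\<Phi> (f s) = n t0 \<otimes>\<^bsub>P\<^esub> Y s \<otimes>\<^bsub>P\<^esub> inv\<^bsub>P\<^esub> n t0" if s: "s \<in> ?S" for s
  proof -
    obtain j t where jt: "s = (j, t)" "j \<in> D" "t \<in> T" using s by auto
    have bt: "b j t \<in> T" using b_closed jt by simp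
    have c: "n t \<in> carrier P" "n (b j t) \<in> carrier P" "n t0 \<in> carrier P" "Y (j, t) \<in> carrier P"
      using n jt bt t0_in Y_closed by auto
    have cancel: "inv\<^bsub>P\<^esub> n u \<otimes>\<^bsub>P\<^esub> (n u \<otimes>\<^bsub>P\<^esub> z) = z" if "u \<in> T" "z \<in> carrier P" for u z
      using n that by (simp add: P.m_assoc [symmetric])
    have "g (j, t) \<in> carrier ?\<pi>" "B t \<in> carrier ?\<pi>" "B (b j t) \<in> carrier ?\<pi>"
      using g B jt bt by auto
    then have "\<Phi> (f s) = \<Phi> (B t) \<otimes>\<^bsub>P\<^esub> \<Phi> (g (j, t)) \<otimes>\<^bsub>P\<^esub> inv\<^bsub>P\<^esub> \<Phi> (B (b j t))"
      by (simp add: f_def jt)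
    also have "\<dots> = n t0 \<otimes>\<^bsub>P\<^esub> Y (j, t) \<otimes>\<^bsub>P\<^esub> inv\<^bsub>P\<^esub> n t0"
      using c jt bt by (simp add: \<Phi>B \<Phi>g P.m_assoc P.inv_mult_group cancel)
    finally show ?thesis by (simp add: jt)
  qed
  show ?thesis
    using iso_presented_group [OF \<theta>.pi.group_axioms f relator gen \<Phi> n [OF t0_in] \<Phi>f]
    by (simp add: \<theta>.pi_def)
qed

end

section \<open>Lattices, cones and smooth fans\<close>

text \<open>The coordinate at a vector outside the basis \<open>B\<close> is zero, so several facts
  below need no membership hypothesis on \<open>b\<close>.\<close>

definition coord :: "'a::real_vector set \<Rightarrow> 'a \<Rightarrow> 'a \<Rightarrow> real" where
  "coord B b x = representation B x b"

lemma dual_latticeD: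
  assumes "u \<in> dual_lattice N"
  shows "linear u" "x \<in> N \<Longrightarrow> u x \<in> \<int>"
  using assms by (auto simp: dual_lattice_def)

context
  fixes N B :: "'a::real_vector set"
  assumes B: "lattice_basis N B"
begin

lemma lattice_basisD:
  shows "finite B" "independent B" "span B = UNIV"
    "N = {\<Sum>b\<in>B. of_int (c b) *\<^sub>R b | c :: 'a \<Rightarrow> int. True}"
  using B unfolding lattice_basis_def by blast+

lemma coord_linear: "linear (coord B b)"
  unfolding coord_def [abs_def]
  by (rule linearI) (simp_all add: real_vector.representation_add real_vector.representation_scale lattice_basisD)

lemma coord_basis: "b \<in> B \<Longrightarrow> coord B b' b = (if b' = b then 1 else 0)"
  by (simp add: coord_def real_vector.representation_basis lattice_basisD)

lemma sum_coord: "(\<Sum>b\<in>B. coord B b x *\<^sub>R b) = x"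
  unfolding coord_def
  using real_vector.sum_representation_eq [of B x B] lattice_basisD by simp

lemma coord_sum:
  assumes "b \<in> B"
  shows "coord B b (\<Sum>b\<in>B. c b *\<^sub>R b) = c b"
proof -
  have "coord B b (\<Sum>b\<in>B. c b *\<^sub>R b) = (\<Sum>b'\<in>B. c b' * coord B b b')"
    by (simp add: linear_sum [OF coord_linear] linear_scale [OF coord_linear])
  also have "\<dots> = (\<Sum>b'\<in>B. if b' = b then c b else 0)"
    by (rule sum.cong) (auto simp: coord_basis)
  finally show ?thesis
    using assms lattice_basisD(1) by simp
qed

lemma coord_eqI: "(\<And>b. b \<in> B \<Longrightarrow> coord B b x = coord B b y) \<Longrightarrow> x = y"
  by (metis (mono_tags, lifting) sum.cong sum_coord)

lemma linear_coord_expand: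
  assumes "linear (u :: 'a \<Rightarrow> real)"
  shows "u x = (\<Sum>b\<in>B. coord B b x * u b)"
proof -
  have "u x = u (\<Sum>b\<in>B. coord B b x *\<^sub>R b)" by (simp add: sum_coord)
  also have "\<dots> = (\<Sum>b\<in>B. coord B b x * u b)"
    by (simp add: linear_sum [OF assms] linear_scale [OF assms])
  finally show ?thesis .
qed

lemma lattice_iff_coord: "x \<in> N \<longleftrightarrow> (\<forall>b\<in>B. coord B b x \<in> \<int>)"
proof
  assume "x \<in> N"
  then obtain c :: "'a \<Rightarrow> int" where "x = (\<Sum>b\<in>B. of_int (c b) *\<^sub>R b)"
    using lattice_basisD(4) by blast
  then show "\<forall>b\<in>B. coord B b x \<in> \<int>" by (simp add: coord_sum)
next
  assume "\<forall>b\<in>B. coord B b x \<in> \<int>"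
  then have "x = (\<Sum>b\<in>B. of_int \<lfloor>coord B b x\<rfloor> *\<^sub>R b)"
    by (subst sum_coord [of x, symmetric]) (auto intro!: sum.cong)
  then show "x \<in> N"
    by (subst lattice_basisD(4)) (rule CollectI, rule exI [of _ "\<lambda>b. \<lfloor>coord B b x\<rfloor>"], simp)
qed

lemma basis_in_lattice: "b \<in> B \<Longrightarrow> b \<in> N"
  by (simp add: lattice_iff_coord coord_basis)

lemma dual_lattice_iff: "u \<in> dual_lattice N \<longleftrightarrow> linear u \<and> (\<forall>b\<in>B. u b \<in> \<int>)"
proof
  assume "u \<in> dual_lattice N"
  then show "linear u \<and> (\<forall>b\<in>B. u b \<in> \<int>)"
    using basis_in_lattice by (auto simp: dual_lattice_def)
next
  assume u: "linear u \<and> (\<forall>b\<in>B. u b \<in> \<int>)"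
  then have "u x \<in> \<int>" if "x \<in> N" for x
    using that linear_coord_expand [of u x] lattice_iff_coord by auto
  then show "u \<in> dual_lattice N" using u by (auto simp: dual_lattice_def)
qed

lemma coord_dual_lattice: "coord B b \<in> dual_lattice N"
  by (simp add: dual_lattice_iff coord_linear coord_basis)

lemma lattice_add: "x \<in> N \<Longrightarrow> y \<in> N \<Longrightarrow> x + y \<in> N"
  by (simp add: lattice_iff_coord linear_add [OF coord_linear])

lemma lattice_diff: "x \<in> N \<Longrightarrow> y \<in> N \<Longrightarrow> x - y \<in> N"
  by (simp add: lattice_iff_coord linear_diff [OF coord_linear])

lemma lattice_scale: "x \<in> N \<Longrightarrow> of_int k *\<^sub>R x \<in> N"
  by (simp add: lattice_iff_coord linear_scale [OF coord_linear])

lemma lattice_sum: "(\<And>i. i \<in> I \<Longrightarrow> f i \<in> N) \<Longrightarrow> sum f I \<in> N"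
  by (induction I rule: infinite_finite_induct)
    (auto simp: lattice_iff_coord linear_0 [OF coord_linear] linear_add [OF coord_linear])

lemma double_lattice_iff:
  assumes x: "x \<in> N"
  shows "x \<in> (\<lambda>w. 2 *\<^sub>R w) ` N \<longleftrightarrow> (\<forall>b\<in>B. even \<lfloor>coord B b x\<rfloor>)"
proof
  assume "x \<in> (\<lambda>w. 2 *\<^sub>R w) ` N"
  then obtain y where y: "y \<in> N" "x = 2 *\<^sub>R y" by blast
  show "\<forall>b\<in>B. even \<lfloor>coord B b x\<rfloor>"
  proof
    fix b assume "b \<in> B"
    then obtain k where "coord B b y = of_int k" using y lattice_iff_coord Ints_cases by metis
    then have "coord B b x = of_int (2 * k)" using y by (simp add: linear_scale [OF coord_linear])
    then show "even \<lfloor>coord B b x\<rfloor>" by (metis dvd_triv_left floor_of_int)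
  qed
next
  assume ev: "\<forall>b\<in>B. even \<lfloor>coord B b x\<rfloor>"
  have "coord B b ((1/2) *\<^sub>R x) \<in> \<int>" if b: "b \<in> B" for b
  proof -
    obtain k where "\<lfloor>coord B b x\<rfloor> = 2 * k" using ev b by blast
    moreover have "coord B b x = of_int \<lfloor>coord B b x\<rfloor>" using x b lattice_iff_coord by auto
    ultimately have "coord B b ((1/2) *\<^sub>R x) = of_int k"
      by (simp add: linear_scale [OF coord_linear])
    then show ?thesis by simp
  qed
  then have "(1/2) *\<^sub>R x \<in> N" by (simp add: lattice_iff_coord)
  moreover have "x = 2 *\<^sub>R ((1/2) *\<^sub>R x)" by simp
  ultimately show "x \<in> (\<lambda>w. 2 *\<^sub>R w) ` N" by blast
qed

lemma primitive_basis_vector: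
  assumes b: "b \<in> B"
  shows "primitive_vector N b"
  unfolding primitive_vector_def
proof (intro conjI ballI allI impI)
  show "b \<in> N" using basis_in_lattice b .
  show "b \<noteq> 0" using b lattice_basisD(2) dependent_zero by blast
  fix w and k :: int assume w: "w \<in> N" and eq: "b = of_int k *\<^sub>R w"
  obtain l where l: "coord B b w = of_int l" using w b lattice_iff_coord Ints_cases by metis
  have "coord B b b = of_int k * coord B b w"
    by (subst eq) (simp add: linear_scale [OF coord_linear])
  then have "1 = k * l" using b l by (simp add: coord_basis flip: of_int_mult)
  then show "\<bar>k\<bar> = 1" by (metis abs_one zmult_eq_1_iff abs_minus)
qed

context
  fixes S :: "'a set"
  assumes S: "S \<subseteq> B"
begin

text \<open>In a lattice basis containing its generators the cone is the nonnegative orthant of a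
  coordinate subspace. Faces and dual semigroups thereby turn into sign conditions.\<close>

lemma cone_iff_coord:
  "x \<in> convex_cone hull S \<longleftrightarrow> (\<forall>b\<in>S. 0 \<le> coord B b x) \<and> (\<forall>b\<in>B - S. coord B b x = 0)"
proof
  let ?C = "{x. (\<forall>b\<in>S. 0 \<le> coord B b x) \<and> (\<forall>b\<in>B - S. coord B b x = 0)}"
  have "convex_cone ?C"
    unfolding convex_cone_iff
    by (simp add: linear_add [OF coord_linear] linear_scale [OF coord_linear] linear_0 [OF coord_linear])
  moreover have "S \<subseteq> ?C" using S by (auto simp: coord_basis)
  ultimately have "convex_cone hull S \<subseteq> ?C" by (simp add: hull_minimal)
  moreover assume "x \<in> convex_cone hull S"
  ultimately have "x \<in> ?C" by (rule subsetD)
  then show "(\<forall>b\<in>S. 0 \<le> coord B b x) \<and> (\<forall>b\<in>B - S. coord B b x = 0)"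
    by (rule CollectD)
next
  assume x: "(\<forall>b\<in>S. 0 \<le> coord B b x) \<and> (\<forall>b\<in>B - S. coord B b x = 0)"
  have fin: "finite T" if "T \<subseteq> S" for T
    by (rule finite_subset [OF _ lattice_basisD(1)]) (use that S in blast)
  have "(\<Sum>b\<in>T. coord B b x *\<^sub>R b) \<in> convex_cone hull S" if "T \<subseteq> S" for T
    using fin [OF that] that
  proof (induction T rule: finite_induct)
    case empty
    then show ?case by (simp add: convex_cone_hull_contains_0)
  next
    case (insert b T)
    then have "coord B b x *\<^sub>R b \<in> convex_cone hull S"
      using x by (intro convex_cone_hull_mul) (simp_all add: hull_inc)
    with insert show ?case by (simp add: convex_cone_hull_add)
  qed
  from this [of S] have "(\<Sum>b\<in>S. coord B b x *\<^sub>R b) \<in> convex_cone hull S" by simp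
  also have "(\<Sum>b\<in>S. coord B b x *\<^sub>R b) = (\<Sum>b\<in>B. coord B b x *\<^sub>R b)"
    using x S lattice_basisD(1) by (intro sum.mono_neutral_left) auto
  finally show "x \<in> convex_cone hull S" by (simp add: sum_coord)
qed

lemma cone_Int_basis: "convex_cone hull S \<inter> B = S"
  using S by (auto simp: cone_iff_coord coord_basis split: if_splits)

lemma linear_on_cone:
  assumes u: "linear (u :: 'a \<Rightarrow> real)" and x: "x \<in> convex_cone hull S"
  shows "u x = (\<Sum>b\<in>S. coord B b x * u b)"
proof -
  have "u x = (\<Sum>b\<in>B. coord B b x * u b)" by (rule linear_coord_expand [OF u])
  also have "\<dots> = (\<Sum>b\<in>S. coord B b x * u b)"
    using x S lattice_basisD(1) by (intro sum.mono_neutral_right) (auto simp: cone_iff_coord)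
  finally show ?thesis .
qed

lemma linear_nonneg_on_cone:
  assumes u: "linear (u :: 'a \<Rightarrow> real)"
  shows "(\<forall>x\<in>convex_cone hull S. 0 \<le> u x) \<longleftrightarrow> (\<forall>b\<in>S. 0 \<le> u b)"
proof
  show "\<forall>x\<in>convex_cone hull S. 0 \<le> u x \<Longrightarrow> \<forall>b\<in>S. 0 \<le> u b" by (simp add: hull_inc)
  assume "\<forall>b\<in>S. 0 \<le> u b"
  then show "\<forall>x\<in>convex_cone hull S. 0 \<le> u x"
    using linear_on_cone [OF u] by (auto simp: cone_iff_coord intro!: sum_nonneg)
qed

lemma dual_semigroup_cone_iff:
  "u \<in> dual_semigroup N (convex_cone hull S) \<longleftrightarrow> u \<in> dual_lattice N \<and> (\<forall>b\<in>S. 0 \<le> u b)"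
  using linear_nonneg_on_cone [of u] by (auto simp: dual_semigroup_def dual_lattice_def)

end

text \<open>On the cone the supporting functional is a sum of nonnegative terms, one for each
  generator. It vanishes only if every term does, so the face is spanned by the generators that it
  kills.\<close>

lemma cone_face_subset:
  assumes S: "S \<subseteq> B" and face: "cone_face \<tau> (convex_cone hull S)"
  obtains S' where "S' \<subseteq> S" "\<tau> = convex_cone hull S'"
proof -
  obtain u :: "'a \<Rightarrow> real" where u: "linear u" "\<forall>x\<in>convex_cone hull S. 0 \<le> u x"
    "\<tau> = {x \<in> convex_cone hull S. u x = 0}"
    using face unfolding cone_face_def by blast
  let ?S' = "{b \<in> S. u b = 0}"
  have S': "?S' \<subseteq> B" using S by blast
  have fin: "finite S" by (rule finite_subset [OF S lattice_basisD(1)])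
  have ub: "\<forall>b\<in>S. 0 \<le> u b" using u linear_nonneg_on_cone [OF S] by blast
  have "x \<in> \<tau> \<longleftrightarrow> x \<in> convex_cone hull ?S'" for x
  proof (cases "x \<in> convex_cone hull S")
    case True
    have "u x = 0 \<longleftrightarrow> (\<forall>b\<in>S. coord B b x * u b = 0)"
      unfolding linear_on_cone [OF S u(1) True]
      using True ub fin by (intro sum_nonneg_eq_0_iff) (auto simp: cone_iff_coord [OF S])
    then show ?thesis
      using True ub S unfolding u(3) cone_iff_coord [OF S] cone_iff_coord [OF S'] by auto
  next
    case False
    moreover have "convex_cone hull ?S' \<subseteq> convex_cone hull S" by (intro hull_mono) blast
    ultimately show ?thesis using u(3) by blast
  qed
  then have "\<tau> = convex_cone hull ?S'" by blast
  then show ?thesis using that [of ?S'] by blast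
qed

text \<open>The sum of the coordinates at the omitted generators is a supporting functional that
  cuts out the smaller cone.\<close>

lemma subset_cone_face:
  assumes S: "S \<subseteq> B" and S': "S' \<subseteq> S"
  shows "cone_face (convex_cone hull S') (convex_cone hull S)"
  unfolding cone_face_def
proof (intro exI conjI)
  let ?u = "\<lambda>x. \<Sum>b\<in>S - S'. coord B b x"
  have fin: "finite (S - S')" by (rule finite_subset [OF _ lattice_basisD(1)]) (use S in blast)
  have S'B: "S' \<subseteq> B" using S S' by blast
  show "linear ?u" by (intro linear_compose_sum ballI coord_linear)
  show "\<forall>x\<in>convex_cone hull S. 0 \<le> ?u x"
    by (auto simp: cone_iff_coord [OF S] intro!: sum_nonneg)
  have "x \<in> convex_cone hull S' \<longleftrightarrow> ?u x = 0" if x: "x \<in> convex_cone hull S" for x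
  proof -
    have "?u x = 0 \<longleftrightarrow> (\<forall>b\<in>S - S'. coord B b x = 0)"
      using x fin by (intro sum_nonneg_eq_0_iff) (auto simp: cone_iff_coord [OF S])
    then show ?thesis
      using x S S' unfolding cone_iff_coord [OF S] cone_iff_coord [OF S'B] by blast
  qed
  moreover have "convex_cone hull S' \<subseteq> convex_cone hull S" using S' by (rule hull_mono)
  ultimately show "convex_cone hull S' = {x \<in> convex_cone hull S. ?u x = 0}"
    by blast
qed

end

section \<open>Smooth fans and the generators of their cones\<close>

locale smooth_fan_locale =
  fixes N :: "'a::real_vector set" and \<Delta> :: "'a set set"
  assumes smooth: "smooth_fan N \<Delta>"
begin

lemma fan_finite: "finite \<Delta>"
  and fan_face: "\<sigma> \<in> \<Delta> \<Longrightarrow> cone_face \<tau> \<sigma> \<Longrightarrow> \<tau> \<in> \<Delta>"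
  and fan_Int_face: "\<sigma> \<in> \<Delta> \<Longrightarrow> \<sigma>' \<in> \<Delta> \<Longrightarrow> cone_face (\<sigma> \<inter> \<sigma>') \<sigma>"
  using smooth unfolding smooth_fan_def fan_def by blast+

lemma fan_Int: "\<sigma> \<in> \<Delta> \<Longrightarrow> \<sigma>' \<in> \<Delta> \<Longrightarrow> \<sigma> \<inter> \<sigma>' \<in> \<Delta>"
  using fan_face fan_Int_face by blast

text \<open>\<open>gens \<sigma>\<close> are the primitive generators of \<open>\<sigma>\<close>, and \<open>bas \<sigma>\<close> a basis of the lattice containing them.\<close>

definition bas :: "'a set \<Rightarrow> 'a set" where
  "bas \<sigma> = (SOME B. \<exists>S. lattice_basis N B \<and> S \<subseteq> B \<and> \<sigma> = convex_cone hull S)"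

definition gens :: "'a set \<Rightarrow> 'a set" where
  "gens \<sigma> = \<sigma> \<inter> bas \<sigma>"

lemma bas_gens:
  assumes "\<sigma> \<in> \<Delta>"
  shows "lattice_basis N (bas \<sigma>)" "gens \<sigma> \<subseteq> bas \<sigma>" "\<sigma> = convex_cone hull gens \<sigma>"
proof -
  have "\<exists>B S. lattice_basis N B \<and> S \<subseteq> B \<and> \<sigma> = convex_cone hull S"
    using smooth assms unfolding smooth_fan_def by blast
  then have "\<exists>S. lattice_basis N (bas \<sigma>) \<and> S \<subseteq> bas \<sigma> \<and> \<sigma> = convex_cone hull S"
    unfolding bas_def by (rule someI_ex)
  then obtain S where S: "lattice_basis N (bas \<sigma>)" "S \<subseteq> bas \<sigma>" "\<sigma> = convex_cone hull S" by blast
  then have "gens \<sigma> = S" using cone_Int_basis [OF S(1,2)] by (simp add: gens_def)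
  with S show "lattice_basis N (bas \<sigma>)" "gens \<sigma> \<subseteq> bas \<sigma>" "\<sigma> = convex_cone hull gens \<sigma>" by simp_all
qed

lemma Int_cone:
  assumes "\<sigma> \<in> \<Delta>" "\<sigma>' \<in> \<Delta>"
  obtains S' where "S' \<subseteq> gens \<sigma>" "\<sigma> \<inter> \<sigma>' = convex_cone hull S'"
proof -
  have "cone_face (\<sigma> \<inter> \<sigma>') (convex_cone hull gens \<sigma>)"
    using fan_Int_face [OF assms] bas_gens(3) [OF assms(1)] by simp
  then show ?thesis
    using cone_face_subset [OF bas_gens(1,2) [OF assms(1)]] that by blast
qed

lemma gens_subset_cone_in_fan:
  assumes "\<sigma> \<in> \<Delta>" "S \<subseteq> gens \<sigma>"
  shows "convex_cone hull S \<in> \<Delta>"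
  using fan_face [OF assms(1)] subset_cone_face [OF bas_gens(1,2) [OF assms(1)] assms(2)]
    bas_gens(3) [OF assms(1)] by simp

text \<open>The ray of an edge vector meets the cone in a common face. By dimension this face has a
  single generator, of which the edge vector is a nonnegative integral multiple; primitivity forces
  the factor 1.\<close>

lemma edge_vectors_in_cone:
  assumes \<sigma>: "\<sigma> \<in> \<Delta>"
  shows "edge_vectors N \<Delta> \<inter> \<sigma> = gens \<sigma>"
proof
  note B = bas_gens [OF \<sigma>]
  show "edge_vectors N \<Delta> \<inter> \<sigma> \<subseteq> gens \<sigma>"
  proof
    fix v assume "v \<in> edge_vectors N \<Delta> \<inter> \<sigma>"
    then obtain \<rho> where v: "primitive_vector N v" "\<rho> \<in> \<Delta>" "dim \<rho> = 1" "v \<in> \<rho>" "v \<in> \<sigma>"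
      unfolding edge_vectors_def by blast
    obtain S' where S': "S' \<subseteq> gens \<sigma>" "\<sigma> \<inter> \<rho> = convex_cone hull S'"
      using Int_cone [OF \<sigma> v(2)] .
    obtain R where R: "R \<subseteq> \<rho>" "independent R" "\<rho> \<subseteq> span R" "card R = dim \<rho>"
      using basis_exists .
    have S'B: "S' \<subseteq> bas \<sigma>" using S' B by blast
    have "S' \<subseteq> span R" using S'(2) R(3) hull_subset [of S' convex_cone] by blast
    moreover have "independent S'" using S'B lattice_basisD(2) [OF B(1)] real_vector.independent_mono by blast
    moreover have "finite R" using R(4) v(3) by (metis card.infinite zero_neq_one)
    ultimately have card: "finite S'" "card S' \<le> 1"
      using real_vector.independent_span_bound [of R S'] R(4) v(3) by auto
    have vS': "v \<in> convex_cone hull S'" using v S' by blast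
    have "v \<noteq> 0" "v \<in> N" using v(1) by (auto simp: primitive_vector_def)
    then have "S' \<noteq> {}" using vS' by auto
    then have "card S' = 1" using card by (simp add: Suc_leI card_gt_0_iff le_antisym)
    then obtain s where s: "S' = {s}" by (auto simp: card_1_singleton_iff)
    have sB: "s \<in> bas \<sigma>" using S'B s by blast
    let ?r = "coord (bas \<sigma>) s v"
    have r: "0 \<le> ?r" "\<And>b. b \<in> bas \<sigma> - {s} \<Longrightarrow> coord (bas \<sigma>) b v = 0"
      using vS' cone_iff_coord [OF B(1), of "{s}" v] sB by (auto simp: s)
    have v_eq: "v = ?r *\<^sub>R s"
      using sB r(2) by (intro coord_eqI [OF B(1)])
        (auto simp: linear_scale [OF coord_linear [OF B(1)]] coord_basis [OF B(1)])
    obtain k where k: "?r = of_int k"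
      using \<open>v \<in> N\<close> sB lattice_iff_coord [OF B(1)] Ints_cases by metis
    then have "\<bar>k\<bar> = 1"
      using v(1) v_eq basis_in_lattice [OF B(1) sB] unfolding primitive_vector_def by metis
    then have "k = 1" using k r(1) by simp
    then have "v = s" using v_eq k by simp
    then show "v \<in> gens \<sigma>" using S'(1) s by blast
  qed
  show "gens \<sigma> \<subseteq> edge_vectors N \<Delta> \<inter> \<sigma>"
  proof
    fix s assume s: "s \<in> gens \<sigma>"
    then have sB: "s \<in> bas \<sigma>" using B by blast
    have "dim (convex_cone hull {s}) = card {s}"
    proof (rule dim_eq_card)
      have "convex_cone hull {s} \<subseteq> span {s}"
        by (intro hull_minimal convex_cone_span) (simp add: span_base)
      moreover have "{s} \<subseteq> convex_cone hull {s}" by (rule hull_subset)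
      ultimately show "span {s} = span (convex_cone hull {s})"
        by (metis span_mono span_span subset_antisym)
      show "independent {s}"
        using sB lattice_basisD(2) [OF B(1)] real_vector.independent_mono by blast
    qed
    then have "dim (convex_cone hull {s}) = 1" by simp
    moreover have "convex_cone hull {s} \<in> \<Delta>" using gens_subset_cone_in_fan [OF \<sigma>, of "{s}"] s by blast
    moreover have "s \<in> convex_cone hull {s}" by (simp add: hull_inc)
    moreover have "s \<in> \<sigma>" using s by (simp add: gens_def)
    ultimately show "s \<in> edge_vectors N \<Delta> \<inter> \<sigma>"
      using primitive_basis_vector [OF B(1) sB] unfolding edge_vectors_def by blast
  qed
qed

lemma zero_cone_in_fan:
  assumes "\<sigma> \<in> \<Delta>"
  shows "{0} \<in> \<Delta>" "{0} \<subseteq> \<sigma>"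
  using gens_subset_cone_in_fan [OF assms, of "{}"] bas_gens(3) [OF assms] convex_cone_hull_contains_0
  by auto

end

section \<open>Affine charts in coordinates\<close>

abbreviation chart_points :: "'a::real_vector set \<Rightarrow> 'a set \<Rightarrow> (('a \<Rightarrow> real) \<Rightarrow> real) set" where
  "chart_points N \<sigma> \<equiv> topspace (affine_chart N \<sigma>)"

lemma chart_points_iff:
  "\<phi> \<in> chart_points N \<sigma> \<longleftrightarrow> \<phi> \<in> extensional (dual_semigroup N \<sigma>) \<and> \<phi> (\<lambda>_. 0) = 1 \<and>
     (\<forall>u\<in>dual_semigroup N \<sigma>. \<forall>w\<in>dual_semigroup N \<sigma>. \<phi> (\<lambda>z. u z + w z) = \<phi> u * \<phi> w)"
  by (auto simp: affine_chart_def PiE_def)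

lemma dual_semigroup_mono: "\<tau> \<subseteq> \<sigma> \<Longrightarrow> dual_semigroup N \<sigma> \<subseteq> dual_semigroup N \<tau>"
  by (auto simp: dual_semigroup_def)

lemma dual_semigroup_zero: "(\<lambda>_. 0) \<in> dual_semigroup N \<sigma>"
  by (auto simp: dual_semigroup_def dual_lattice_def intro!: linearI)

lemma dual_semigroupD:
  assumes "u \<in> dual_semigroup N \<sigma>"
  shows "linear u" "x \<in> N \<Longrightarrow> u x \<in> \<int>" "x \<in> \<sigma> \<Longrightarrow> 0 \<le> u x"
  using assms by (auto simp: dual_semigroup_def dual_lattice_def)

lemma dual_semigroupI:
  assumes "linear u" "\<And>x. x \<in> N \<Longrightarrow> u x \<in> \<int>" "\<And>x. x \<in> \<sigma> \<Longrightarrow> 0 \<le> u x"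
  shows "u \<in> dual_semigroup N \<sigma>"
  using assms by (auto simp: dual_semigroup_def dual_lattice_def)

lemma dual_semigroup_add:
  assumes u: "u \<in> dual_semigroup N \<sigma>" and w: "w \<in> dual_semigroup N \<sigma>"
  shows "(\<lambda>z. u z + w z) \<in> dual_semigroup N \<sigma>"
  by (intro dual_semigroupI linear_compose_add Ints_add add_nonneg_nonneg)
    (fact dual_semigroupD [OF u] dual_semigroupD [OF w])+

lemma restrict_chart_points:
  assumes "\<tau> \<subseteq> \<sigma>" "\<phi> \<in> chart_points N \<tau>"
  shows "restrict \<phi> (dual_semigroup N \<sigma>) \<in> chart_points N \<sigma>"
  using assms(2) dual_semigroup_mono [OF assms(1), of N]
  unfolding chart_points_iff
  by (auto simp: dual_semigroup_zero dual_semigroup_add subset_iff)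

lemma power_int_add_nonneg:
  fixes x :: real
  assumes "x \<noteq> 0 \<or> 0 \<le> m \<and> 0 \<le> n"
  shows "x powi (m + n) = x powi m * x powi n"
  using assms by (cases "x = 0") (auto simp: power_int_add power_int_0_left_if)

lemma continuous_map_power_int:
  assumes "continuous_map Y euclideanreal f" "0 \<le> n \<or> (\<forall>y\<in>topspace Y. f y \<noteq> 0)"
  shows "continuous_map Y euclideanreal (\<lambda>y. f y powi n)"
proof (cases "0 \<le> n")
  case True
  then show ?thesis
    using continuous_map_real_pow [OF assms(1)] by (simp add: power_int_def)
next
  case False
  then have "continuous_map Y euclideanreal (\<lambda>y. inverse (f y ^ nat (- n)))"
    using assms by (intro continuous_intros) auto
  then show ?thesis using False by (simp add: power_int_def power_inverse)
qed

lemma continuous_map_eval: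
  assumes "u \<in> dual_semigroup N \<sigma>"
  shows "continuous_map (affine_chart N \<sigma>) euclideanreal (\<lambda>\<phi>. \<phi> u)"
  unfolding affine_chart_def
  using continuous_map_from_subtopology [OF continuous_map_product_projection [OF assms]] by blast

text \<open>The point with coordinates \<open>x\<close>: a character evaluates to its monomial. The
  coordinates at generators of the cone may vanish because the exponents there are nonnegative; all
  others have to be nonzero.\<close>

definition monomial_point :: "'a::real_vector set \<Rightarrow> 'a set \<Rightarrow> 'a set \<Rightarrow> ('a \<Rightarrow> real) \<Rightarrow> ('a \<Rightarrow> real) \<Rightarrow> real" where
  "monomial_point N B \<sigma> x = (\<lambda>u\<in>dual_semigroup N \<sigma>. \<Prod>b\<in>B. x b powi \<lfloor>u b\<rfloor>)"

context
  fixes N B S :: "'a::real_vector set" and \<sigma> :: "'a set"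
  assumes B: "lattice_basis N B" and S: "S \<subseteq> B" and \<sigma>: "\<sigma> = convex_cone hull S"
begin

lemma dual_semigroup_iff:
  "u \<in> dual_semigroup N \<sigma> \<longleftrightarrow> linear u \<and> (\<forall>b\<in>B. u b \<in> \<int>) \<and> (\<forall>b\<in>S. 0 \<le> u b)"
  unfolding \<sigma> dual_semigroup_cone_iff [OF B S] dual_lattice_iff [OF B] by simp

lemma coord_in_dual_semigroup: "b \<in> B \<Longrightarrow> coord B b \<in> dual_semigroup N \<sigma>"
  unfolding dual_semigroup_iff using S
  by (auto simp: coord_linear [OF B] coord_basis [OF B] subset_iff)

lemma dual_semigroup_floor:
  assumes "u \<in> dual_semigroup N \<sigma>" "b \<in> B"
  shows "of_int \<lfloor>u b\<rfloor> = u b"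
  using assms dual_semigroup_iff by auto

lemma monomial_point_in_chart:
  assumes x: "\<forall>b\<in>B - S. x b \<noteq> 0"
  shows "monomial_point N B \<sigma> x \<in> chart_points N \<sigma>"
  unfolding chart_points_iff
proof (intro conjI ballI)
  show "monomial_point N B \<sigma> x \<in> extensional (dual_semigroup N \<sigma>)"
    by (simp add: monomial_point_def)
  show "monomial_point N B \<sigma> x (\<lambda>_. 0) = 1"
    by (simp add: monomial_point_def dual_semigroup_zero)
  fix u w assume u: "u \<in> dual_semigroup N \<sigma>" and w: "w \<in> dual_semigroup N \<sigma>"
  have "x b powi \<lfloor>u b + w b\<rfloor> = x b powi \<lfloor>u b\<rfloor> * x b powi \<lfloor>w b\<rfloor>" if b: "b \<in> B" for b
  proof -
    have "\<lfloor>u b + w b\<rfloor> = \<lfloor>u b\<rfloor> + \<lfloor>w b\<rfloor>"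
      using dual_semigroup_floor [OF u b] dual_semigroup_floor [OF w b]
      by (metis floor_of_int of_int_add)
    moreover have "x b \<noteq> 0 \<or> 0 \<le> \<lfloor>u b\<rfloor> \<and> 0 \<le> \<lfloor>w b\<rfloor>"
      using x b u w by (cases "b \<in> S") (auto simp: dual_semigroup_iff)
    ultimately show ?thesis by (simp add: power_int_add_nonneg)
  qed
  then show "monomial_point N B \<sigma> x (\<lambda>z. u z + w z) = monomial_point N B \<sigma> x u * monomial_point N B \<sigma> x w"
    by (simp add: monomial_point_def u w dual_semigroup_add prod.distrib [symmetric])
qed

lemma monomial_point_coord:
  assumes b: "b \<in> B"
  shows "monomial_point N B \<sigma> x (coord B b) = x b"
proof -
  have "monomial_point N B \<sigma> x (coord B b) = (\<Prod>b'\<in>B. if b' = b then x b else 1)"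
    unfolding monomial_point_def
    by (simp add: coord_in_dual_semigroup b) (auto intro!: prod.cong simp: coord_basis [OF B])
  then show ?thesis using b lattice_basisD(1) [OF B] by simp
qed

context
  fixes \<phi>
  assumes \<phi>: "\<phi> \<in> chart_points N \<sigma>"
begin

lemma chart_mult: "u \<in> dual_semigroup N \<sigma> \<Longrightarrow> w \<in> dual_semigroup N \<sigma> \<Longrightarrow> \<phi> (\<lambda>z. u z + w z) = \<phi> u * \<phi> w"
  and chart_zero: "\<phi> (\<lambda>_. 0) = 1"
  using \<phi> unfolding chart_points_iff by blast+

lemma scaled_coord_in_dual_semigroup:
  assumes "b \<in> B" "b \<in> S \<longrightarrow> 0 \<le> k"
  shows "(\<lambda>z. of_int k * coord B b z) \<in> dual_semigroup N \<sigma>"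
proof -
  have "linear (\<lambda>z. of_int k * coord B b z)"
    using linear_compose_scale_right [OF coord_linear [OF B], of "of_int k"] by simp
  then show ?thesis
    unfolding dual_semigroup_iff using assms S by (auto simp: coord_basis [OF B] subset_iff)
qed

lemma chart_point_nat_power:
  assumes u: "u \<in> dual_semigroup N \<sigma>"
  shows "(\<lambda>z. real n * u z) \<in> dual_semigroup N \<sigma> \<and> \<phi> (\<lambda>z. real n * u z) = \<phi> u ^ n"
proof (induction n)
  case 0
  then show ?case by (simp add: dual_semigroup_zero chart_zero)
next
  case (Suc n)
  have "(\<lambda>z. real (Suc n) * u z) = (\<lambda>z. u z + real n * u z)"
    by (simp add: algebra_simps)
  then show ?case
    using chart_mult [OF u] dual_semigroup_add [OF u] Suc by simp
qed

text \<open>Off the generators both the coordinate and its negative lie in the dual semigroup, so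
  its value is invertible.\<close>

lemma chart_coord_nonzero:
  assumes "b \<in> B - S"
  shows "\<phi> (coord B b) \<noteq> 0"
proof -
  have "(\<lambda>z. coord B b z) \<in> dual_semigroup N \<sigma>" "(\<lambda>z. - coord B b z) \<in> dual_semigroup N \<sigma>"
    using scaled_coord_in_dual_semigroup [of b 1] scaled_coord_in_dual_semigroup [of b "-1"] assms by auto
  from chart_mult [OF this] show ?thesis by (auto simp: chart_zero)
qed

lemma chart_point_coord_power:
  assumes b: "b \<in> B" and k: "b \<in> S \<longrightarrow> 0 \<le> k"
  shows "\<phi> (\<lambda>z. of_int k * coord B b z) = \<phi> (coord B b) powi k"
proof (cases "0 \<le> k")
  case True
  then show ?thesis
    using chart_point_nat_power [OF coord_in_dual_semigroup [OF b], of "nat k"]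
    by (simp add: power_int_def)
next
  case False
  then have bS: "b \<in> B - S" using b k by simp
  let ?u = "\<lambda>z. of_int k * coord B b z" and ?w = "\<lambda>z. real (nat (- k)) * coord B b z"
  have w: "?w \<in> dual_semigroup N \<sigma>" "\<phi> ?w = \<phi> (coord B b) ^ nat (- k)"
    using chart_point_nat_power [OF coord_in_dual_semigroup [OF b]] by blast+
  have "\<phi> ?u * \<phi> ?w = 1"
    using chart_mult [OF scaled_coord_in_dual_semigroup [OF b k] w(1)] False by (simp add: chart_zero)
  then show ?thesis
    using w(2) False chart_coord_nonzero [OF bS]
    by (simp add: power_int_def field_simps)
qed

text \<open>A character is an integral combination of coordinate functions, each term of which
  already lies in the dual semigroup. Hence the chart is a product of real lines, one for each
  generator, and punctured lines.\<close>

lemma chart_point_eq_monomial_point: "\<phi> = monomial_point N B \<sigma> (\<lambda>b. \<phi> (coord B b))"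
proof
  fix u
  show "\<phi> u = monomial_point N B \<sigma> (\<lambda>b. \<phi> (coord B b)) u"
  proof (cases "u \<in> dual_semigroup N \<sigma>")
    case False
    then show ?thesis
      using \<phi> unfolding chart_points_iff by (simp add: monomial_point_def extensional_def)
  next
    case True
    have nn: "b \<in> S \<longrightarrow> 0 \<le> \<lfloor>u b\<rfloor>" for b using True dual_semigroup_iff by auto
    have "(\<lambda>z. \<Sum>b\<in>T. of_int \<lfloor>u b\<rfloor> * coord B b z) \<in> dual_semigroup N \<sigma> \<and>
        \<phi> (\<lambda>z. \<Sum>b\<in>T. of_int \<lfloor>u b\<rfloor> * coord B b z) = (\<Prod>b\<in>T. \<phi> (coord B b) powi \<lfloor>u b\<rfloor>)"
      if "T \<subseteq> B" for T
      using finite_subset [OF that lattice_basisD(1) [OF B]] that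
    proof (induction T rule: finite_induct)
      case empty
      then show ?case by (simp add: dual_semigroup_zero chart_zero)
    next
      case (insert b T)
      then have b: "b \<in> B" by simp
      note 1 = scaled_coord_in_dual_semigroup [OF b nn]
      have IH: "(\<lambda>z. \<Sum>b\<in>T. of_int \<lfloor>u b\<rfloor> * coord B b z) \<in> dual_semigroup N \<sigma>"
        "\<phi> (\<lambda>z. \<Sum>b\<in>T. of_int \<lfloor>u b\<rfloor> * coord B b z) = (\<Prod>b\<in>T. \<phi> (coord B b) powi \<lfloor>u b\<rfloor>)"
        using insert by simp_all
      show ?case
        using insert.hyps chart_mult [OF 1 IH(1)] dual_semigroup_add [OF 1 IH(1)]
          chart_point_coord_power [OF b nn] IH(2) by simp
    qed
    from this [of B] have "\<phi> (\<lambda>z. \<Sum>b\<in>B. of_int \<lfloor>u b\<rfloor> * coord B b z) = (\<Prod>b\<in>B. \<phi> (coord B b) powi \<lfloor>u b\<rfloor>)"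
      by simp
    moreover have "(\<lambda>z. \<Sum>b\<in>B. of_int \<lfloor>u b\<rfloor> * coord B b z) = u"
    proof
      fix z
      have "u z = (\<Sum>b\<in>B. coord B b z * u b)"
        using True dual_semigroup_iff linear_coord_expand [OF B] by blast
      also have "\<dots> = (\<Sum>b\<in>B. of_int \<lfloor>u b\<rfloor> * coord B b z)"
        by (rule sum.cong) (simp_all add: dual_semigroup_floor [OF True])
      finally show "(\<Sum>b\<in>B. of_int \<lfloor>u b\<rfloor> * coord B b z) = u z" by simp
    qed
    ultimately show ?thesis using True by (simp add: monomial_point_def)
  qed
qed

end

lemma chart_points_eqI:
  assumes "\<phi> \<in> chart_points N \<sigma>" "\<phi>' \<in> chart_points N \<sigma>" "\<And>b. b \<in> B \<Longrightarrow> \<phi> (coord B b) = \<phi>' (coord B b)"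
  shows "\<phi> = \<phi>'"
proof -
  have "monomial_point N B \<sigma> (\<lambda>b. \<phi> (coord B b)) = monomial_point N B \<sigma> (\<lambda>b. \<phi>' (coord B b))"
    using assms(3) by (auto simp: monomial_point_def intro!: restrict_ext prod.cong)
  then show ?thesis
    using chart_point_eq_monomial_point assms by metis
qed

lemma continuous_map_monomial_point:
  assumes cont: "\<And>b. b \<in> B \<Longrightarrow> continuous_map Y euclideanreal (\<lambda>k. x k b)"
    and nz: "\<And>k b. k \<in> topspace Y \<Longrightarrow> b \<in> B - S \<Longrightarrow> x k b \<noteq> 0"
  shows "continuous_map Y (affine_chart N \<sigma>) (\<lambda>k. monomial_point N B \<sigma> (x k))"
proof -
  have "continuous_map Y euclideanreal (\<lambda>k. monomial_point N B \<sigma> (x k) u)"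
    if u: "u \<in> dual_semigroup N \<sigma>" for u
  proof -
    have "continuous_map Y euclideanreal (\<lambda>k. \<Prod>b\<in>B. x k b powi \<lfloor>u b\<rfloor>)"
    proof (intro continuous_map_prod lattice_basisD(1) [OF B] continuous_map_power_int cont)
      show "0 \<le> \<lfloor>u b\<rfloor> \<or> (\<forall>k\<in>topspace Y. x k b \<noteq> 0)" if "b \<in> B" for b
        using nz that u by (cases "b \<in> S") (auto simp: dual_semigroup_iff)
    qed
    then show ?thesis using u by (simp add: monomial_point_def)
  qed
  then have "continuous_map Y (product_topology (\<lambda>_. euclideanreal) (dual_semigroup N \<sigma>))
      (\<lambda>k. monomial_point N B \<sigma> (x k))"
    unfolding continuous_map_componentwise by (auto simp: monomial_point_def)
  moreover have "monomial_point N B \<sigma> (x k) \<in> chart_points N \<sigma>" if "k \<in> topspace Y" for k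
    using nz that by (intro monomial_point_in_chart) blast
  ultimately show ?thesis
    unfolding affine_chart_def continuous_map_in_subtopology by (auto simp: chart_points_iff)
qed

lemma restrict_to_face:
  assumes S': "S' \<subseteq> S"
  shows "\<tau> = convex_cone hull S' \<Longrightarrow>
    restrict (monomial_point N B \<tau> x) (dual_semigroup N \<sigma>) = monomial_point N B \<sigma> x"
proof -
  assume \<tau>: "\<tau> = convex_cone hull S'"
  have "dual_semigroup N \<sigma> \<subseteq> dual_semigroup N \<tau>"
    unfolding \<tau> \<sigma> by (rule dual_semigroup_mono [OF hull_mono [OF S']])
  then show "restrict (monomial_point N B \<tau> x) (dual_semigroup N \<sigma>) = monomial_point N B \<sigma> x"
    by (intro ext) (auto simp: monomial_point_def)
qed

end

section \<open>The charts of a real toric variety\<close>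

context smooth_fan_locale
begin

lemma gluing_iff:
  "((\<sigma>, \<phi>), (\<sigma>', \<phi>')) \<in> chart_gluing N \<Delta> \<longleftrightarrow> \<sigma> \<in> \<Delta> \<and> \<sigma>' \<in> \<Delta> \<and>
     (\<exists>z\<in>chart_points N (\<sigma> \<inter> \<sigma>'). \<phi> = restrict z (dual_semigroup N \<sigma>) \<and> \<phi>' = restrict z (dual_semigroup N \<sigma>'))"
  unfolding chart_gluing_def by blast

lemma coords_nonzero_off_gens:
  assumes "\<sigma> \<in> \<Delta>" "\<phi> \<in> chart_points N \<sigma>" "b \<in> bas \<sigma> - gens \<sigma>"
  shows "\<phi> (coord (bas \<sigma>) b) \<noteq> 0"
  by (rule chart_coord_nonzero [OF bas_gens [OF assms(1)] assms(2,3)])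

text \<open>The inverse of the inclusion of the chart of a face, defined on the locus where the
  coordinates at the omitted generators do not vanish. The same formula is read on the larger
  semigroup of the face.\<close>

definition extend_point :: "'a set \<Rightarrow> 'a set \<Rightarrow> (('a \<Rightarrow> real) \<Rightarrow> real) \<Rightarrow> ('a \<Rightarrow> real) \<Rightarrow> real" where
  "extend_point \<sigma> \<tau> \<phi> = monomial_point N (bas \<sigma>) \<tau> (\<lambda>b. \<phi> (coord (bas \<sigma>) b))"

context
  fixes \<sigma> \<tau> S'
  assumes \<sigma>: "\<sigma> \<in> \<Delta>" and S': "S' \<subseteq> gens \<sigma>" and \<tau>: "\<tau> = convex_cone hull S'"
begin

lemma face_subset: "\<tau> \<subseteq> \<sigma>"
  using hull_mono [OF S', of convex_cone] bas_gens(3) [OF \<sigma>] \<tau> by simp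

lemma face_basis: "S' \<subseteq> bas \<sigma>"
  using S' bas_gens(2) [OF \<sigma>] by blast

lemma face_coord_nonzero:
  assumes "z \<in> chart_points N \<tau>" "b \<in> bas \<sigma> - S'"
  shows "z (coord (bas \<sigma>) b) \<noteq> 0"
  by (rule chart_coord_nonzero [OF bas_gens(1) [OF \<sigma>] face_basis \<tau> assms])

lemma extend_point:
  assumes \<phi>: "\<phi> \<in> chart_points N \<sigma>" and nz: "\<forall>b\<in>gens \<sigma> - S'. \<phi> (coord (bas \<sigma>) b) \<noteq> 0"
  shows "extend_point \<sigma> \<tau> \<phi> \<in> chart_points N \<tau>"
    "restrict (extend_point \<sigma> \<tau> \<phi>) (dual_semigroup N \<sigma>) = \<phi>"
proof -
  have "\<forall>b\<in>bas \<sigma> - S'. \<phi> (coord (bas \<sigma>) b) \<noteq> 0"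
    using nz coords_nonzero_off_gens [OF \<sigma> \<phi>] by blast
  then show "extend_point \<sigma> \<tau> \<phi> \<in> chart_points N \<tau>"
    unfolding extend_point_def
    by (rule monomial_point_in_chart [OF bas_gens(1) [OF \<sigma>] face_basis \<tau>])
  show "restrict (extend_point \<sigma> \<tau> \<phi>) (dual_semigroup N \<sigma>) = \<phi>"
    unfolding extend_point_def restrict_to_face [OF bas_gens [OF \<sigma>] S' \<tau>]
    by (rule chart_point_eq_monomial_point [OF bas_gens [OF \<sigma>] \<phi>, symmetric])
qed

lemma restrict_inj:
  assumes z: "z \<in> chart_points N \<tau>" "z' \<in> chart_points N \<tau>"
    and eq: "restrict z (dual_semigroup N \<sigma>) = restrict z' (dual_semigroup N \<sigma>)"
  shows "z = z'"
proof (rule chart_points_eqI [OF bas_gens(1) [OF \<sigma>] face_basis \<tau> z])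
  fix b assume "b \<in> bas \<sigma>"
  then have "coord (bas \<sigma>) b \<in> dual_semigroup N \<sigma>"
    by (rule coord_in_dual_semigroup [OF bas_gens [OF \<sigma>]])
  then show "z (coord (bas \<sigma>) b) = z' (coord (bas \<sigma>) b)"
    using eq by (metis restrict_apply')
qed

text \<open>The image of \<open>W\<close> is its preimage under the continuous map
  \<open>extend_point\<close>, whose domain is open as a finite intersection of nonvanishing
  loci.\<close>

lemma openin_face_image:
  assumes W: "openin (affine_chart N \<tau>) W"
  shows "openin (affine_chart N \<sigma>) ((\<lambda>z. restrict z (dual_semigroup N \<sigma>)) ` W)"
proof -
  let ?B = "bas \<sigma>"
  let ?M = "{\<phi> \<in> chart_points N \<sigma>. \<forall>b\<in>gens \<sigma> - S'. \<phi> (coord ?B b) \<noteq> 0}"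
  note cB = coord_in_dual_semigroup [OF bas_gens [OF \<sigma>]]
  have fin: "finite (gens \<sigma> - S')"
    by (rule finite_subset [OF _ lattice_basisD(1) [OF bas_gens(1) [OF \<sigma>]]])
      (use bas_gens(2) [OF \<sigma>] in blast)
  have "openin (affine_chart N \<sigma>) {\<phi> \<in> chart_points N \<sigma>. \<phi> (coord ?B b) \<in> - {0}}" if "b \<in> gens \<sigma> - S'" for b
    using that bas_gens(2) [OF \<sigma>] cB [of b]
    by (intro openin_continuous_map_preimage [OF continuous_map_eval]) auto
  then have "openin (affine_chart N \<sigma>) (chart_points N \<sigma> \<inter> (\<Inter>b\<in>gens \<sigma> - S'. {\<phi> \<in> chart_points N \<sigma>. \<phi> (coord ?B b) \<in> - {0}}))"
  proof (cases "gens \<sigma> - S' = {}")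
    case True
    show ?thesis unfolding True by simp
  qed (use fin in \<open>auto intro!: openin_Int openin_INT\<close>)
  also have "chart_points N \<sigma> \<inter> (\<Inter>b\<in>gens \<sigma> - S'. {\<phi> \<in> chart_points N \<sigma>. \<phi> (coord ?B b) \<in> - {0}}) = ?M"
    by blast
  finally have M: "openin (affine_chart N \<sigma>) ?M" .
  have "continuous_map (subtopology (affine_chart N \<sigma>) ?M) (affine_chart N \<tau>) (extend_point \<sigma> \<tau>)"
    unfolding extend_point_def [abs_def]
  proof (rule continuous_map_monomial_point [OF bas_gens(1) [OF \<sigma>] face_basis \<tau>])
    show "continuous_map (subtopology (affine_chart N \<sigma>) ?M) euclideanreal (\<lambda>\<phi>. \<phi> (coord ?B b))" if "b \<in> ?B" for b
      by (rule continuous_map_from_subtopology [OF continuous_map_eval [OF cB [OF that]]])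
    fix \<phi> b assume "\<phi> \<in> topspace (subtopology (affine_chart N \<sigma>) ?M)" "b \<in> ?B - S'"
    then show "\<phi> (coord ?B b) \<noteq> 0"
      using coords_nonzero_off_gens [OF \<sigma>, of \<phi> b] by (cases "b \<in> gens \<sigma>") auto
  qed
  from openin_continuous_map_preimage [OF this W]
  have "openin (subtopology (affine_chart N \<sigma>) ?M)
      {\<phi> \<in> topspace (subtopology (affine_chart N \<sigma>) ?M). extend_point \<sigma> \<tau> \<phi> \<in> W}" .
  then have op: "openin (affine_chart N \<sigma>) {\<phi> \<in> topspace (subtopology (affine_chart N \<sigma>) ?M). extend_point \<sigma> \<tau> \<phi> \<in> W}"
    by (rule openin_trans_full [OF _ M])
  have "(\<lambda>z. restrict z (dual_semigroup N \<sigma>)) ` W = {\<phi> \<in> topspace (subtopology (affine_chart N \<sigma>) ?M). extend_point \<sigma> \<tau> \<phi> \<in> W}"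
  proof (intro subset_antisym subsetI)
    fix \<phi> assume "\<phi> \<in> (\<lambda>z. restrict z (dual_semigroup N \<sigma>)) ` W"
    then obtain z where z: "z \<in> W" "\<phi> = restrict z (dual_semigroup N \<sigma>)" by blast
    then have zc: "z \<in> chart_points N \<tau>" using openin_subset [OF W] by blast
    have \<phi>: "\<phi> \<in> chart_points N \<sigma>" using restrict_chart_points [OF face_subset zc] z(2) by simp
    have nz: "\<forall>b\<in>gens \<sigma> - S'. \<phi> (coord ?B b) \<noteq> 0"
    proof
      fix b assume b: "b \<in> gens \<sigma> - S'"
      then have "b \<in> ?B" using bas_gens(2) [OF \<sigma>] by blast
      then show "\<phi> (coord ?B b) \<noteq> 0"
        using face_coord_nonzero [OF zc, of b] b cB [of b] z(2) by simp
    qed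
    have "extend_point \<sigma> \<tau> \<phi> = z"
      by (rule restrict_inj [OF extend_point(1) [OF \<phi> nz] zc trans [OF extend_point(2) [OF \<phi> nz] z(2)]])
    then show "\<phi> \<in> {\<phi> \<in> topspace (subtopology (affine_chart N \<sigma>) ?M). extend_point \<sigma> \<tau> \<phi> \<in> W}"
      using \<phi> nz z(1) by simp
  next
    fix \<phi> assume "\<phi> \<in> {\<phi> \<in> topspace (subtopology (affine_chart N \<sigma>) ?M). extend_point \<sigma> \<tau> \<phi> \<in> W}"
    then have "\<phi> \<in> chart_points N \<sigma>" "\<forall>b\<in>gens \<sigma> - S'. \<phi> (coord ?B b) \<noteq> 0" "extend_point \<sigma> \<tau> \<phi> \<in> W" by simp_all
    then show "\<phi> \<in> (\<lambda>z. restrict z (dual_semigroup N \<sigma>)) ` W"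
      using extend_point(2) [of \<phi>] by (metis imageI)
  qed
  then show ?thesis using op by simp
qed

end

section \<open>The gluing relation, the quotient and its open charts\<close>

lemma gluing_points:
  assumes "((\<sigma>, \<phi>), (\<sigma>', \<phi>')) \<in> chart_gluing N \<Delta>"
  shows "\<sigma> \<in> \<Delta>" "\<sigma>' \<in> \<Delta>" "\<phi> \<in> chart_points N \<sigma>" "\<phi>' \<in> chart_points N \<sigma>'"
proof -
  obtain z where z: "z \<in> chart_points N (\<sigma> \<inter> \<sigma>')" "\<phi> = restrict z (dual_semigroup N \<sigma>)"
    "\<phi>' = restrict z (dual_semigroup N \<sigma>')" and \<sigma>: "\<sigma> \<in> \<Delta>" "\<sigma>' \<in> \<Delta>"
    using assms unfolding gluing_iff by blast
  show "\<sigma> \<in> \<Delta>" "\<sigma>' \<in> \<Delta>" using \<sigma> by simp_all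
  show "\<phi> \<in> chart_points N \<sigma>" "\<phi>' \<in> chart_points N \<sigma>'"
    using z restrict_chart_points [of "\<sigma> \<inter> \<sigma>'" _ z N] by simp_all
qed

lemma gluing_refl:
  assumes "\<sigma> \<in> \<Delta>" "\<phi> \<in> chart_points N \<sigma>"
  shows "((\<sigma>, \<phi>), (\<sigma>, \<phi>)) \<in> chart_gluing N \<Delta>"
proof -
  have "\<phi> = restrict \<phi> (dual_semigroup N \<sigma>)"
    using assms(2) unfolding chart_points_iff by (simp add: extensional_restrict)
  then show ?thesis using assms unfolding gluing_iff Int_absorb by blast
qed

text \<open>The middle point has nonzero coordinates off \<open>S1\<close> and off
  \<open>S3\<close>, hence off their intersection. It therefore extends to the chart of the face
  spanned by the common generators, and this one point restricts to both given gluings.\<close>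

lemma gluing_trans:
  assumes 1: "((\<sigma>1, \<phi>1), (\<sigma>2, \<phi>2)) \<in> chart_gluing N \<Delta>" and 2: "((\<sigma>2, \<phi>2), (\<sigma>3, \<phi>3)) \<in> chart_gluing N \<Delta>"
  shows "((\<sigma>1, \<phi>1), (\<sigma>3, \<phi>3)) \<in> chart_gluing N \<Delta>"
proof -
  let ?D = "dual_semigroup N"
  note \<sigma>1 = gluing_points(1) [OF 1] and \<sigma>2 = gluing_points(2) [OF 1] and \<sigma>3 = gluing_points(2) [OF 2]
  note \<phi>2 = gluing_points(4) [OF 1]
  obtain z1 where z1: "z1 \<in> chart_points N (\<sigma>1 \<inter> \<sigma>2)" "\<phi>1 = restrict z1 (?D \<sigma>1)" "\<phi>2 = restrict z1 (?D \<sigma>2)"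
    using 1 unfolding gluing_iff by blast
  obtain z2 where z2: "z2 \<in> chart_points N (\<sigma>2 \<inter> \<sigma>3)" "\<phi>2 = restrict z2 (?D \<sigma>2)" "\<phi>3 = restrict z2 (?D \<sigma>3)"
    using 2 unfolding gluing_iff by blast
  obtain S1 where S1: "S1 \<subseteq> gens \<sigma>2" "\<sigma>1 \<inter> \<sigma>2 = convex_cone hull S1"
    using Int_cone [OF \<sigma>2 \<sigma>1] by (metis Int_commute)
  obtain S3 where S3: "S3 \<subseteq> gens \<sigma>2" "\<sigma>2 \<inter> \<sigma>3 = convex_cone hull S3"
    using Int_cone [OF \<sigma>2 \<sigma>3] .
  define \<tau> where "\<tau> = convex_cone hull (S1 \<inter> S3)"
  have S: "S1 \<inter> S3 \<subseteq> gens \<sigma>2" using S1 by blast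
  have sub: "\<tau> \<subseteq> \<sigma>1 \<inter> \<sigma>2" "\<tau> \<subseteq> \<sigma>2 \<inter> \<sigma>3"
    unfolding \<tau>_def S1(2) S3(2) by (intro hull_mono; blast)+
  have nz: "\<forall>b\<in>gens \<sigma>2 - (S1 \<inter> S3). \<phi>2 (coord (bas \<sigma>2) b) \<noteq> 0"
  proof
    fix b assume b: "b \<in> gens \<sigma>2 - (S1 \<inter> S3)"
    then have bB: "b \<in> bas \<sigma>2" using bas_gens(2) [OF \<sigma>2] by blast
    note c = coord_in_dual_semigroup [OF bas_gens [OF \<sigma>2] bB]
    show "\<phi>2 (coord (bas \<sigma>2) b) \<noteq> 0"
    proof (cases "b \<in> S1")
      case True
      then have "b \<in> bas \<sigma>2 - S3" using b bB by blast
      from face_coord_nonzero [OF \<sigma>2 S3 z2(1) this] show ?thesis using z2(2) c by simp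
    next
      case False
      then have "b \<in> bas \<sigma>2 - S1" using bB by blast
      from face_coord_nonzero [OF \<sigma>2 S1 z1(1) this] show ?thesis using z1(3) c by simp
    qed
  qed
  define z where "z = extend_point \<sigma>2 \<tau> \<phi>2"
  have z: "z \<in> chart_points N \<tau>" "restrict z (?D \<sigma>2) = \<phi>2"
    unfolding z_def by (rule extend_point [OF \<sigma>2 S \<tau>_def \<phi>2 nz])+
  have D: "?D \<sigma>2 \<subseteq> ?D (\<sigma>1 \<inter> \<sigma>2)" "?D \<sigma>2 \<subseteq> ?D (\<sigma>2 \<inter> \<sigma>3)" "?D \<sigma>1 \<subseteq> ?D (\<sigma>1 \<inter> \<sigma>2)"
    "?D \<sigma>3 \<subseteq> ?D (\<sigma>2 \<inter> \<sigma>3)" "?D \<sigma>1 \<subseteq> ?D (\<sigma>1 \<inter> \<sigma>3)" "?D \<sigma>3 \<subseteq> ?D (\<sigma>1 \<inter> \<sigma>3)"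
    by (rule dual_semigroup_mono; blast)+
  have "restrict z (?D (\<sigma>1 \<inter> \<sigma>2)) = z1"
    by (rule restrict_inj [OF \<sigma>2 S1 restrict_chart_points [OF sub(1) z(1)] z1(1)])
      (use z(2) z1(3) D(1) in \<open>simp add: Int_absorb1\<close>)
  moreover have "restrict z (?D (\<sigma>2 \<inter> \<sigma>3)) = z2"
    by (rule restrict_inj [OF \<sigma>2 S3 restrict_chart_points [OF sub(2) z(1)] z2(1)])
      (use z(2) z2(2) D(2) in \<open>simp add: Int_absorb1\<close>)
  ultimately have "\<phi>1 = restrict (restrict z (?D (\<sigma>1 \<inter> \<sigma>3))) (?D \<sigma>1)"
    "\<phi>3 = restrict (restrict z (?D (\<sigma>1 \<inter> \<sigma>3))) (?D \<sigma>3)"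
    using z1(2) z2(3) D by (auto simp: Int_absorb1)
  moreover have "restrict z (?D (\<sigma>1 \<inter> \<sigma>3)) \<in> chart_points N (\<sigma>1 \<inter> \<sigma>3)"
    by (rule restrict_chart_points [OF _ z(1)]) (use sub in blast)
  ultimately show ?thesis unfolding gluing_iff using \<sigma>1 \<sigma>3 by blast
qed

lemma gluing_sym:
  "((\<sigma>, \<phi>), (\<sigma>', \<phi>')) \<in> chart_gluing N \<Delta> \<Longrightarrow> ((\<sigma>', \<phi>'), (\<sigma>, \<phi>)) \<in> chart_gluing N \<Delta>"
  unfolding gluing_iff by (metis Int_commute)

abbreviation "charts \<equiv> sum_topology (affine_chart N) \<Delta>"

lemma equiv_gluing: "equiv (topspace charts) (chart_gluing N \<Delta>)"
proof (rule equivI)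
  show "chart_gluing N \<Delta> \<subseteq> topspace charts \<times> topspace charts"
    using gluing_points by auto
  show "refl_on (topspace charts) (chart_gluing N \<Delta>)"
    by (rule refl_onI) (use gluing_refl in auto)
  show "sym (chart_gluing N \<Delta>)"
    by (rule symI) (use gluing_sym in auto)
  show "trans (chart_gluing N \<Delta>)"
    by (rule transI) (use gluing_trans in auto)
qed

definition X where "X = real_toric_variety N \<Delta>"

definition point :: "'a set \<Rightarrow> (('a \<Rightarrow> real) \<Rightarrow> real) \<Rightarrow> ('a set \<times> (('a \<Rightarrow> real) \<Rightarrow> real)) set" where
  "point \<sigma> \<phi> = chart_gluing N \<Delta> `` {(\<sigma>, \<phi>)}"

definition chart_image :: "'a set \<Rightarrow> ('a set \<times> (('a \<Rightarrow> real) \<Rightarrow> real)) set set" where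
  "chart_image \<sigma> = point \<sigma> ` chart_points N \<sigma>"

lemma openin_X: "openin X W \<longleftrightarrow> W \<subseteq> topspace charts // chart_gluing N \<Delta> \<and> openin charts (\<Union>W)"
  unfolding X_def real_toric_variety_def by (rule openin_quotient_topology [OF equiv_gluing])

lemma topspace_X: "topspace X = topspace charts // chart_gluing N \<Delta>"
  unfolding X_def real_toric_variety_def by (rule topspace_quotient_topology [OF equiv_gluing])

lemma topspace_X_charts: "topspace X = (\<Union>\<sigma>\<in>\<Delta>. chart_image \<sigma>)"
proof -
  have "topspace X = (\<Union>p\<in>Sigma \<Delta> (chart_points N). {chart_gluing N \<Delta> `` {p}})"
    unfolding topspace_X quotient_def by (simp add: comp_def)
  also have "\<dots> = (\<Union>\<sigma>\<in>\<Delta>. \<Union>\<phi>\<in>chart_points N \<sigma>. {chart_gluing N \<Delta> `` {(\<sigma>, \<phi>)}})"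
    by blast
  also have "\<dots> = (\<Union>\<sigma>\<in>\<Delta>. chart_image \<sigma>)"
    by (simp add: chart_image_def point_def UNION_singleton_eq_range)
  finally show ?thesis .
qed

lemma point_eq_iff:
  assumes "\<sigma> \<in> \<Delta>" "\<phi> \<in> chart_points N \<sigma>" "\<sigma>' \<in> \<Delta>" "\<phi>' \<in> chart_points N \<sigma>'"
  shows "point \<sigma> \<phi> = point \<sigma>' \<phi>' \<longleftrightarrow> ((\<sigma>, \<phi>), (\<sigma>', \<phi>')) \<in> chart_gluing N \<Delta>"
  unfolding point_def by (rule eq_equiv_class_iff [OF equiv_gluing]) (use assms in auto)

lemma inj_on_point:
  assumes "\<sigma> \<in> \<Delta>"
  shows "inj_on (point \<sigma>) (chart_points N \<sigma>)"
proof (rule inj_onI)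
  fix \<phi> \<phi>' assume "\<phi> \<in> chart_points N \<sigma>" "\<phi>' \<in> chart_points N \<sigma>" "point \<sigma> \<phi> = point \<sigma> \<phi>'"
  then have "((\<sigma>, \<phi>), (\<sigma>, \<phi>')) \<in> chart_gluing N \<Delta>" using point_eq_iff assms by blast
  then show "\<phi> = \<phi>'" unfolding gluing_iff by blast
qed

lemma continuous_point:
  assumes \<sigma>: "\<sigma> \<in> \<Delta>"
  shows "continuous_map (affine_chart N \<sigma>) X (point \<sigma>)"
  unfolding continuous_map_def
proof (intro conjI allI impI)
  show "point \<sigma> \<in> chart_points N \<sigma> \<rightarrow> topspace X"
    using topspace_X_charts \<sigma> by (auto simp: chart_image_def)
  fix W assume W: "openin X W"
  have "{\<phi> \<in> chart_points N \<sigma>. point \<sigma> \<phi> \<in> W} = {\<phi>. (\<sigma>, \<phi>) \<in> \<Union>W}"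
  proof (intro subset_antisym subsetI)
    fix \<phi> assume "\<phi> \<in> {\<phi> \<in> chart_points N \<sigma>. point \<sigma> \<phi> \<in> W}"
    then show "\<phi> \<in> {\<phi>. (\<sigma>, \<phi>) \<in> \<Union>W}"
      using gluing_refl [OF \<sigma>] by (auto simp: point_def intro!: bexI [of _ "point \<sigma> \<phi>"])
  next
    fix \<phi> assume "\<phi> \<in> {\<phi>. (\<sigma>, \<phi>) \<in> \<Union>W}"
    then obtain C where C: "C \<in> W" "(\<sigma>, \<phi>) \<in> C" by blast
    then have CQ: "C \<in> topspace charts // chart_gluing N \<Delta>" using W openin_X by blast
    then obtain y where y: "C = chart_gluing N \<Delta> `` {y}" by (auto simp: quotient_def)
    then have "(y, (\<sigma>, \<phi>)) \<in> chart_gluing N \<Delta>" using C by blast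
    then have "C = point \<sigma> \<phi>" "\<phi> \<in> chart_points N \<sigma>"
      using y equiv_class_eq [OF equiv_gluing] gluing_points(4) unfolding point_def
      by (metis, metis prod.collapse)
    then show "\<phi> \<in> {\<phi> \<in> chart_points N \<sigma>. point \<sigma> \<phi> \<in> W}" using C by simp
  qed
  then show "openin (affine_chart N \<sigma>) {\<phi> \<in> chart_points N \<sigma>. point \<sigma> \<phi> \<in> W}"
    using W \<sigma> unfolding openin_X openin_sum_topology by simp
qed

text \<open>In another chart the image of \<open>V\<close> is seen through the intersection cone: it
  is the part of the overlap lying over \<open>V\<close>, which remains open by
  \<open>openin_face_image\<close>.\<close>

lemma open_point:
  assumes \<sigma>: "\<sigma> \<in> \<Delta>"
  shows "open_map (affine_chart N \<sigma>) X (point \<sigma>)"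
  unfolding open_map_def
proof (intro allI impI)
  fix V assume V: "openin (affine_chart N \<sigma>) V"
  then have VU: "V \<subseteq> chart_points N \<sigma>" by (rule openin_subset)
  show "openin X (point \<sigma> ` V)"
    unfolding openin_X openin_sum_topology
  proof (intro conjI ballI)
    show "point \<sigma> ` V \<subseteq> topspace charts // chart_gluing N \<Delta>"
      using topspace_X_charts \<sigma> VU unfolding topspace_X [symmetric] chart_image_def by blast
    show "\<Union> (point \<sigma> ` V) \<subseteq> Sigma \<Delta> (topspace \<circ> affine_chart N)"
      using gluing_points unfolding point_def by fastforce
    fix \<sigma>' assume \<sigma>': "\<sigma>' \<in> \<Delta>"
    let ?\<tau> = "\<sigma> \<inter> \<sigma>'" and ?D = "dual_semigroup N"
    obtain S' where S': "S' \<subseteq> gens \<sigma>'" "?\<tau> = convex_cone hull S'"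
      using Int_cone [OF \<sigma>' \<sigma>] by (metis Int_commute)
    obtain S where S: "S \<subseteq> gens \<sigma>" "?\<tau> = convex_cone hull S"
      using Int_cone [OF \<sigma> \<sigma>'] .
    let ?W = "{z \<in> chart_points N ?\<tau>. restrict z (?D \<sigma>) \<in> V}"
    have cont: "continuous_map (affine_chart N ?\<tau>) (affine_chart N \<sigma>) (\<lambda>z. restrict z (?D \<sigma>))"
    proof -
      have "?D \<sigma> \<subseteq> ?D ?\<tau>" by (rule dual_semigroup_mono) blast
      then have "continuous_map (affine_chart N ?\<tau>) (product_topology (\<lambda>_. euclideanreal) (?D \<sigma>)) (\<lambda>z. restrict z (?D \<sigma>))"
        unfolding continuous_map_componentwise
        using continuous_map_eval [of _ N ?\<tau>] by auto
      moreover have "restrict z (?D \<sigma>) \<in> chart_points N \<sigma>" if "z \<in> chart_points N ?\<tau>" for z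
        by (rule restrict_chart_points [OF _ that]) blast
      ultimately show ?thesis
        unfolding affine_chart_def [of N \<sigma>] continuous_map_in_subtopology by (auto simp: chart_points_iff)
    qed
    have "{\<phi>'. (\<sigma>', \<phi>') \<in> \<Union> (point \<sigma> ` V)} = (\<lambda>z. restrict z (?D \<sigma>')) ` ?W"
    proof (intro subset_antisym subsetI)
      fix \<phi>' assume "\<phi>' \<in> {\<phi>'. (\<sigma>', \<phi>') \<in> \<Union> (point \<sigma> ` V)}"
      then obtain \<phi> where "\<phi> \<in> V" "((\<sigma>, \<phi>), (\<sigma>', \<phi>')) \<in> chart_gluing N \<Delta>" by (auto simp: point_def)
      then show "\<phi>' \<in> (\<lambda>z. restrict z (?D \<sigma>')) ` ?W" unfolding gluing_iff by blast
    next
      fix \<phi>' assume "\<phi>' \<in> (\<lambda>z. restrict z (?D \<sigma>')) ` ?W"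
      then obtain z where z: "z \<in> chart_points N ?\<tau>" "restrict z (?D \<sigma>) \<in> V" "\<phi>' = restrict z (?D \<sigma>')" by blast
      then have "((\<sigma>, restrict z (?D \<sigma>)), (\<sigma>', \<phi>')) \<in> chart_gluing N \<Delta>"
        unfolding gluing_iff using \<sigma> \<sigma>' by blast
      then show "\<phi>' \<in> {\<phi>'. (\<sigma>', \<phi>') \<in> \<Union> (point \<sigma> ` V)}" using z(2) by (auto simp: point_def)
    qed
    moreover have "openin (affine_chart N \<sigma>') ((\<lambda>z. restrict z (?D \<sigma>')) ` ?W)"
      by (rule openin_face_image [OF \<sigma>' S' openin_continuous_map_preimage [OF cont V]])
    ultimately show "openin (affine_chart N \<sigma>') {\<phi>'. (\<sigma>', \<phi>') \<in> \<Union> (point \<sigma> ` V)}" by simp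
  qed
qed

lemma homeomorphic_map_point:
  assumes "\<sigma> \<in> \<Delta>"
  shows "homeomorphic_map (affine_chart N \<sigma>) (subtopology X (chart_image \<sigma>)) (point \<sigma>)"
  using injective_open_imp_embedding_map [OF continuous_point open_point inj_on_point] assms
  unfolding embedding_map_def chart_image_def by blast

lemma chart_image_open: "\<sigma> \<in> \<Delta> \<Longrightarrow> openin X (chart_image \<sigma>)"
  using open_point unfolding open_map_def chart_image_def by blast

lemma chart_image_mono:
  assumes \<sigma>: "\<sigma> \<in> \<Delta>" and \<tau>: "\<tau> \<in> \<Delta>" "\<tau> \<subseteq> \<sigma>"
  shows "chart_image \<tau> \<subseteq> chart_image \<sigma>"
    "z \<in> chart_points N \<tau> \<Longrightarrow> point \<tau> z = point \<sigma> (restrict z (dual_semigroup N \<sigma>))"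
proof -
  show *: "point \<tau> z = point \<sigma> (restrict z (dual_semigroup N \<sigma>))" if z: "z \<in> chart_points N \<tau>" for z
  proof -
    have "z = restrict z (dual_semigroup N \<tau>)"
      using z unfolding chart_points_iff by (simp add: extensional_restrict)
    moreover have "\<tau> \<inter> \<sigma> = \<tau>" using \<tau> by blast
    ultimately have "((\<tau>, z), (\<sigma>, restrict z (dual_semigroup N \<sigma>))) \<in> chart_gluing N \<Delta>"
      unfolding gluing_iff using \<sigma> \<tau> z by auto
    then show ?thesis
      using point_eq_iff [OF \<tau>(1) z \<sigma> restrict_chart_points [OF \<tau>(2) z]] by simp
  qed
  show "chart_image \<tau> \<subseteq> chart_image \<sigma>"
    unfolding chart_image_def using * restrict_chart_points [OF \<tau>(2)] by fastforce
qed

lemma chart_image_Int: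
  assumes \<sigma>: "\<sigma> \<in> \<Delta>" "\<sigma>' \<in> \<Delta>"
  shows "chart_image \<sigma> \<inter> chart_image \<sigma>' \<subseteq> chart_image (\<sigma> \<inter> \<sigma>')"
proof
  fix x assume "x \<in> chart_image \<sigma> \<inter> chart_image \<sigma>'"
  then obtain \<phi> \<phi>' where \<phi>: "\<phi> \<in> chart_points N \<sigma>" "\<phi>' \<in> chart_points N \<sigma>'" "x = point \<sigma> \<phi>" "x = point \<sigma>' \<phi>'"
    unfolding chart_image_def by blast
  then obtain z where z: "z \<in> chart_points N (\<sigma> \<inter> \<sigma>')" "\<phi> = restrict z (dual_semigroup N \<sigma>)"
    using point_eq_iff [OF \<sigma>(1) \<phi>(1) \<sigma>(2) \<phi>(2)] unfolding gluing_iff by auto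
  have "point (\<sigma> \<inter> \<sigma>') z = x"
    using chart_image_mono(2) [OF \<sigma>(1) fan_Int [OF \<sigma>] _ z(1)] z(2) \<phi>(3) by simp
  then show "x \<in> chart_image (\<sigma> \<inter> \<sigma>')" unfolding chart_image_def using z(1) by blast
qed

text \<open>The charts through \<open>x\<close> form a finite family closed under intersection of
  cones, so a minimal cone is the least one.\<close>

lemma minimal_cone:
  assumes x: "x \<in> topspace X"
  shows "\<exists>\<tau>\<in>\<Delta>. x \<in> chart_image \<tau> \<and> (\<forall>\<sigma>\<in>\<Delta>. x \<in> chart_image \<sigma> \<longrightarrow> \<tau> \<subseteq> \<sigma>)"
proof -
  let ?F = "{\<sigma> \<in> \<Delta>. x \<in> chart_image \<sigma>}"
  have F: "finite ?F" "?F \<noteq> {}" using fan_finite x topspace_X_charts by auto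
  from finite_has_minimal [OF this]
  obtain \<tau> where \<tau>: "\<tau> \<in> \<Delta>" "x \<in> chart_image \<tau>"
    "\<And>\<sigma>. \<sigma> \<in> \<Delta> \<Longrightarrow> x \<in> chart_image \<sigma> \<Longrightarrow> \<sigma> \<subseteq> \<tau> \<Longrightarrow> \<tau> = \<sigma>"
    by auto
  have "\<tau> \<subseteq> \<sigma>" if \<sigma>: "\<sigma> \<in> \<Delta>" "x \<in> chart_image \<sigma>" for \<sigma>
  proof -
    have "x \<in> chart_image (\<tau> \<inter> \<sigma>)" using subsetD [OF chart_image_Int [OF \<tau>(1) \<sigma>(1)]] \<tau>(2) \<sigma>(2) by simp
    then have "\<tau> = \<tau> \<inter> \<sigma>" using \<tau>(3) [OF fan_Int [OF \<tau>(1) \<sigma>(1)]] by simp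
    then show ?thesis by blast
  qed
  with \<tau>(1,2) show ?thesis by (intro bexI [of _ \<tau>]) simp_all
qed

section \<open>Coordinates on the glued charts\<close>

definition point_coord :: "'a set \<Rightarrow> ('a set \<times> (('a \<Rightarrow> real) \<Rightarrow> real)) set \<Rightarrow> 'a \<Rightarrow> real" where
  "point_coord \<sigma> x b = inv_into (chart_points N \<sigma>) (point \<sigma>) x (coord (bas \<sigma>) b)"

text \<open>Inverse to \<open>point_coord \<sigma>\<close>, provided that the point lies in the
  chart and the coordinates off the generators are nonzero.\<close>

definition coord_point :: "'a set \<Rightarrow> ('a \<Rightarrow> real) \<Rightarrow> ('a set \<times> (('a \<Rightarrow> real) \<Rightarrow> real)) set" where
  "coord_point \<sigma> x = point \<sigma> (monomial_point N (bas \<sigma>) \<sigma> x)"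

context
  fixes \<sigma> assumes \<sigma>: "\<sigma> \<in> \<Delta>"
begin

lemma point_coord_point:
  "\<phi> \<in> chart_points N \<sigma> \<Longrightarrow> point_coord \<sigma> (point \<sigma> \<phi>) b = \<phi> (coord (bas \<sigma>) b)"
  unfolding point_coord_def using inv_into_f_f [OF inj_on_point [OF \<sigma>]] by simp

lemma continuous_point_coord:
  assumes b: "b \<in> bas \<sigma>"
  shows "continuous_map (subtopology X (chart_image \<sigma>)) euclideanreal (\<lambda>x. point_coord \<sigma> x b)"
proof -
  obtain g where g: "homeomorphic_maps (affine_chart N \<sigma>) (subtopology X (chart_image \<sigma>)) (point \<sigma>) g"
    using homeomorphic_map_point [OF \<sigma>] homeomorphic_map_maps by blast
  have "continuous_map (subtopology X (chart_image \<sigma>)) euclideanreal ((\<lambda>\<phi>. \<phi> (coord (bas \<sigma>) b)) \<circ> g)"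
    using g unfolding homeomorphic_maps_def
    by (intro continuous_map_compose [OF _ continuous_map_eval [OF coord_in_dual_semigroup [OF bas_gens [OF \<sigma>] b]]]) blast
  then show ?thesis
  proof (rule continuous_map_eq)
    fix x assume x: "x \<in> topspace (subtopology X (chart_image \<sigma>))"
    have gx: "g x \<in> chart_points N \<sigma>" "point \<sigma> (g x) = x"
      using g x unfolding homeomorphic_maps_def continuous_map_def by auto
    then show "((\<lambda>\<phi>. \<phi> (coord (bas \<sigma>) b)) \<circ> g) x = point_coord \<sigma> x b"
      using point_coord_point [OF gx(1), of b] by simp
  qed
qed

lemma point_coord_nonzero:
  assumes "x \<in> chart_image \<sigma>" "b \<in> bas \<sigma> - gens \<sigma>"
  shows "point_coord \<sigma> x b \<noteq> 0"
proof -
  obtain \<phi> where "\<phi> \<in> chart_points N \<sigma>" "x = point \<sigma> \<phi>" using assms by (auto simp: chart_image_def)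
  then show ?thesis using coords_nonzero_off_gens [OF \<sigma> _ assms(2)] point_coord_point by simp
qed

lemma coord_point_point_coord:
  assumes "x \<in> chart_image \<sigma>"
  shows "coord_point \<sigma> (point_coord \<sigma> x) = x"
proof -
  obtain \<phi> where \<phi>: "\<phi> \<in> chart_points N \<sigma>" "x = point \<sigma> \<phi>" using assms by (auto simp: chart_image_def)
  then have "point_coord \<sigma> x = (\<lambda>b. \<phi> (coord (bas \<sigma>) b))"
    using point_coord_point by (intro ext) simp
  then show ?thesis
    using chart_point_eq_monomial_point [OF bas_gens [OF \<sigma>] \<phi>(1)] \<phi>(2) by (simp add: coord_point_def)
qed

lemma coord_point:
  assumes "\<forall>b\<in>bas \<sigma> - gens \<sigma>. x b \<noteq> 0"
  shows "coord_point \<sigma> x \<in> chart_image \<sigma>" "b \<in> bas \<sigma> \<Longrightarrow> point_coord \<sigma> (coord_point \<sigma> x) b = x b"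
proof -
  have m: "monomial_point N (bas \<sigma>) \<sigma> x \<in> chart_points N \<sigma>"
    by (rule monomial_point_in_chart [OF bas_gens [OF \<sigma>] assms])
  then show "coord_point \<sigma> x \<in> chart_image \<sigma>" by (simp add: coord_point_def chart_image_def)
  show "point_coord \<sigma> (coord_point \<sigma> x) b = x b" if "b \<in> bas \<sigma>"
    unfolding coord_point_def point_coord_point [OF m]
    by (rule monomial_point_coord [OF bas_gens [OF \<sigma>] that])
qed

lemma continuous_coord_point:
  assumes "\<And>b. b \<in> bas \<sigma> \<Longrightarrow> continuous_map Y euclideanreal (\<lambda>k. x k b)"
    and "\<And>k b. k \<in> topspace Y \<Longrightarrow> b \<in> bas \<sigma> - gens \<sigma> \<Longrightarrow> x k b \<noteq> 0"
  shows "continuous_map Y (subtopology X (chart_image \<sigma>)) (\<lambda>k. coord_point \<sigma> (x k))"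
proof -
  have "continuous_map Y X (point \<sigma> \<circ> (\<lambda>k. monomial_point N (bas \<sigma>) \<sigma> (x k)))"
    by (rule continuous_map_compose [OF continuous_map_monomial_point [OF bas_gens [OF \<sigma>] assms] continuous_point [OF \<sigma>]])
  moreover have "coord_point \<sigma> (x k) \<in> chart_image \<sigma>" if "k \<in> topspace Y" for k
    using assms(2) [OF that] by (intro coord_point) blast
  ultimately show ?thesis
    unfolding continuous_map_in_subtopology by (auto simp: coord_point_def comp_def)
qed

end

end

section \<open>Paths in the charts\<close>

lemma convex_combination_same_sign:
  fixes a c :: real
  assumes "0 < a * c" "0 \<le> r" "r \<le> 1"
  shows "(1 - r) * a + r * c \<noteq> 0"
proof -
  have "0 < ((1 - r) * a + r * c) * a"
  proof -
    have "((1 - r) * a + r * c) * a = (1 - r) * a\<^sup>2 + r * (a * c)"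
      by (simp add: algebra_simps power2_eq_square)
    moreover have "0 < (1 - r) * a\<^sup>2 + r * (a * c)"
    proof (cases "r = 0")
      case True
      then show ?thesis using assms(1) by auto
    next
      case False
      then have "0 < r * (a * c)" "0 \<le> (1 - r) * a\<^sup>2" using assms by simp_all
      then show ?thesis by linarith
    qed
    ultimately show ?thesis by simp
  qed
  then show ?thesis by auto
qed

lemma nonvanishing_same_sign:
  fixes f :: "real \<Rightarrow> real"
  assumes f: "continuous_on {0..1} f" "\<And>s. s \<in> {0..1} \<Longrightarrow> f s \<noteq> 0" and s: "s \<in> {0..1}"
  shows "0 < f 0 * f s"
proof (rule ccontr)
  assume "\<not> 0 < f 0 * f s"
  moreover have "f 0 \<noteq> 0" "f s \<noteq> 0" using f(2) s by auto
  ultimately have "f 0 < 0 \<and> 0 < f s \<or> 0 < f 0 \<and> f s < 0"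
    by (metis linorder_neqE_linordered_idom mult_neg_neg mult_pos_pos)
  moreover have c: "continuous_on {0..s} f" using f(1) continuous_on_subset s by fastforce
  ultimately obtain r where "0 \<le> r" "r \<le> s" "f r = 0"
    using IVT' [of f 0 0 s] IVT2' [of f s 0 0] s by fastforce
  then show False using f(2) s by auto
qed

context smooth_fan_locale
begin

text \<open>Fixing the signs of the nonvanishing coordinates cuts the chart into convex pieces in
  coordinates, so a straight segment does not leave the chart.\<close>

lemma linear_path:
  assumes \<sigma>: "\<sigma> \<in> \<Delta>" and xy: "x \<in> chart_image \<sigma>" "y \<in> chart_image \<sigma>"
    and sign: "\<And>b. b \<in> bas \<sigma> - gens \<sigma> \<Longrightarrow> 0 < point_coord \<sigma> x b * point_coord \<sigma> y b"
  shows "path_component_of (subtopology X (chart_image \<sigma>)) x y"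
  unfolding path_component_of_def
proof (intro exI conjI)
  let ?p = "\<lambda>s::real. coord_point \<sigma> (\<lambda>b. (1 - s) * point_coord \<sigma> x b + s * point_coord \<sigma> y b)"
  show "pathin (subtopology X (chart_image \<sigma>)) ?p"
    unfolding pathin_def
  proof (rule continuous_coord_point [OF \<sigma>])
    show "continuous_map (top_of_set {0..1}) euclideanreal
      (\<lambda>s. (1 - s) * point_coord \<sigma> x b + s * point_coord \<sigma> y b)" for b
      by (simp, intro continuous_intros)
  qed (use convex_combination_same_sign [OF sign] in auto)
  show "?p 0 = x" "?p 1 = y"
    using coord_point_point_coord [OF \<sigma>] xy by simp_all
qed

text \<open>The neighbourhood is the whole sign piece of \<open>x\<close>, open as a finite
  intersection of sign conditions.\<close>

lemma chart_locally_connected: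
  assumes \<sigma>: "\<sigma> \<in> \<Delta>" and x: "x \<in> chart_image \<sigma>"
  shows "\<exists>V. openin X V \<and> x \<in> V \<and> (\<forall>y\<in>V. path_component_of (subtopology X (chart_image \<sigma>)) x y)"
proof -
  let ?R = "bas \<sigma> - gens \<sigma>" and ?Y = "subtopology X (chart_image \<sigma>)"
  have top: "topspace ?Y = chart_image \<sigma>"
    using openin_subset [OF chart_image_open [OF \<sigma>]] by auto
  define V where "V b = {y \<in> topspace ?Y. point_coord \<sigma> x b * point_coord \<sigma> y b \<in> {0<..}}" for b
  have V: "openin ?Y (V b)" if "b \<in> ?R" for b
    unfolding V_def
    using continuous_point_coord [OF \<sigma>, of b] that
    by (intro openin_continuous_map_preimage [where Y = euclideanreal] continuous_map_real_mult_left) auto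
  have fin: "finite ?R" using lattice_basisD(1) [OF bas_gens(1) [OF \<sigma>]] by blast
  have "openin ?Y (topspace ?Y \<inter> (\<Inter>b\<in>?R. V b))"
  proof (cases "?R = {}")
    case True
    show ?thesis unfolding True using openin_topspace [of ?Y] by simp
  next
    case False
    have "openin ?Y (\<Inter>b\<in>?R. V b)" using fin V False by (intro openin_Inter) auto
    then show ?thesis by (intro openin_Int openin_topspace)
  qed
  then have "openin X (topspace ?Y \<inter> (\<Inter>b\<in>?R. V b))"
    by (rule openin_trans_full [OF _ chart_image_open [OF \<sigma>]])
  moreover have "x \<in> topspace ?Y \<inter> (\<Inter>b\<in>?R. V b)"
    using x point_coord_nonzero [OF \<sigma> x] unfolding top V_def by (auto simp: zero_less_mult_iff linorder_neq_iff)
  moreover have "path_component_of ?Y x y" if "y \<in> topspace ?Y \<inter> (\<Inter>b\<in>?R. V b)" for y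
    using that unfolding top V_def by (intro linear_path [OF \<sigma> x]) auto
  ultimately show ?thesis by blast
qed

lemma chart_path_same_sign:
  assumes \<sigma>: "\<sigma> \<in> \<Delta>" and p: "pathin (subtopology X (chart_image \<sigma>)) p"
    and b: "b \<in> bas \<sigma> - gens \<sigma>" and s: "s \<in> {0..1}"
  shows "0 < point_coord \<sigma> (p 0) b * point_coord \<sigma> (p s) b"
proof (rule nonvanishing_same_sign [OF _ _ s])
  have "continuous_map (top_of_set {0..1}) euclideanreal ((\<lambda>x. point_coord \<sigma> x b) \<circ> p)"
    using b by (intro continuous_map_compose [OF p [unfolded pathin_def] continuous_point_coord [OF \<sigma>]]) blast
  then show "continuous_on {0..1} (\<lambda>s. point_coord \<sigma> (p s) b)"
    by (simp add: comp_def)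
  show "point_coord \<sigma> (p s) b \<noteq> 0" if "s \<in> {0..1}" for s
    using p that by (intro point_coord_nonzero [OF \<sigma> _ b]) (simp add: pathin_subtopology)
qed

text \<open>The coordinates off the generators keep their signs along the loop, so the straight-line
  contraction to \<open>p 0\<close> never makes them vanish. The ends stay fixed because both equal
  \<open>p 0\<close>.\<close>

lemma chart_loops_contract:
  assumes \<sigma>: "\<sigma> \<in> \<Delta>" and p: "pathin (subtopology X (chart_image \<sigma>)) p" and loop: "p 1 = p 0"
  shows "path_homotopic X p (\<lambda>_. p 0)"
  unfolding path_homotopic_def
proof (intro exI conjI ballI)
  let ?h = "\<lambda>k::real \<times> real. coord_point \<sigma>
    (\<lambda>b. (1 - fst k) * point_coord \<sigma> (p (snd k)) b + fst k * point_coord \<sigma> (p 0) b)"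
  have pU: "p s \<in> chart_image \<sigma>" if "s \<in> {0..1}" for s
    using p that by (simp add: pathin_subtopology)
  have "continuous_map (top_of_set unit_square) (subtopology X (chart_image \<sigma>)) ?h"
  proof (rule continuous_coord_point [OF \<sigma>])
    fix b assume b: "b \<in> bas \<sigma>"
    have "continuous_map (top_of_set {0..1}) euclideanreal ((\<lambda>x. point_coord \<sigma> x b) \<circ> p)"
      by (rule continuous_map_compose [OF p [unfolded pathin_def] continuous_point_coord [OF \<sigma> b]])
    then have c: "continuous_on {0..1} (\<lambda>s. point_coord \<sigma> (p s) b)" by (simp add: comp_def)
    have "continuous_on unit_square (\<lambda>k. point_coord \<sigma> (p (snd k)) b)"
      by (rule continuous_on_compose2 [OF c]) (auto intro!: continuous_intros)
    then show "continuous_map (top_of_set unit_square) euclideanreal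
       (\<lambda>k. (1 - fst k) * point_coord \<sigma> (p (snd k)) b + fst k * point_coord \<sigma> (p 0) b)"
      by (simp, intro continuous_intros)
  next
    fix k b assume k: "k \<in> topspace (top_of_set unit_square)" and b: "b \<in> bas \<sigma> - gens \<sigma>"
    then have "snd k \<in> {0..1}" "0 \<le> fst k" "fst k \<le> 1" by auto
    then show "(1 - fst k) * point_coord \<sigma> (p (snd k)) b + fst k * point_coord \<sigma> (p 0) b \<noteq> 0"
      using chart_path_same_sign [OF \<sigma> p b, of "snd k"]
      by (intro convex_combination_same_sign) (simp_all add: mult.commute)
  qed
  then show "continuous_map (top_of_set unit_square) X ?h"
    by (rule continuous_map_into_fulltopology)
  show "?h (0, s) = p s" "?h (1, s) = p 0" if "s \<in> {0..1}" for s
    using coord_point_point_coord [OF \<sigma> pU] that by simp_all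
  show "?h (r, 0) = p 0" "?h (r, 1) = p 1" if "r \<in> {0..1}" for r
  proof -
    have "(1 - r) * z + r * z = z" for z :: real by (simp add: algebra_simps)
    then show "?h (r, 0) = p 0" "?h (r, 1) = p 1"
      using coord_point_point_coord [OF \<sigma> pU] by (simp_all add: loop)
  qed
qed

end

section \<open>Base points of the components of the torus\<close>

lemma of_int_bit_eq_0_iff: "(of_int k :: bit) = 0 \<longleftrightarrow> even k"
proof (cases "even k")
  case True
  then obtain m where "k = 2 * m" by blast
  then show ?thesis by simp
next
  case False
  then obtain m where "k = 2 * m + 1" by (elim oddE)
  then show ?thesis by simp
qed

lemma bit_add_self: "x + x = (0 :: bit)"
  by (cases x) simp_all

lemma bit_add_eq_0_iff: "x + y = 0 \<longleftrightarrow> x = (y :: bit)"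
  by (cases x; cases y) simp_all

context
  fixes N :: "'a::real_vector set" and B
  assumes B: "lattice_basis N B"
begin

lemma pairing2_add:
  assumes "f \<in> dual_lattice N" "x \<in> N" "y \<in> N"
  shows "pairing2 f (x + y) = pairing2 f x + pairing2 f y"
proof -
  obtain k l where "f x = of_int k" "f y = of_int l"
    using dual_latticeD(2) [OF assms(1)] assms(2,3) Ints_cases by metis
  then show ?thesis
    using linear_add [OF dual_latticeD(1) [OF assms(1)], of x y]
    by (simp add: pairing2_def flip: of_int_add del: add_bit_eq_xor)
qed

lemma pairing2_scale:
  assumes "f \<in> dual_lattice N" "x \<in> N"
  shows "pairing2 f (of_int k *\<^sub>R x) = of_int k * pairing2 f x"
proof -
  obtain l where "f x = of_int l"
    using dual_latticeD(2) [OF assms] Ints_cases by metis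
  then show ?thesis
    using linear_scale [OF dual_latticeD(1) [OF assms(1)], of "of_int k" x]
    by (simp add: pairing2_def flip: of_int_mult del: mult_bit_eq_and)
qed

lemma pairing2_zero:
  assumes "f \<in> dual_lattice N"
  shows "pairing2 f 0 = 0"
  using linear_0 [OF dual_latticeD(1) [OF assms]] by (simp add: pairing2_def)

lemma pairing2_diff:
  assumes f: "f \<in> dual_lattice N" and xy: "x \<in> N" "y \<in> N"
  shows "pairing2 f (x - y) = pairing2 f x + pairing2 f y"
proof -
  have "pairing2 f (x - y) + pairing2 f y = pairing2 f x"
    using pairing2_add [OF f lattice_diff [OF B xy] xy(2)] by simp
  then show ?thesis by (metis add.assoc add.right_neutral bit_add_self)
qed

lemma pairing2_sum:
  assumes f: "f \<in> dual_lattice N"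
  shows "(\<And>i. i \<in> I \<Longrightarrow> g i \<in> N) \<Longrightarrow> pairing2 f (sum g I) = (\<Sum>i\<in>I. pairing2 f (g i))"
proof (induction I rule: infinite_finite_induct)
  case (insert i I)
  then show ?case
    using pairing2_add [OF f, of "g i" "sum g I"] lattice_sum [OF B, of I g]
    by (simp del: add_bit_eq_xor)
qed (simp_all add: pairing2_zero [OF f])

lemma pairing2_double:
  assumes "f \<in> dual_lattice N" "x \<in> (\<lambda>w. 2 *\<^sub>R w) ` N"
  shows "pairing2 f x = 0"
proof -
  obtain y where "y \<in> N" "x = of_int 2 *\<^sub>R y" using assms(2) by auto
  then show ?thesis using pairing2_scale [OF assms(1), of y 2] by simp
qed

lemma double_lattice_iff_pairing2:
  "x \<in> N \<Longrightarrow> x \<in> (\<lambda>w. 2 *\<^sub>R w) ` N \<longleftrightarrow> (\<forall>b\<in>B. pairing2 (coord B b) x = 0)"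
  unfolding double_lattice_iff [OF B] pairing2_def of_int_bit_eq_0_iff ..

end

definition bit_sign :: "bit \<Rightarrow> real" where
  "bit_sign z = (if z = 0 then 1 else - 1)"

lemma bit_sign_add: "bit_sign (x + y) = bit_sign x * bit_sign y"
  by (cases x; cases y) (simp_all add: bit_sign_def)

lemma bit_sign_mult_pos_iff: "0 < bit_sign x * bit_sign y \<longleftrightarrow> x = y"
  by (cases x; cases y) (simp_all add: bit_sign_def)

context smooth_fan_locale
begin

text \<open>The class of \<open>\<nu>\<close> in \<open>N / 2N\<close> determines the \<open>2\<close>-torsion point \<open>w \<mapsto> (-1)\<^bsup>w(\<nu>)\<^esup>\<close> of the
  torus \<open>Hom(M, \<real>\<^sup>*)\<close>, the chart of the zero cone.\<close>

definition base_hom :: "'a set \<Rightarrow> 'a \<Rightarrow> ('a \<Rightarrow> real) \<Rightarrow> real" where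
  "base_hom \<sigma> \<nu> = (\<lambda>w\<in>dual_semigroup N \<sigma>. bit_sign (pairing2 w \<nu>))"

text \<open>Defined in the chart of the zero cone, which lies in every other chart, so no cone has
  to be chosen.\<close>

definition base_point :: "'a \<Rightarrow> ('a set \<times> (('a \<Rightarrow> real) \<Rightarrow> real)) set" where
  "base_point \<nu> = point {0} (base_hom {0} \<nu>)"

lemma base_hom_in_chart:
  assumes \<nu>: "\<nu> \<in> N"
  shows "base_hom \<sigma> \<nu> \<in> chart_points N \<sigma>"
  unfolding chart_points_iff
proof (intro conjI ballI)
  show "base_hom \<sigma> \<nu> \<in> extensional (dual_semigroup N \<sigma>)" by (simp add: base_hom_def)
  show "base_hom \<sigma> \<nu> (\<lambda>_. 0) = 1"
    by (simp add: base_hom_def dual_semigroup_zero pairing2_def bit_sign_def)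
  fix u w assume u: "u \<in> dual_semigroup N \<sigma>" and w: "w \<in> dual_semigroup N \<sigma>"
  obtain k l where "u \<nu> = of_int k" "w \<nu> = of_int l"
    using dual_semigroupD(2) [OF u \<nu>] dual_semigroupD(2) [OF w \<nu>] Ints_cases by metis
  then have "pairing2 (\<lambda>z. u z + w z) \<nu> = pairing2 u \<nu> + pairing2 w \<nu>"
    by (simp add: pairing2_def flip: of_int_add del: add_bit_eq_xor)
  then show "base_hom \<sigma> \<nu> (\<lambda>z. u z + w z) = base_hom \<sigma> \<nu> u * base_hom \<sigma> \<nu> w"
    by (simp add: base_hom_def u w dual_semigroup_add bit_sign_add del: add_bit_eq_xor)
qed

lemma base_point_in_chart:
  assumes \<sigma>: "\<sigma> \<in> \<Delta>" and \<nu>: "\<nu> \<in> N"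
  shows "base_point \<nu> = point \<sigma> (base_hom \<sigma> \<nu>)" "base_point \<nu> \<in> chart_image \<sigma>"
proof -
  have "dual_semigroup N \<sigma> \<subseteq> dual_semigroup N {0}"
    by (rule dual_semigroup_mono [OF zero_cone_in_fan(2) [OF \<sigma>]])
  then have "restrict (base_hom {0} \<nu>) (dual_semigroup N \<sigma>) = base_hom \<sigma> \<nu>"
    by (intro ext) (auto simp: base_hom_def)
  then show "base_point \<nu> = point \<sigma> (base_hom \<sigma> \<nu>)"
    unfolding base_point_def
    using chart_image_mono(2) [OF \<sigma> zero_cone_in_fan [OF \<sigma>] base_hom_in_chart [OF \<nu>]] by simp
  then show "base_point \<nu> \<in> chart_image \<sigma>"
    using base_hom_in_chart [OF \<nu>] by (auto simp: chart_image_def)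
qed

lemma point_coord_base_point:
  assumes \<sigma>: "\<sigma> \<in> \<Delta>" and \<nu>: "\<nu> \<in> N" and b: "b \<in> bas \<sigma>"
  shows "point_coord \<sigma> (base_point \<nu>) b = bit_sign (pairing2 (coord (bas \<sigma>) b) \<nu>)"
  unfolding base_point_in_chart(1) [OF \<sigma> \<nu>] point_coord_point [OF \<sigma> base_hom_in_chart [OF \<nu>]]
  using coord_in_dual_semigroup [OF bas_gens [OF \<sigma>] b] by (simp add: base_hom_def)

lemma base_point_cong:
  assumes "\<And>w. w \<in> dual_lattice N \<Longrightarrow> pairing2 w \<nu> = pairing2 w \<nu>'"
  shows "base_point \<nu> = base_point \<nu>'"
proof -
  have "base_hom {0} \<nu> = base_hom {0} \<nu>'"
    unfolding base_hom_def using assms by (auto simp: dual_semigroup_def intro!: restrict_ext)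
  then show ?thesis by (simp add: base_point_def)
qed

text \<open>The components of a chart are separated by the signs of the coordinates off the
  generators, and at base points these signs are parities. Thus the components are classified by the
  lattice modulo twice the lattice and the generators of the cone.\<close>

lemma linked_base_points:
  assumes \<sigma>: "\<sigma> \<in> \<Delta>" and \<nu>: "\<nu> \<in> N" "\<nu>' \<in> N"
  shows "path_component_of (subtopology X (chart_image \<sigma>)) (base_point \<nu>) (base_point \<nu>') \<longleftrightarrow>
    (\<forall>b\<in>bas \<sigma> - gens \<sigma>. pairing2 (coord (bas \<sigma>) b) \<nu> = pairing2 (coord (bas \<sigma>) b) \<nu>')" (is "?L \<longleftrightarrow> ?R")
proof
  assume ?L
  then obtain p where p: "pathin (subtopology X (chart_image \<sigma>)) p" "p 0 = base_point \<nu>" "p 1 = base_point \<nu>'"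
    unfolding path_component_of_def by blast
  show ?R
  proof
    fix b assume b: "b \<in> bas \<sigma> - gens \<sigma>"
    then show "pairing2 (coord (bas \<sigma>) b) \<nu> = pairing2 (coord (bas \<sigma>) b) \<nu>'"
      using chart_path_same_sign [OF \<sigma> p(1) b, of 1] p(2,3) point_coord_base_point [OF \<sigma>] \<nu>
      by (simp add: bit_sign_mult_pos_iff)
  qed
next
  assume R: ?R
  show ?L
  proof (rule linear_path [OF \<sigma> base_point_in_chart(2) [OF \<sigma> \<nu>(1)] base_point_in_chart(2) [OF \<sigma> \<nu>(2)]])
    fix b assume "b \<in> bas \<sigma> - gens \<sigma>"
    then show "0 < point_coord \<sigma> (base_point \<nu>) b * point_coord \<sigma> (base_point \<nu>') b"
      using R point_coord_base_point [OF \<sigma>] \<nu> by (simp add: bit_sign_mult_pos_iff)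
  qed
qed

text \<open>The lattice vector gets coefficient 1 exactly where the coordinate of \<open>x\<close>
  is negative, so that the signs of its base point match those of \<open>x\<close>.\<close>

lemma reach_base_point:
  assumes \<sigma>: "\<sigma> \<in> \<Delta>" and x: "x \<in> chart_image \<sigma>"
  shows "\<exists>\<nu>\<in>N. path_component_of (subtopology X (chart_image \<sigma>)) x (base_point \<nu>)"
proof -
  let ?B = "bas \<sigma>"
  note B = bas_gens(1) [OF \<sigma>]
  define c :: "'a \<Rightarrow> int" where "c b = (if point_coord \<sigma> x b < 0 then 1 else 0)" for b
  define \<nu> where "\<nu> = (\<Sum>b\<in>?B. of_int (c b) *\<^sub>R b)"
  have \<nu>: "\<nu> \<in> N" unfolding \<nu>_def
    by (rule lattice_sum [OF B lattice_scale [OF B basis_in_lattice [OF B]]])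
  have "path_component_of (subtopology X (chart_image \<sigma>)) x (base_point \<nu>)"
  proof (rule linear_path [OF \<sigma> x base_point_in_chart(2) [OF \<sigma> \<nu>]])
    fix b assume b: "b \<in> ?B - gens \<sigma>"
    have "coord ?B b \<nu> = of_int (c b)" using b coord_sum [OF B] by (simp add: \<nu>_def)
    then have "point_coord \<sigma> (base_point \<nu>) b = (if point_coord \<sigma> x b < 0 then - 1 else 1)"
      using b point_coord_base_point [OF \<sigma> \<nu>, of b] by (simp add: pairing2_def c_def bit_sign_def)
    then show "0 < point_coord \<sigma> x b * point_coord \<sigma> (base_point \<nu>) b"
      using point_coord_nonzero [OF \<sigma> x b] by simp
  qed
  then show ?thesis using \<nu> by blast
qed

end

section \<open>The presentation\<close>

locale numbered_smooth_fan = smooth_fan_locale N \<Delta>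
  for N :: "'a::real_vector set" and \<Delta> :: "'a set set" +
  fixes n d :: nat and v :: "nat \<Rightarrow> 'a" and u :: "nat \<Rightarrow> 'a \<Rightarrow> real"
  assumes rank: "lattice_of_rank n N"
    and edges: "bij_betw v {1..d} (edge_vectors N \<Delta>)"
    and n_le_d: "n \<le> d"
    and basis: "mod2_basis N n v"
    and dual: "mod2_dual_basis N n v u"
begin

abbreviation T :: "(nat \<Rightarrow> bit) set" where "T \<equiv> Z2_vectors n"

text \<open>Translation by the class of \<open>v j\<close> modulo 2, written in the dual
  basis.\<close>

definition cross :: "nat \<Rightarrow> (nat \<Rightarrow> bit) \<Rightarrow> nat \<Rightarrow> bit" where
  "cross j t = (\<lambda>i\<in>{1..n}. t i + pairing2 (u i) (v j))"

text \<open>The representative of the class \<open>t\<close> in the lattice with coefficients 0 and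
  1 in the chosen basis modulo 2.\<close>

definition \<nu> :: "(nat \<Rightarrow> bit) \<Rightarrow> 'a" where
  "\<nu> t = (\<Sum>i=1..n. of_int (if t i = 1 then 1 else 0) *\<^sub>R v i)"

definition e :: "(nat \<Rightarrow> bit) \<Rightarrow> ('a set \<times> (('a \<Rightarrow> real) \<Rightarrow> real)) set" where
  "e t = base_point (\<nu> t)"

definition J :: "'a set \<Rightarrow> nat set" where
  "J \<sigma> = {j \<in> {1..d}. v j \<in> \<sigma>}"

definition base_labels :: "(nat \<Rightarrow> bit) \<Rightarrow> nat list" where
  "base_labels t = filter (\<lambda>k. t k = 1) [1..<Suc n]"

definition origin :: "nat \<Rightarrow> bit" where
  "origin = (\<lambda>i\<in>{1..n}. 0)"

section \<open>Coordinates modulo 2\<close>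

lemma lattice_basis_exists: obtains B where "lattice_basis N B"
  using rank unfolding lattice_of_rank_def by blast

lemma v_edge: "j \<in> {1..d} \<Longrightarrow> v j \<in> edge_vectors N \<Delta>"
  using bij_betw_apply [OF edges] .

lemma v_inj: "\<lbrakk>i \<in> {1..d}; j \<in> {1..d}; v i = v j\<rbrakk> \<Longrightarrow> i = j"
  by (rule inj_onD [OF bij_betw_imp_inj_on [OF edges]])

lemma v_in_lattice: "j \<in> {1..d} \<Longrightarrow> v j \<in> N"
  using v_edge [of j] by (simp add: edge_vectors_def primitive_vector_def)

lemma v_in_gens: "\<sigma> \<in> \<Delta> \<Longrightarrow> j \<in> J \<sigma> \<Longrightarrow> v j \<in> gens \<sigma>"
  using edge_vectors_in_cone [of \<sigma>] v_edge [of j] by (auto simp: J_def)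

lemma gens_eq_v:
  assumes "\<sigma> \<in> \<Delta>" "b \<in> gens \<sigma>"
  obtains j where "j \<in> J \<sigma>" "b = v j"
proof -
  have b: "b \<in> edge_vectors N \<Delta>" "b \<in> \<sigma>" using edge_vectors_in_cone [OF assms(1)] assms(2) by blast+
  then have "b \<in> v ` {1..d}" using edges by (simp add: bij_betw_def)
  then obtain j where "j \<in> {1..d}" "b = v j" by blast
  then show ?thesis using that [of j] b(2) by (simp add: J_def)
qed

lemma u_dual: "i \<in> {1..n} \<Longrightarrow> u i \<in> dual_lattice N"
  using dual by (simp add: mod2_dual_basis_def)

lemma pairing2_u_v: "i \<in> {1..n} \<Longrightarrow> j \<in> {1..n} \<Longrightarrow> pairing2 (u i) (v j) = (if i = j then 1 else 0)"
  using dual by (simp add: mod2_dual_basis_def)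

lemma pairing2_combination:
  assumes i: "i \<in> {1..n}"
  shows "pairing2 (u i) (\<Sum>j=1..n. of_int (c j) *\<^sub>R v j) = of_int (c i)"
proof -
  obtain B where B: "lattice_basis N B" by (rule lattice_basis_exists)
  have vN: "v j \<in> N" if "j \<in> {1..n}" for j using v_in_lattice that n_le_d by auto
  have "pairing2 (u i) (\<Sum>j=1..n. of_int (c j) *\<^sub>R v j) = (\<Sum>j=1..n. pairing2 (u i) (of_int (c j) *\<^sub>R v j))"
    by (rule pairing2_sum [OF B u_dual [OF i]]) (rule lattice_scale [OF B vN])
  also have "\<dots> = (\<Sum>j=1..n. if j = i then of_int (c i) else 0)"
    by (rule sum.cong) (auto simp: pairing2_scale [OF B u_dual [OF i] vN] pairing2_u_v [OF i] simp del: mult_bit_eq_and)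
  also have "\<dots> = of_int (c i)" using i by simp
  finally show ?thesis .
qed

text \<open>Modulo 2 the vector is a combination of the \<open>v i\<close>, and the dual basis reads
  off its coefficients. If all of them are even, the combination is itself a double.\<close>

lemma double_lattice_criterion:
  assumes z: "z \<in> N" and u0: "\<And>i. i \<in> {1..n} \<Longrightarrow> pairing2 (u i) z = 0"
  shows "z \<in> (\<lambda>w. 2 *\<^sub>R w) ` N"
proof -
  obtain B where B: "lattice_basis N B" by (rule lattice_basis_exists)
  have vN: "v j \<in> N" if "j \<in> {1..n}" for j using v_in_lattice that n_le_d by auto
  obtain c :: "nat \<Rightarrow> int" where c: "z - (\<Sum>i=1..n. of_int (c i) *\<^sub>R v i) \<in> (\<lambda>w. 2 *\<^sub>R w) ` N"
    using basis z unfolding mod2_basis_def by blast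
  have sN: "(\<Sum>i=1..n. of_int (c i) *\<^sub>R v i) \<in> N"
    by (rule lattice_sum [OF B]) (rule lattice_scale [OF B vN])
  have even: "even (c i)" if i: "i \<in> {1..n}" for i
  proof -
    have "0 = pairing2 (u i) (z - (\<Sum>i=1..n. of_int (c i) *\<^sub>R v i))"
      using pairing2_double [OF B u_dual [OF i] c] by simp
    also have "\<dots> = of_int (c i)"
      unfolding pairing2_diff [OF B u_dual [OF i] z sN] u0 [OF i] pairing2_combination [OF i] by simp
    finally show ?thesis using of_int_bit_eq_0_iff by metis
  qed
  have "(\<Sum>i=1..n. of_int (c i) *\<^sub>R v i) = (\<Sum>i=1..n. 2 *\<^sub>R (of_int (c i div 2) *\<^sub>R v i))"
  proof (rule sum.cong [OF refl])
    fix i assume "i \<in> {1..n}"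
    then have "c i = 2 * (c i div 2)" using even by simp
    then have "real_of_int (c i) = 2 * of_int (c i div 2)" by (metis of_int_mult of_int_numeral)
    then show "of_int (c i) *\<^sub>R v i = 2 *\<^sub>R (of_int (c i div 2) *\<^sub>R v i)" by simp
  qed
  also have "\<dots> = 2 *\<^sub>R (\<Sum>i=1..n. of_int (c i div 2) *\<^sub>R v i)"
    by (rule scaleR_sum_right [symmetric])
  finally have s: "(\<Sum>i=1..n. of_int (c i) *\<^sub>R v i) = 2 *\<^sub>R (\<Sum>i=1..n. of_int (c i div 2) *\<^sub>R v i)" .
  have s'N: "(\<Sum>i=1..n. of_int (c i div 2) *\<^sub>R v i) \<in> N"
    by (rule lattice_sum [OF B]) (rule lattice_scale [OF B vN])
  obtain y where y: "y \<in> N" "z - (\<Sum>i=1..n. of_int (c i) *\<^sub>R v i) = 2 *\<^sub>R y" using c by blast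
  have "z = 2 *\<^sub>R (y + (\<Sum>i=1..n. of_int (c i div 2) *\<^sub>R v i))"
    using y(2) s by (simp add: scaleR_add_right algebra_simps)
  then show ?thesis using lattice_add [OF B y(1) s'N] by blast
qed

lemma pairing2_cong:
  assumes xy: "x \<in> N" "y \<in> N" and eq: "\<And>i. i \<in> {1..n} \<Longrightarrow> pairing2 (u i) x = pairing2 (u i) y"
    and f: "f \<in> dual_lattice N"
  shows "pairing2 f x = pairing2 f y"
proof -
  obtain B where B: "lattice_basis N B" by (rule lattice_basis_exists)
  have "x - y \<in> (\<lambda>w. 2 *\<^sub>R w) ` N"
  proof (rule double_lattice_criterion [OF lattice_diff [OF B xy]])
    fix i assume i: "i \<in> {1..n}"
    show "pairing2 (u i) (x - y) = 0"
      unfolding pairing2_diff [OF B u_dual [OF i] xy] bit_add_eq_0_iff by (rule eq [OF i])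
  qed
  from pairing2_double [OF B f this] show ?thesis
    unfolding pairing2_diff [OF B f xy] bit_add_eq_0_iff .
qed

lemma \<nu>_in_lattice: "\<nu> t \<in> N"
proof -
  obtain B where B: "lattice_basis N B" by (rule lattice_basis_exists)
  have vN: "v j \<in> N" if "j \<in> {1..n}" for j using v_in_lattice that n_le_d by auto
  show ?thesis
    unfolding \<nu>_def by (rule lattice_sum [OF B]) (rule lattice_scale [OF B vN])
qed

lemma pairing2_\<nu>: "i \<in> {1..n} \<Longrightarrow> pairing2 (u i) (\<nu> t) = t i"
  unfolding \<nu>_def pairing2_combination by (cases "t i") simp_all

lemma T_eqI:
  assumes "t \<in> T" "t' \<in> T" "\<And>f. f \<in> dual_lattice N \<Longrightarrow> pairing2 f (\<nu> t) = pairing2 f (\<nu> t')"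
  shows "t = t'"
  using assms(1,2)
proof (rule PiE_ext)
  fix i assume i: "i \<in> {1..n}"
  then show "t i = t' i" using assms(3) [OF u_dual [OF i]] pairing2_\<nu> [OF i] by simp
qed

lemma pairing2_cross:
  assumes j: "j \<in> {1..d}" and f: "f \<in> dual_lattice N"
  shows "pairing2 f (\<nu> (cross j t)) = pairing2 f (\<nu> t) + pairing2 f (v j)"
proof -
  obtain B where B: "lattice_basis N B" by (rule lattice_basis_exists)
  have vj: "v j \<in> N" using v_in_lattice j .
  have "pairing2 f (\<nu> (cross j t)) = pairing2 f (\<nu> t + v j)"
  proof (rule pairing2_cong [OF \<nu>_in_lattice lattice_add [OF B \<nu>_in_lattice vj] _ f])
    fix i assume i: "i \<in> {1..n}"
    show "pairing2 (u i) (\<nu> (cross j t)) = pairing2 (u i) (\<nu> t + v j)"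
      unfolding pairing2_add [OF B u_dual [OF i] \<nu>_in_lattice vj] pairing2_\<nu> [OF i]
      using i by (simp add: cross_def del: add_bit_eq_xor)
  qed
  then show ?thesis unfolding pairing2_add [OF B f \<nu>_in_lattice vj] .
qed

lemma pairing2_fold_cross:
  assumes f: "f \<in> dual_lattice N"
  shows "set js \<subseteq> {1..d} \<Longrightarrow> pairing2 f (\<nu> (fold cross js t)) = pairing2 f (\<nu> t) + (\<Sum>j\<leftarrow>js. pairing2 f (v j))"
proof (induction js arbitrary: t)
  case (Cons j js)
  then show ?case
    using pairing2_cross [OF _ f, of j t] by (simp add: add.assoc del: add_bit_eq_xor)
qed simp

lemma pairing2_coord_v:
  assumes \<sigma>: "\<sigma> \<in> \<Delta>" and j: "j \<in> J \<sigma>"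
  shows "pairing2 (coord (bas \<sigma>) b) (v j) = (if b = v j then 1 else 0)"
proof -
  have "v j \<in> bas \<sigma>" using v_in_gens [OF \<sigma> j] bas_gens(2) [OF \<sigma>] by blast
  then show ?thesis by (simp add: pairing2_def coord_basis [OF bas_gens(1) [OF \<sigma>]])
qed

text \<open>The generators of a smooth cone are distinct members of a lattice basis, so the
  coordinate at \<open>v j\<close> detects the label \<open>j\<close> and no other. This is the
  independence of the edges modulo 2.\<close>

lemma sum_coord_v:
  assumes \<sigma>: "\<sigma> \<in> \<Delta>" and js: "distinct js" "set js \<subseteq> J \<sigma>" and j: "j \<in> J \<sigma>"
  shows "(\<Sum>k\<leftarrow>js. pairing2 (coord (bas \<sigma>) (v j)) (v k)) = (if j \<in> set js then 1 else 0)"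
proof -
  have "(\<Sum>k\<leftarrow>js. pairing2 (coord (bas \<sigma>) (v j)) (v k)) = (\<Sum>k\<in>set js. pairing2 (coord (bas \<sigma>) (v j)) (v k))"
    by (rule sum_list_distinct_conv_sum_set [OF js(1)])
  also have "\<dots> = (\<Sum>k\<in>set js. if k = j then 1 else 0)"
  proof (rule sum.cong)
    fix k assume "k \<in> set js"
    then have k: "k \<in> J \<sigma>" using js by blast
    have "v j = v k \<longleftrightarrow> k = j" using v_inj [of j k] j k by (auto simp: J_def)
    then show "pairing2 (coord (bas \<sigma>) (v j)) (v k) = (if k = j then 1 else 0)"
      using pairing2_coord_v [OF \<sigma> k] by simp
  qed simp
  finally show ?thesis by simp
qed

section \<open>The fan as an atlas of charts\<close>

lemma cross_in_T: "cross j t \<in> T"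
  by (simp add: cross_def)

lemma fold_cross_in_T: "t \<in> T \<Longrightarrow> fold cross js t \<in> T"
proof (induction js arbitrary: t)
  case (Cons j js)
  show ?case using Cons.IH [OF cross_in_T] by simp
qed simp

text \<open>Vertex and word are proved together: the letter for label \<open>k\<close> is indexed by
  the vertex reached before crossing \<open>k\<close>, which is the truncation of \<open>t\<close>
  before \<open>k\<close>.\<close>

lemma fold_base_labels:
  assumes t: "t \<in> T"
  shows "m \<le> n \<Longrightarrow> fold cross (filter (\<lambda>k. t k = 1) [1..<Suc m]) origin = truncate_before n (Suc m) t \<and>
    map (\<lambda>s. (s, True)) (walk_edges cross origin (filter (\<lambda>k. t k = 1) [1..<Suc m])) =
    concat (map (\<lambda>k. if t k = 1 then [y_letter k (truncate_before n k t)] else []) [1..<Suc m])"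
proof (induction m)
  case 0
  show ?case by (auto simp: origin_def truncate_before_def intro!: restrict_ext)
next
  case (Suc m)
  then have IH: "fold cross (filter (\<lambda>k. t k = 1) [1..<Suc m]) origin = truncate_before n (Suc m) t"
    "map (\<lambda>s. (s, True)) (walk_edges cross origin (filter (\<lambda>k. t k = 1) [1..<Suc m])) =
     concat (map (\<lambda>k. if t k = 1 then [y_letter k (truncate_before n k t)] else []) [1..<Suc m])"
    by simp_all
  have m: "Suc m \<in> {1..n}" using Suc by simp
  have upt: "[1..<Suc (Suc m)] = [1..<Suc m] @ [Suc m]" by simp
  have walk: "walk_edges cross s (js @ [k]) = walk_edges cross s js @ [(k, fold cross js s)]" for js k s
    by (induction js arbitrary: s) auto
  show ?case
  proof (cases "t (Suc m) = 1")
    case True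
    \<comment> \<open>For labels up to \<open>n\<close> duality makes the crossing change the single
      coordinate of that number.\<close>
    have "cross (Suc m) (truncate_before n (Suc m) t) = truncate_before n (Suc (Suc m)) t"
      unfolding cross_def truncate_before_def
      using m True pairing2_u_v by (auto intro!: restrict_ext simp: less_Suc_eq)
    then show ?thesis
      unfolding upt using True IH by (simp add: walk y_letter_def del: upt_Suc)
  next
    case False
    then have "truncate_before n (Suc m) t = truncate_before n (Suc (Suc m)) t"
      unfolding truncate_before_def by (auto intro!: restrict_ext simp: less_Suc_eq)
    then show ?thesis unfolding upt using False IH by (simp del: upt_Suc)
  qed
qed

lemma truncate_all: "t \<in> T \<Longrightarrow> truncate_before n (Suc n) t = t"
  unfolding truncate_before_def by (auto simp: PiE_def extensional_def)

lemma base_word: "t \<in> T \<Longrightarrow> base_path_word n t = walk_word cross origin (base_labels t)"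
  using fold_base_labels [of t n] by (simp add: base_path_word_def base_labels_def del: upt_Suc)

lemma ray_in_fan:
  assumes j: "j \<in> {1..d}"
  shows "convex_cone hull {v j} \<in> \<Delta>" "v j \<in> convex_cone hull {v j}"
proof -
  obtain \<rho> where \<rho>: "\<rho> \<in> \<Delta>" "v j \<in> \<rho>" using v_edge [OF j] by (auto simp: edge_vectors_def)
  then have "v j \<in> gens \<rho>" using v_in_gens j by (auto simp: J_def)
  then show "convex_cone hull {v j} \<in> \<Delta>" using gens_subset_cone_in_fan [OF \<rho>(1), of "{v j}"] by simp
  show "v j \<in> convex_cone hull {v j}" by (simp add: hull_inc)
qed

sublocale atlas: chart_atlas "{1..d}" T cross X \<Delta> chart_image J e origin base_labels
proof unfold_locales
  show "cross j t \<in> T" for j t by (rule cross_in_T)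
  show "cross j (cross j t) = t" if "t \<in> T" for j t
  proof (rule PiE_ext [OF cross_in_T that])
    fix i assume "i \<in> {1..n}"
    then show "cross j (cross j t) i = t i"
      by (simp add: cross_def add.assoc bit_add_self del: add_bit_eq_xor)
  qed
  show "cross i (cross j t) = cross j (cross i t)" for i j t
    by (rule PiE_ext [OF cross_in_T cross_in_T])
      (simp add: cross_def ac_simps del: add_bit_eq_xor)
  show "openin X (chart_image \<sigma>)" if "\<sigma> \<in> \<Delta>" for \<sigma> using chart_image_open that .
  show "\<exists>\<tau>\<in>\<Delta>. x \<in> chart_image \<tau> \<and> (\<forall>\<sigma>\<in>\<Delta>. x \<in> chart_image \<sigma> \<longrightarrow> chart_image \<tau> \<subseteq> chart_image \<sigma> \<and> J \<tau> \<subseteq> J \<sigma>)"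
    if x: "x \<in> topspace X" for x
  proof -
    obtain \<tau> where \<tau>: "\<tau> \<in> \<Delta>" "x \<in> chart_image \<tau>" "\<And>\<sigma>. \<sigma> \<in> \<Delta> \<Longrightarrow> x \<in> chart_image \<sigma> \<Longrightarrow> \<tau> \<subseteq> \<sigma>"
      using minimal_cone [OF x] by auto
    have "chart_image \<tau> \<subseteq> chart_image \<sigma> \<and> J \<tau> \<subseteq> J \<sigma>" if "\<sigma> \<in> \<Delta>" "x \<in> chart_image \<sigma>" for \<sigma>
      using chart_image_mono(1) [OF that(1) \<tau>(1) \<tau>(3) [OF that]] \<tau>(3) [OF that] by (auto simp: J_def)
    then show ?thesis using \<tau>(1,2) by (intro bexI [of _ \<tau>]) simp_all
  qed
  show "\<exists>V. openin X V \<and> x \<in> V \<and> (\<forall>y\<in>V. path_component_of (subtopology X (chart_image \<sigma>)) x y)"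
    if "\<sigma> \<in> \<Delta>" "x \<in> chart_image \<sigma>" for \<sigma> x
    using chart_locally_connected that .
  show "path_homotopic X p (\<lambda>_. p 0)"
    if "\<sigma> \<in> \<Delta>" "pathin (subtopology X (chart_image \<sigma>)) p" "p 1 = p 0" for \<sigma> p
    using chart_loops_contract that .
  show "\<exists>t\<in>T. path_component_of (subtopology X (chart_image \<sigma>)) x (e t)"
    if \<sigma>: "\<sigma> \<in> \<Delta>" and x: "x \<in> chart_image \<sigma>" for \<sigma> x
  proof -
    obtain \<mu> where \<mu>: "\<mu> \<in> N" "path_component_of (subtopology X (chart_image \<sigma>)) x (base_point \<mu>)"
      using reach_base_point [OF \<sigma> x] by blast
    \<comment> \<open>The coordinates of the class of \<open>\<mu>\<close>; base points depend only
      on this class, so that of \<open>\<mu>\<close> is the one indexed by \<open>t\<close>.\<close>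
    define t where "t = (\<lambda>i\<in>{1..n}. pairing2 (u i) \<mu>)"
    have "base_point \<mu> = e t"
      unfolding e_def
    proof (rule base_point_cong)
      fix f assume "f \<in> dual_lattice N"
      then show "pairing2 f \<mu> = pairing2 f (\<nu> t)"
        by (rule pairing2_cong [OF \<mu>(1) \<nu>_in_lattice, rotated]) (simp add: pairing2_\<nu> t_def)
    qed
    moreover have "t \<in> T" by (simp add: t_def)
    ultimately show ?thesis using \<mu>(2) by auto
  qed
  show e_in: "e t \<in> chart_image \<sigma>" if "\<sigma> \<in> \<Delta>" for \<sigma> t
    unfolding e_def by (rule base_point_in_chart(2) [OF that \<nu>_in_lattice])
  show "\<exists>\<gamma>. pathin X \<gamma> \<and> \<gamma> 0 = e t \<and> \<gamma> 1 = e (cross j t) \<and>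
      (\<forall>\<sigma>\<in>\<Delta>. j \<in> J \<sigma> \<longrightarrow> pathin (subtopology X (chart_image \<sigma>)) \<gamma>)"
    if j: "j \<in> {1..d}" for j t
  proof -
    \<comment> \<open>The path is chosen in the chart of the ray of \<open>v j\<close>. That chart
      lies in the chart of every cone containing \<open>v j\<close>, so one path serves all of
      them.\<close>
    let ?\<rho> = "convex_cone hull {v j}"
    note \<rho> = ray_in_fan [OF j]
    have jJ: "j \<in> J ?\<rho>" using j \<rho>(2) by (simp add: J_def)
    have "path_component_of (subtopology X (chart_image ?\<rho>)) (e t) (e (cross j t))"
      unfolding e_def linked_base_points [OF \<rho>(1) \<nu>_in_lattice \<nu>_in_lattice]
    proof
      fix b assume "b \<in> bas ?\<rho> - gens ?\<rho>"
      then have "b \<noteq> v j" using v_in_gens [OF \<rho>(1) jJ] by blast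
      then show "pairing2 (coord (bas ?\<rho>) b) (\<nu> t) = pairing2 (coord (bas ?\<rho>) b) (\<nu> (cross j t))"
        using pairing2_cross [OF j coord_dual_lattice [OF bas_gens(1) [OF \<rho>(1)]], of b t]
          pairing2_coord_v [OF \<rho>(1) jJ, of b] by simp
    qed
    then obtain \<gamma> where \<gamma>: "pathin (subtopology X (chart_image ?\<rho>)) \<gamma>" "\<gamma> 0 = e t" "\<gamma> 1 = e (cross j t)"
      unfolding path_component_of_def by blast
    have "pathin (subtopology X (chart_image \<sigma>)) \<gamma>" if \<sigma>: "\<sigma> \<in> \<Delta>" "j \<in> J \<sigma>" for \<sigma>
    proof -
      have "{v j} \<subseteq> gens \<sigma>" using v_in_gens [OF \<sigma>] by simp
      then have "?\<rho> \<subseteq> \<sigma>"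
        using hull_mono [of "{v j}" "gens \<sigma>" convex_cone] bas_gens(3) [OF \<sigma>(1)] by simp
      then have "chart_image ?\<rho> \<subseteq> chart_image \<sigma>"
        by (rule chart_image_mono(1) [OF \<sigma>(1) \<rho>(1)])
      then show ?thesis using \<gamma>(1) by (auto simp: pathin_subtopology)
    qed
    then show ?thesis using \<gamma> by (intro exI [of _ \<gamma>]) (simp add: pathin_subtopology)
  qed
  show "{1..d} = \<Union> (J ` \<Delta>)"
  proof
    show "{1..d} \<subseteq> \<Union> (J ` \<Delta>)"
    proof
      fix j assume j: "j \<in> {1..d}"
      then have "j \<in> J (convex_cone hull {v j})" using ray_in_fan(2) by (simp add: J_def)
      then show "j \<in> \<Union> (J ` \<Delta>)" using ray_in_fan(1) [OF j] by blast
    qed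
  qed (auto simp: J_def)
  show "\<exists>js. set js \<subseteq> J \<sigma> \<and> fold cross js t = t'"
    if \<sigma>: "\<sigma> \<in> \<Delta>" and t: "t \<in> T" "t' \<in> T"
      and path: "path_component_of (subtopology X (chart_image \<sigma>)) (e t) (e t')" for \<sigma> t t'
  proof -
    let ?c = "coord (bas \<sigma>)"
    note B = bas_gens(1) [OF \<sigma>]
    \<comment> \<open>Off the generators the two vertices already agree by
      \<open>linked_base_points\<close>; crossing exactly the labels where they differ corrects the
      remaining coordinates.\<close>
    define J' where "J' = {j \<in> J \<sigma>. pairing2 (?c (v j)) (\<nu> t) \<noteq> pairing2 (?c (v j)) (\<nu> t')}"
    define js where "js = sorted_list_of_set J'"
    have "finite J'" by (rule finite_subset [of _ "{1..d}"]) (auto simp: J'_def J_def)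
    then have js: "set js = J'" "distinct js" by (simp_all add: js_def)
    have jsJ: "set js \<subseteq> J \<sigma>" using js by (auto simp: J'_def)
    have jsd: "set js \<subseteq> {1..d}" using jsJ by (auto simp: J_def)
    have off: "pairing2 (?c b) (\<nu> t) = pairing2 (?c b) (\<nu> t')" if "b \<in> bas \<sigma> - gens \<sigma>" for b
      using path that unfolding e_def linked_base_points [OF \<sigma> \<nu>_in_lattice \<nu>_in_lattice] by blast
    have coords: "pairing2 (?c b) (\<nu> (fold cross js t)) = pairing2 (?c b) (\<nu> t')" if b: "b \<in> bas \<sigma>" for b
    proof (cases "b \<in> gens \<sigma>")
      case True
      then obtain j where j: "j \<in> J \<sigma>" "b = v j" using gens_eq_v [OF \<sigma>] by metis
      have "pairing2 (?c b) (\<nu> (fold cross js t)) = pairing2 (?c b) (\<nu> t) + (if j \<in> J' then 1 else 0)"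
        unfolding pairing2_fold_cross [OF coord_dual_lattice [OF B] jsd] j(2) sum_coord_v [OF \<sigma> js(2) jsJ j(1)] js(1) ..
      also have "\<dots> = pairing2 (?c b) (\<nu> t')"
        using j unfolding J'_def
        by (cases "pairing2 (?c b) (\<nu> t)"; cases "pairing2 (?c b) (\<nu> t')") simp_all
      finally show ?thesis .
    next
      case False
      have "(\<Sum>k\<leftarrow>js. pairing2 (?c b) (v k)) = (\<Sum>k\<leftarrow>js. 0)"
      proof (rule arg_cong [where f = sum_list], rule map_cong [OF refl])
        fix k assume "k \<in> set js"
        then have k: "k \<in> J \<sigma>" using jsJ by blast
        then have "b \<noteq> v k" using False v_in_gens [OF \<sigma> k] by blast
        then show "pairing2 (?c b) (v k) = 0" using pairing2_coord_v [OF \<sigma> k] by simp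
      qed
      then show ?thesis
        using off [of b] b False pairing2_fold_cross [OF coord_dual_lattice [OF B] jsd, of b t] by simp
    qed
    have "\<nu> (fold cross js t) - \<nu> t' \<in> (\<lambda>w. 2 *\<^sub>R w) ` N"
      unfolding double_lattice_iff_pairing2 [OF B lattice_diff [OF B \<nu>_in_lattice \<nu>_in_lattice]]
    proof
      fix b assume "b \<in> bas \<sigma>"
      then show "pairing2 (?c b) (\<nu> (fold cross js t) - \<nu> t') = 0"
        unfolding pairing2_diff [OF B coord_dual_lattice [OF B] \<nu>_in_lattice \<nu>_in_lattice] bit_add_eq_0_iff
        by (rule coords)
    qed
    then have "pairing2 f (\<nu> (fold cross js t)) = pairing2 f (\<nu> t')" if "f \<in> dual_lattice N" for f
      using pairing2_double [OF B that, of "\<nu> (fold cross js t) - \<nu> t'"]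
      unfolding pairing2_diff [OF B that \<nu>_in_lattice \<nu>_in_lattice] bit_add_eq_0_iff by simp
    from T_eqI [OF fold_cross_in_T [OF t(1)] t(2) this] have "fold cross js t = t'" .
    with jsJ show ?thesis by (intro exI [of _ js]) simp
  qed
  show "js = []"
    if \<sigma>: "\<sigma> \<in> \<Delta>" and js: "distinct js" "set js \<subseteq> J \<sigma>" and fold: "fold cross js t = t" for \<sigma> js t
  proof (rule ccontr)
    assume "js \<noteq> []"
    then obtain j where j: "j \<in> set js" by (cases js) auto
    note B = bas_gens(1) [OF \<sigma>]
    have jJ: "j \<in> J \<sigma>" using j js by blast
    have "set js \<subseteq> {1..d}" using js by (auto simp: J_def)
    \<comment> \<open>A label that occurs exactly once would change the parity of its own
      coordinate, yet the walk is closed.\<close>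
    from pairing2_fold_cross [OF coord_dual_lattice [OF B, of "v j"] this, of t]
    have "pairing2 (coord (bas \<sigma>) (v j)) (\<nu> t) = pairing2 (coord (bas \<sigma>) (v j)) (\<nu> t) + 1"
      unfolding fold sum_coord_v [OF \<sigma> js jJ] using j by simp
    then show False by (cases "pairing2 (coord (bas \<sigma>) (v j)) (\<nu> t)") simp_all
  qed
  show "origin \<in> T" by (simp add: origin_def)
  show "set (base_labels t) \<subseteq> {1..d} \<and> fold cross (base_labels t) origin = t" if "t \<in> T" for t
  proof
    show "set (base_labels t) \<subseteq> {1..d}" using n_le_d by (auto simp: base_labels_def)
    show "fold cross (base_labels t) origin = t"
      using fold_base_labels [OF that, of n] truncate_all [OF that]
      by (simp add: base_labels_def del: upt_Suc)
  qed
  show "base_labels origin = []"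
    by (auto simp: base_labels_def origin_def filter_empty_conv)
qed

text \<open>Generators of a common cone span a face of it, which belongs to the fan. The case
  \<open>p = q\<close> is included and concerns a ray.\<close>

lemma square_iff:
  "(\<exists>\<sigma>\<in>\<Delta>. p \<in> J \<sigma> \<and> q \<in> J \<sigma>) \<longleftrightarrow> p \<in> {1..d} \<and> q \<in> {1..d} \<and> convex_cone hull {v p, v q} \<in> \<Delta>"
proof
  assume "\<exists>\<sigma>\<in>\<Delta>. p \<in> J \<sigma> \<and> q \<in> J \<sigma>"
  then obtain \<sigma> where \<sigma>: "\<sigma> \<in> \<Delta>" "p \<in> J \<sigma>" "q \<in> J \<sigma>" by blast
  then have "{v p, v q} \<subseteq> gens \<sigma>" using v_in_gens by blast
  from gens_subset_cone_in_fan [OF \<sigma>(1) this] \<sigma>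
  show "p \<in> {1..d} \<and> q \<in> {1..d} \<and> convex_cone hull {v p, v q} \<in> \<Delta>" by (simp add: J_def)
next
  assume pq: "p \<in> {1..d} \<and> q \<in> {1..d} \<and> convex_cone hull {v p, v q} \<in> \<Delta>"
  then have "p \<in> J (convex_cone hull {v p, v q}) \<and> q \<in> J (convex_cone hull {v p, v q})"
    by (simp add: J_def hull_inc)
  then show "\<exists>\<sigma>\<in>\<Delta>. p \<in> J \<sigma> \<and> q \<in> J \<sigma>" using pq by blast
qed

end

theorem proposition3p1:
  fixes N :: "'a::real_vector set" and \<Delta> :: "'a set set"
    and n d :: nat
    and v :: "nat \<Rightarrow> 'a" and u :: "nat \<Rightarrow> 'a \<Rightarrow> real"
    and a :: "nat \<Rightarrow> nat \<Rightarrow> bit"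
    and b :: "nat \<Rightarrow> (nat \<Rightarrow> bit) \<Rightarrow> nat \<Rightarrow> bit"
    and c :: "nat \<Rightarrow> nat \<Rightarrow> (nat \<Rightarrow> bit) \<Rightarrow> nat \<Rightarrow> bit"
  assumes "lattice_of_rank n N"
    and "smooth_fan N \<Delta>"
    and "bij_betw v {1..d} (edge_vectors N \<Delta>)"
    and "connected_space (real_toric_variety N \<Delta>)"
    and "n \<le> d"
    and "mod2_basis N n v"
    and "mod2_dual_basis N n v u"
    and "\<And>j i. a j i = pairing2 (u i) (v j)"
    and "\<And>j t. b j t = (\<lambda>i\<in>{1..n}. t i + a j i)"
    and "\<And>p q t. c p q t = (\<lambda>i\<in>{1..n}. t i + a p i + a q i)"
    and "x \<in> topspace (real_toric_variety N \<Delta>)"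
  shows "fundamental_group (real_toric_variety N \<Delta>) x \<cong>
    presented_group ({1..d} \<times> Z2_vectors n)
      ({base_path_word n t | t. t \<in> Z2_vectors n} \<union>
       {[y_letter j t, y_letter j (b j t)] | j t. j \<in> {1..d} \<and> t \<in> Z2_vectors n} \<union>
       {[y_letter p t, y_letter q (b p t), y_letter p (c p q t), y_letter q (b q t)] | p q t.
          p \<in> {1..d} \<and> q \<in> {1..d} \<and> t \<in> Z2_vectors n \<and> convex_cone hull {v p, v q} \<in> \<Delta>})"
proof -
  interpret numbered_smooth_fan N \<Delta> n d v u
    using assms by unfold_locales
  have b: "b j t = cross j t" for j t
    by (simp add: assms(8,9) cross_def)
  \<comment> \<open>The index of the third letter is the vertex reached after crossing
    \<open>p\<close> and then \<open>q\<close>.\<close>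
  have c: "c p q t = cross q (cross p t)" for p q t
    unfolding assms(10) by (auto simp: assms(8) cross_def simp del: add_bit_eq_xor intro!: restrict_ext)
  \<comment> \<open>The two crossings of \<open>p\<close> cancel, so the fourth letter of the square
    relator starts at \<open>cross q t\<close>, in agreement with its stated index.\<close>
  have square: "cross p (cross q (cross p t)) = cross q t" if "t \<in> T" "p \<in> {1..d}" "q \<in> {1..d}" for p q t
  proof -
    have "cross p (cross q (cross p t)) = cross p (cross p (cross q t))"
      using atlas.b_comm [of q p t] that by simp
    also have "\<dots> = cross q t" using atlas.b_invol [of p "cross q t"] that cross_in_T by simp
    finally show ?thesis .
  qed
  have 1: "{base_path_word n t | t. t \<in> T} = {walk_word cross origin (base_labels t) | t. t \<in> T}"
    by (intro Collect_cong iff_exI rev_conj_cong refl) (simp only: base_word)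
  have 2: "{[y_letter j t, y_letter j (b j t)] | j t. j \<in> {1..d} \<and> t \<in> T} =
      {walk_word cross t [j, j] | j t. j \<in> {1..d} \<and> t \<in> T}"
  proof -
    have "[y_letter j t, y_letter j (b j t)] = walk_word cross t [j, j]" for j t
      by (simp add: b y_letter_def)
    then show ?thesis by (simp only:)
  qed
  have 3: "{[y_letter p t, y_letter q (b p t), y_letter p (c p q t), y_letter q (b q t)] | p q t.
          p \<in> {1..d} \<and> q \<in> {1..d} \<and> t \<in> T \<and> convex_cone hull {v p, v q} \<in> \<Delta>} =
      {walk_word cross t [p, q, p, q] | p q t. t \<in> T \<and> (\<exists>\<sigma>\<in>\<Delta>. p \<in> J \<sigma> \<and> q \<in> J \<sigma>)}" (is "?L = ?R")
  proof -
    have word: "[y_letter p t, y_letter q (b p t), y_letter p (c p q t), y_letter q (b q t)] = walk_word cross t [p, q, p, q]"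
      if "t \<in> T" "p \<in> {1..d}" "q \<in> {1..d}" for p q t
      using square [OF that] by (simp add: b c y_letter_def)
    show ?thesis
    proof (intro subset_antisym subsetI)
      fix r assume "r \<in> ?L"
      then obtain p q t where r: "r = [y_letter p t, y_letter q (b p t), y_letter p (c p q t), y_letter q (b q t)]"
        and pqt: "p \<in> {1..d}" "q \<in> {1..d}" "t \<in> T" "convex_cone hull {v p, v q} \<in> \<Delta>"
        by (elim CollectE exE conjE)
      have w: "r = walk_word cross t [p, q, p, q]"
        by (rule trans [OF r word [OF pqt(3,1,2)]])
      have sq: "\<exists>\<sigma>\<in>\<Delta>. p \<in> J \<sigma> \<and> q \<in> J \<sigma>"
        by (rule iffD2 [OF square_iff]) (intro conjI pqt)
      show "r \<in> ?R"
        by (intro CollectI exI conjI) (rule w, rule pqt(3), rule sq)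
    next
      fix r assume "r \<in> ?R"
      then obtain p q t where r: "r = walk_word cross t [p, q, p, q]" "t \<in> T" "\<exists>\<sigma>\<in>\<Delta>. p \<in> J \<sigma> \<and> q \<in> J \<sigma>"
        by (elim CollectE exE conjE)
      have pqt: "p \<in> {1..d}" "q \<in> {1..d}" "convex_cone hull {v p, v q} \<in> \<Delta>"
        using iffD1 [OF square_iff r(3)] by blast+
      have w: "r = [y_letter p t, y_letter q (b p t), y_letter p (c p q t), y_letter q (b q t)]"
        by (rule trans [OF r(1) word [OF r(2) pqt(1,2), symmetric]])
      show "r \<in> ?L"
        by (intro CollectI exI conjI) (rule w, rule pqt(1), rule pqt(2), rule r(2), rule pqt(3))
    qed
  qed
  show ?thesis
    unfolding 1 2 3 using atlas.fundamental_group_iso [of x] assms(11)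
    unfolding X_def atlas.relators_def by simp
qed

end
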